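(* Let $n\ge1$, $a_1,\dots,a_n\in\mathbb C^\times$, and let $\alpha_i,\beta_i\in\mathbb C$ satisfy $\alpha_i-\beta_i=l_i\in\mathbb Z_{\ge0}$ $(1\le i\le n)$. Let $L(P)=V_{l_1}(\tilde a_1)\,\widetilde\otimes\cdots\widetilde\otimes\,V_{l_n}(\tilde a_n)$, $\tilde a_i=q^{-\alpha_i-\beta_i+2}a_i$, be a level-0 finite-dimensional irreducible representation of $U_{q,p}(\widehat{\mathfrak{gl}}_2)$, normalized so that its highest weight vector $\zeta$ satisfies $k_1^+(z)\zeta=\prod_i\theta(q^{2\alpha_i}z/a_i)\zeta$ and $k_2^+(z)\zeta=\prod_i\theta(q^{2\beta_i}z/a_i)\zeta$. For $\gamma=(\gamma_1,\dots,\gamma_n)\in\mathbb C^n$ satisfying $$(\ast)\qquad \alpha_i-\gamma_i\in\mathbb Z_{\ge0},\quad\gamma_i-\beta_i\in\mathbb Z_{\ge0}\qquad(1\le i\le n)$$ put $$\xi_\gamma=\prod_{i=1}^nB_2(q^{-2(\gamma_i-1)}a_i)B_2(q^{-2(\gamma_i-2)}a_i)\cdots B_2(q^{-2\beta_i}a_i)\cdot\zeta,\qquad \xi_\beta=\zeta .$$ Then the set of vectors $\{\xi_\gamma\}$ with $\gamma$ satisfying $(\ast)$ forms a basis of $L(P)$. Moreover, for $j\in\{1,\dots,n\}$, $$A_1(z)\xi_\gamma=\prod_{i=1}^n\theta(q^{2\alpha_i}z/a_i)\theta(q^{2(\beta_i-1)}z/a_i)\,\xi_\gamma,\qquad A_2(z)\xi_\gamma=\prod_{i=1}^n\theta(q^{2\gamma_i}z/a_i)\,\xi_\gamma,$$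 $$B_2(q^{-2\gamma_j}a_j)\xi_\gamma=\xi_{\gamma+\delta_j},$$ $$C_2(q^{-2\gamma_j}a_j)\xi_\gamma=-\Delta^{(n-1)}\!\left(\frac{\theta(q^2\Pi^* )}{\theta(\Pi^* )}\right)\prod_{i=1}^n\theta(q^{2(\alpha_i-\gamma_j+1)}a_j/a_i)\,\theta(q^{2(\beta_i-\gamma_j)}a_j/a_i)\;\xi_{\gamma-\delta_j},$$ where $\gamma\pm\delta_j=(\gamma_1,\dots,\gamma_j\pm1,\dots,\gamma_n)$, $\Pi^*=\Pi^*_{1,2}$, and $\xi_{\gamma\pm\delta_j}$ is considered to be zero if $\gamma\pm\delta_j$ does not satisfy $(\ast)$.
   Context: Notation. $q,p\in\mathbb C^\times$ are generic, $|q|,|p|<1$; $(x;p)_\infty=\prod_{n\ge0}(1-xp^n)$, $\Theta_p(z)=(z;p)_\infty(p/z;p)_\infty(p;p)_\infty$, $\theta(z)=-z^{-1/2}\Theta_p(z)$. Take $N=2$. $P_{\epsilon_l},Q_{\epsilon_l}$ satisfy $[P_{\epsilon_k},Q_{\epsilon_l}]=\delta_{k,l}$; $h_{\epsilon_l}$ are the Cartan generators of $\mathfrak{gl}_N$; $\mathbb F$ is the field of meromorphic functions of the $P_{\epsilon_l}$ and $(P+h)_{\epsilon_l}=P_{\epsilon_l}+h_{\epsilon_l}$. Put $\Pi_{j,k}=q^{2((P+h)_{\epsilon_j}-(P+h)_{\epsilon_k})}$, $\Pi^*_{j,k}=q^{2(P_{\epsilon_j}-P_{\epsilon_k})}$.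 $\overline R(z,\Pi)=\sum_jE_{jj}\otimes E_{jj}+\sum_{j<k}\big(b(z,\Pi_{j,k})E_{jj}\otimes E_{kk}+\bar b(z)E_{kk}\otimes E_{jj}+c(z,\Pi_{j,k})E_{jk}\otimes E_{kj}+\bar c(z,\Pi_{j,k})E_{kj}\otimes E_{jk}\big)$ with $b(z,\Pi)=\frac{\theta(q^2\Pi)\theta(q^{-2}\Pi)\theta(z)}{\theta(\Pi)^2\theta(q^2z)}$, $\bar b(z)=\frac{\theta(z)}{\theta(q^2z)}$, $c(z,\Pi)=\frac{\theta(q^2)\theta(z\Pi)}{\theta(\Pi)\theta(q^2z)}$, $\bar c(z,\Pi)=\frac{\theta(q^2)\theta(z\Pi^{-1})}{\theta(\Pi^{-1})\theta(q^2z)}$. The algebra at level 0 (central elements $q^{\pm c/2}$ acting as 1). $U_{q,p}(\widehat{\mathfrak{gl}}_2)\cong E_{q,p}(\widehat{\mathfrak{gl}}_2)$ is generated over $\mathbb F[[p]]$ by $\bar L_{ij,n}$; with $L^+_{ij}(z)=\sum_np^{\max(n,0)}\bar L_{ij,n}z^{-n}$ the relations are $\overline R^{(12)}(z_1/z_2,\Pi)L^{+(1)}(z_1)L^{+(2)}(z_2)=L^{+(2)}(z_2)L^{+(1)}(z_1)\overline R^{(12)}(z_1/z_2,\Pi^* )$ and $g(P+h)\bar L_{ij,n}=\bar L_{ij,n}g(P+h-\epsilon_i)$, $g(P)\bar L_{ij,n}=\bar L_{ij,n}g(P-\epsilon_j)$ (where $g(P-\epsilon_j)$ means $P_{\epsilon_k}\mapsto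 P_{\epsilon_k}-\delta_{jk}$). Operators: $k_2^+(z)=A_2(z)=L_{22}^+(z)$, $B_2(z)=L^+_{12}(z)$, $C_2(z)=L^+_{21}(z)$, $k_1^+(z)=L^+_{11}(z)-L^+_{12}(z)L^+_{22}(z)^{-1}L^+_{21}(z)$, and $A_1(z)=k_1^+(z)k_2^+(q^{-2}z)$ (the quantum determinant). Representations. A highest weight vector $\zeta\ne0$ generates the module and satisfies $L_{21}^+(z)\zeta=0$ with $L^+_{11}(z),L^+_{22}(z)$ (equivalently $k_1^+(z),k_2^+(z)$) acting by scalar functions. Multiplying $L^+(z)$ by a scalar function of $z$ is an automorphism of the algebra; representations are considered up to twisting by such automorphisms. $V_{l_i}(\tilde a_i)$ is the $(l_i+1)$-dimensional irreducible level-0 highest weight representation which after such a twist has highest weight $(\theta(q^{2\alpha_i}z/a_i),\theta(q^{2\beta_i}z/a_i))$; with $v_0^{l_i}$ its highest weight vector, $\zeta=v_0^{l_1}\widetilde\otimes\cdots\widetilde\otimes v_0^{l_n}$. $V\,\widetilde\otimes\,W$ is $V\otimes W$ modulo $g(P)v\otimes w=v\otimes g(P+h)w$, with action through $\Delta(L^+_{ij}(z))=\sum_kL^+_{ik}(z)\otimes L^+_{kj}(z)$, $\Delta(g(P+h))=g(P+h)\otimes1$, $\Delta(g(P))=1\otimes g(P)$. $\Delta^{(n-1)}(g(\Pi^* ))$ denotes the action of the function $g(\Pi^* )$ on the $n$-fold tensor product via the iterated comultiplication. The operators $B_2(z),B_2(w)$ commute, so the order of factors in $\xi_\gamma$ is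 immaterial.
   Formalization: Added hypothesis: for i≠j no point q^{-2γ_i}a_i with γ_i in β_i,…,α_i equals, modulo powers of p, a point q^{-2γ_j}a_j with γ_j in β_j,…,α_j-1; otherwise the ξ_γ are no basis, e.g. for n=2, a_1=a_2, α=(1,1), β=(0,0) one has ξ_(1,0)=ξ_(0,1). *)

theory Defs
  imports
    "HOL-Complex_Analysis.Complex_Analysis"
    "HOL-Computational_Algebra.Fraction_Field"
    "HOL-Library.Poly_Mapping"
begin

section \<open>The field of meromorphic functions of two complex variables\<close>

definition entire_on_C2 :: "(complex \<times> complex \<Rightarrow> complex) \<Rightarrow> bool" where
  "entire_on_C2 f \<longleftrightarrow>
     (\<forall>x. \<exists>a b. (f has_derivative (\<lambda>h. a * fst h + b * snd h)) (at x))"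

typedef entire2 = "{f. entire_on_C2 f}"
  by (rule exI[of _ "\<lambda>_. 0"])
    (auto simp: entire_on_C2_def intro!: exI[of _ "0::complex"])

setup_lifting type_definition_entire2

lemma entire_on_C2_const: "entire_on_C2 (\<lambda>_. c)"
  by (auto simp: entire_on_C2_def intro!: exI[of _ "0::complex"])

lemma entire_on_C2_add:
  assumes "entire_on_C2 f" "entire_on_C2 g"
  shows "entire_on_C2 (\<lambda>x. f x + g x)"
  unfolding entire_on_C2_def
proof
  fix x
  obtain a b where f: "(f has_derivative (\<lambda>h. a * fst h + b * snd h)) (at x)"
    using assms(1) unfolding entire_on_C2_def by blast
  obtain c d where g: "(g has_derivative (\<lambda>h. c * fst h + d * snd h)) (at x)"
    using assms(2) unfolding entire_on_C2_def by blast
  have "((\<lambda>x. f x + g x) has_derivative (\<lambda>h. (a + c) * fst h + (b + d) * snd h)) (at x)"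
    using has_derivative_add[OF f g] by (simp add: algebra_simps)
  then show "\<exists>a b. ((\<lambda>x. f x + g x) has_derivative (\<lambda>h. a * fst h + b * snd h)) (at x)"
    by blast
qed

lemma entire_on_C2_mult:
  assumes "entire_on_C2 f" "entire_on_C2 g"
  shows "entire_on_C2 (\<lambda>x. f x * g x)"
  unfolding entire_on_C2_def
proof
  fix x
  obtain a b where f: "(f has_derivative (\<lambda>h. a * fst h + b * snd h)) (at x)"
    using assms(1) unfolding entire_on_C2_def by blast
  obtain c d where g: "(g has_derivative (\<lambda>h. c * fst h + d * snd h)) (at x)"
    using assms(2) unfolding entire_on_C2_def by blast
  have "((\<lambda>x. f x * g x) has_derivative
      (\<lambda>h. (f x * c + a * g x) * fst h + (f x * d + b * g x) * snd h)) (at x)"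
    using has_derivative_mult[OF f g] by (simp add: algebra_simps)
  then show "\<exists>a b. ((\<lambda>x. f x * g x) has_derivative (\<lambda>h. a * fst h + b * snd h)) (at x)"
    by blast
qed

lemma entire_on_C2_uminus: "entire_on_C2 f \<Longrightarrow> entire_on_C2 (\<lambda>x. - f x)"
  using entire_on_C2_mult[OF entire_on_C2_const[of "-1"], of f] by simp

lemma entire_on_C2_line:
  assumes "entire_on_C2 f"
  shows "(\<lambda>t. f (x + (t * u, t * v))) holomorphic_on UNIV"
proof -
  have "(\<lambda>t. f (x + (t * u, t * v))) field_differentiable (at t)" for t
  proof -
    obtain a b where
      f: "(f has_derivative (\<lambda>h. a * fst h + b * snd h)) (at (x + (t * u, t * v)))"
      using assms unfolding entire_on_C2_def by blast
    have l: "((\<lambda>t. x + (t * u, t * v)) has_derivative (\<lambda>h. (h * u, h * v))) (at t)"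
      by (auto intro!: derivative_eq_intros has_derivative_Pair)
    have "((\<lambda>t. f (x + (t * u, t * v))) has_derivative
        (\<lambda>h. a * fst (h * u, h * v) + b * snd (h * u, h * v))) (at t)"
      using has_derivative_compose[OF l f] .
    then have "((\<lambda>t. f (x + (t * u, t * v))) has_derivative (\<lambda>h. (a * u + b * v) * h)) (at t)"
      by (simp add: algebra_simps)
    then show ?thesis
      unfolding field_differentiable_def has_field_derivative_def by blast
  qed
  then show ?thesis
    by (simp add: holomorphic_on_def)
qed

lemma entire_on_C2_no_zero_divisors:
  assumes f: "entire_on_C2 f" and g: "entire_on_C2 g" and fg: "\<And>x. f x * g x = 0"
    and fx: "f x \<noteq> 0" and gy: "g y \<noteq> 0"
  shows False
proof -
  define l where "l t = x + (t * fst (y - x), t * snd (y - x))" for t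
  have hf: "(\<lambda>t. f (l t)) holomorphic_on UNIV" and hg: "(\<lambda>t. g (l t)) holomorphic_on UNIV"
    unfolding l_def by (rule entire_on_C2_line[OF f], rule entire_on_C2_line[OF g])
  have l0: "l 0 = x" and l1: "l 1 = y"
    by (auto simp: l_def prod_eq_iff)
  have c: "continuous_on UNIV (\<lambda>t. f (l t))"
    using hf holomorphic_on_imp_continuous_on by blast
  have o: "open ((\<lambda>t. f (l t)) -` (- {0}))"
    using c by (intro open_vimage) auto
  have "g (l 1) = 0"
  proof (rule analytic_continuation_open
      [where f="\<lambda>t. g (l t)" and g="\<lambda>_. 0" and s="(\<lambda>t. f (l t)) -` (- {0})" and s'=UNIV])
    show "open ((\<lambda>t. f (l t)) -` (- {0}))" by (rule o)
    show "(\<lambda>t. f (l t)) -` (- {0}) \<noteq> {}" using fx l0 by auto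
    show "(\<lambda>t. g (l t)) holomorphic_on UNIV" by (rule hg)
    show "g (l t) = 0" if "t \<in> (\<lambda>t. f (l t)) -` (- {0})" for t
      using fg[of "l t"] that by simp
  qed auto
  with gy l1 show False by simp
qed

instantiation entire2 :: idom
begin

lift_definition zero_entire2 :: entire2 is "\<lambda>_. 0"
  by (rule entire_on_C2_const)
lift_definition one_entire2 :: entire2 is "\<lambda>_. 1"
  by (rule entire_on_C2_const)
lift_definition plus_entire2 :: "entire2 \<Rightarrow> entire2 \<Rightarrow> entire2" is "\<lambda>f g x. f x + g x"
  by (rule entire_on_C2_add)
lift_definition times_entire2 :: "entire2 \<Rightarrow> entire2 \<Rightarrow> entire2" is "\<lambda>f g x. f x * g x"
  by (rule entire_on_C2_mult)
lift_definition uminus_entire2 :: "entire2 \<Rightarrow> entire2" is "\<lambda>f x. - f x"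
  by (rule entire_on_C2_uminus)
definition minus_entire2 :: "entire2 \<Rightarrow> entire2 \<Rightarrow> entire2" where
  "minus_entire2 f g = f + - g"

instance
proof
  fix f g h :: entire2
  show "f + g + h = f + (g + h)" by transfer (simp add: add.assoc)
  show "f + g = g + f" by transfer (simp add: add.commute)
  show "0 + f = f" by transfer simp
  show "- f + f = 0" by transfer simp
  show "f - g = f + - g" by (simp add: minus_entire2_def)
  show "f * g * h = f * (g * h)" by transfer (simp add: mult.assoc)
  show "f * g = g * f" by transfer (simp add: mult.commute)
  show "1 * f = f" by transfer simp
  show "0 * f = 0" by transfer simp
  show "f * 0 = 0" by transfer simp
  show "f * (g + h) = f * g + f * h" by transfer (simp add: distrib_left)
  show "(f + g) * h = f * h + g * h" by transfer (simp add: distrib_right)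
  show "(0::entire2) \<noteq> 1" by transfer (simp add: fun_eq_iff)
  show "f \<noteq> 0 \<Longrightarrow> g \<noteq> 0 \<Longrightarrow> f * g \<noteq> 0"
    by transfer (metis entire_on_C2_no_zero_divisors)
qed

end

text \<open>Every meromorphic function on \<open>\<complex>\<^sup>2\<close> is a quotient of two entire functions (Poincare, Cousin),
  so the field of meromorphic functions of \<open>P = (P\<^sub>\<epsilon>\<^sub>1, P\<^sub>\<epsilon>\<^sub>2)\<close> is the fraction field of the
  ring of entire functions.\<close>

type_synonym merof = "entire2 fract"

definition mero :: "(complex \<times> complex \<Rightarrow> complex) \<Rightarrow> merof" where
  "mero f = Fract (Abs_entire2 f) 1"

abbreviation const :: "complex \<Rightarrow> merof" where
  "const c \<equiv> mero (\<lambda>_. c)"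

lemma entire_on_C2_shift:
  fixes m :: "complex \<times> complex"
  assumes "entire_on_C2 f"
  shows "entire_on_C2 (\<lambda>x. f (x + m))"
  unfolding entire_on_C2_def
proof
  fix x :: "complex \<times> complex"
  obtain a b where d: "(f has_derivative (\<lambda>h. a * fst h + b * snd h)) (at (x + m))"
    using assms unfolding entire_on_C2_def by blast
  have "((\<lambda>x. x + m) has_derivative (\<lambda>h. h)) (at x)"
    using has_derivative_add[OF has_derivative_ident has_derivative_const[of m]] by (simp only: add_0_right)
  then have "((\<lambda>x. f (x + m)) has_derivative (\<lambda>h. a * fst h + b * snd h)) (at x)"
    using has_derivative_compose[where f="\<lambda>x. x + m" and g=f, OF _ d] by blast
  then show "\<exists>a b. ((\<lambda>x. f (x + m)) has_derivative (\<lambda>h. a * fst h + b * snd h)) (at x)"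
    by blast
qed

definition shift_entire :: "complex \<times> complex \<Rightarrow> entire2 \<Rightarrow> entire2" where
  "shift_entire m f = Abs_entire2 (\<lambda>x. Rep_entire2 f (x + m))"

lemma Rep_shift_entire: "Rep_entire2 (shift_entire m f) x = Rep_entire2 f (x + m)"
  using Rep_entire2[of f] entire_on_C2_shift[of "Rep_entire2 f" m]
  by (simp add: shift_entire_def Abs_entire2_inverse)

lemma shift_entire_mult: "shift_entire m (f * g) = shift_entire m f * shift_entire m g"
  by (simp add: Rep_entire2_inject[symmetric] fun_eq_iff Rep_shift_entire times_entire2.rep_eq)

lemma shift_entire_eq_0_iff: "shift_entire m f = 0 \<longleftrightarrow> f = 0"
proof
  assume *: "shift_entire m f = 0"
  have "Rep_entire2 f x = Rep_entire2 (shift_entire m f) (x - m)" for x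
    by (simp add: Rep_shift_entire)
  then have "Rep_entire2 f x = 0" for x
    by (simp add: * zero_entire2.rep_eq)
  then show "f = 0"
    by (simp add: Rep_entire2_inject[symmetric] zero_entire2.rep_eq fun_eq_iff)
next
  assume "f = 0"
  then show "shift_entire m f = 0"
    by (simp only: Rep_entire2_inject[symmetric] fun_eq_iff Rep_shift_entire zero_entire2.rep_eq)
      simp
qed

text \<open>\<open>shift m g\<close> is the function \<open>g(P + m)\<close>.\<close>

lift_definition shift :: "complex \<times> complex \<Rightarrow> merof \<Rightarrow> merof"
  is "\<lambda>m x. (shift_entire m (fst x), shift_entire m (snd x))"
proof -
  fix m :: "complex \<times> complex" and x y :: "entire2 \<times> entire2"
  assume *: "fractrel x y"
  then have "fst x * snd y = fst y * snd x"
    by simp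
  then have "shift_entire m (fst x) * shift_entire m (snd y) =
      shift_entire m (fst y) * shift_entire m (snd x)"
    by (simp only: shift_entire_mult[symmetric])
  with * show "fractrel (shift_entire m (fst x), shift_entire m (snd x))
      (shift_entire m (fst y), shift_entire m (snd y))"
    by (simp add: shift_entire_eq_0_iff)
qed

lemma shift_Fract: "shift m (Fract f g) = Fract (shift_entire m f) (shift_entire m g)"
  by transfer (auto simp: shift_entire_eq_0_iff)

definition epsilon :: "nat \<Rightarrow> complex \<times> complex" where
  "epsilon j = (if j = 1 then (1, 0) else (0, 1))"


section \<open>Theta functions and the dynamical R-matrix\<close>

definition qpochhammer_inf :: "complex \<Rightarrow> complex \<Rightarrow> complex" where
  "qpochhammer_inf x p = prodinf (\<lambda>n. 1 - x * p ^ n)"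

definition Theta :: "complex \<Rightarrow> complex \<Rightarrow> complex" where
  "Theta p z = qpochhammer_inf z p * qpochhammer_inf (p / z) p * qpochhammer_inf p p"

text \<open>Because of the factor \<open>z\<^bsup>-1/2\<^esup>\<close> the function \<open>\<theta>\<close> lives on the universal cover of \<open>\<complex>\<^sup>\<times>\<close>. It
  is written in the additive variable \<open>u\<close> with \<open>z = q\<^bsup>2u\<^esup>\<close>: \<open>\<theta>(q\<^bsup>2u\<^esup>) = th q p u\<close>.\<close>

definition th :: "complex \<Rightarrow> complex \<Rightarrow> complex \<Rightarrow> complex" where
  "th q p u = - (q powr (- u)) * Theta p (q powr (2 * u))"

lemma entire_on_C2_compose:
  assumes f: "f holomorphic_on UNIV"
  shows "entire_on_C2 (\<lambda>P. f (c + d * (fst P - snd P)))"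
  unfolding entire_on_C2_def
proof
  fix x
  obtain f' where "(f has_field_derivative f') (at (c + d * (fst x - snd x)))"
    using f unfolding holomorphic_on_def field_differentiable_def by auto
  then have f': "(f has_derivative (*) f') (at (c + d * (fst x - snd x)))"
    by (simp add: has_field_derivative_def)
  have l: "((\<lambda>P. c + d * (fst P - snd P)) has_derivative (\<lambda>h. d * (fst h - snd h))) (at x)"
    by (auto intro!: derivative_eq_intros)
  have "((\<lambda>P. f (c + d * (fst P - snd P))) has_derivative
      (\<lambda>h. (f' * d) * fst h + (- f' * d) * snd h)) (at x)"
    using has_derivative_compose[OF l f'] by (simp add: algebra_simps)
  then show "\<exists>a b. ((\<lambda>P. f (c + d * (fst P - snd P))) has_derivative
      (\<lambda>h. a * fst h + b * snd h)) (at x)"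
    by blast
qed

lemma qpochhammer_inf_holomorphic:
  assumes "norm p < 1"
  shows "(\<lambda>x. qpochhammer_inf x p) holomorphic_on UNIV"
proof -
  have conv: "uniformly_convergent_on (cball 0 R) (\<lambda>N x. \<Prod>n<N. 1 - x * p ^ n)" for R :: real
  proof (rule uniformly_convergent_on_prod')
    show "uniformly_convergent_on (cball 0 R) (\<lambda>N x. \<Sum>n<N. norm ((1 - x * p ^ n) - 1))"
    proof (rule Weierstrass_m_test')
      show "norm (norm ((1 - x * p ^ n) - 1)) \<le> R * norm p ^ n" if "x \<in> cball 0 R" for n x
        using that by (simp add: norm_mult norm_power mult_right_mono)
      show "summable (\<lambda>n. R * norm p ^ n)"
        using assms by (intro summable_mult summable_geometric) simp
    qed
  qed (auto intro!: continuous_intros)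
  have lim: "uniform_limit (cball 0 R) (\<lambda>N x. \<Prod>n<N. 1 - x * p ^ n)
      (\<lambda>x. qpochhammer_inf x p) sequentially" for R :: real
  proof -
    obtain g where g: "uniform_limit (cball 0 R) (\<lambda>N x. \<Prod>n<N. 1 - x * p ^ n) g sequentially"
      using conv[of R] by (auto simp: uniformly_convergent_on_def)
    have "g x = qpochhammer_inf x p" if "x \<in> cball 0 R" for x
    proof -
      have "summable (\<lambda>n. norm ((1 - x * p ^ n) - 1))"
        using assms by (simp add: norm_mult norm_power summable_mult summable_geometric)
      then have "convergent_prod (\<lambda>n. 1 - x * p ^ n)"
        by (intro abs_convergent_prod_imp_convergent_prod summable_imp_abs_convergent_prod)
      then have "(\<lambda>n. \<Prod>k\<le>n. 1 - x * p ^ k) \<longlonglongrightarrow> qpochhammer_inf x p"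
        unfolding qpochhammer_inf_def by (rule convergent_prod_LIMSEQ)
      moreover have "(\<lambda>n. \<Prod>k\<le>n. 1 - x * p ^ k) \<longlonglongrightarrow> g x"
        using LIMSEQ_Suc[OF tendsto_uniform_limitI[OF g that]] by (simp add: lessThan_Suc_atMost)
      ultimately show ?thesis
        using LIMSEQ_unique by blast
    qed
    then show ?thesis
      using uniform_limit_cong'[of "cball 0 R" "\<lambda>N x. \<Prod>n<N. 1 - x * p ^ n"
          "\<lambda>N x. \<Prod>n<N. 1 - x * p ^ n" g "\<lambda>x. qpochhammer_inf x p" sequentially] g
      by simp
  qed
  show ?thesis
  proof (rule holomorphic_uniform_sequence)
    fix z :: complex
    have "uniform_limit (cball z 1) (\<lambda>N x. \<Prod>n<N. 1 - x * p ^ n)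
        (\<lambda>x. qpochhammer_inf x p) sequentially"
      by (rule uniform_limit_on_subset[OF lim[of "norm z + 1"]]) (simp add: cball_subset_cball_iff)
    then show "\<exists>d>0. cball z d \<subseteq> UNIV \<and> uniform_limit (cball z d)
        (\<lambda>N x. \<Prod>n<N. 1 - x * p ^ n) (\<lambda>x. qpochhammer_inf x p) sequentially"
      by (intro exI[of _ 1]) auto
  qed (auto intro!: holomorphic_intros)
qed

lemma th_holomorphic:
  assumes "norm p < 1" "q \<noteq> 0"
  shows "th q p holomorphic_on UNIV"
proof -
  note h = holomorphic_on_compose[OF _ holomorphic_on_subset
      [OF qpochhammer_inf_holomorphic[OF assms(1)]], unfolded o_def]
  have "(\<lambda>u. qpochhammer_inf (q powr (2 * u)) p) holomorphic_on UNIV"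
    by (rule h) (use assms in \<open>auto intro!: holomorphic_intros\<close>)
  moreover have "(\<lambda>u. qpochhammer_inf (p / q powr (2 * u)) p) holomorphic_on UNIV"
    by (rule h) (use assms in \<open>auto intro!: holomorphic_intros\<close>)
  ultimately have "(\<lambda>u. - (q powr (- u)) * Theta p (q powr (2 * u))) holomorphic_on UNIV"
    unfolding Theta_def using assms by (intro holomorphic_intros) auto
  then show ?thesis
    by (simp add: th_def[abs_def])
qed

text \<open>\<open>thPi q p c\<close> and \<open>thPi_inv q p c\<close> are \<open>\<theta>(q\<^bsup>2c\<^esup>\<Pi>)\<close> and \<open>\<theta>(q\<^bsup>2c\<^esup>\<Pi>\<^sup>-\<^sup>1)\<close> as functions of \<open>P\<close>, where
  \<open>\<Pi> = q\<^bsup>2(P\<^sub>1 - P\<^sub>2)\<^esup>\<close>.\<close>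

definition thPi :: "complex \<Rightarrow> complex \<Rightarrow> complex \<Rightarrow> merof" where
  "thPi q p c = mero (\<lambda>P. th q p (c + (fst P - snd P)))"

definition thPi_inv :: "complex \<Rightarrow> complex \<Rightarrow> complex \<Rightarrow> merof" where
  "thPi_inv q p c = mero (\<lambda>P. th q p (c - (fst P - snd P)))"

text \<open>The arguments of \<open>mero\<close> here are indeed entire, so that they represent themselves.\<close>

lemma
  assumes "norm p < 1" "q \<noteq> 0"
  shows thPi_entire: "entire_on_C2 (\<lambda>P. th q p (c + (fst P - snd P)))"
    and thPi_inv_entire: "entire_on_C2 (\<lambda>P. th q p (c - (fst P - snd P)))"
  using entire_on_C2_compose[OF th_holomorphic[OF assms], of c 1]
    entire_on_C2_compose[OF th_holomorphic[OF assms], of c "-1"]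
  by (simp_all add: algebra_simps)

text \<open>The entry of \<open>R(q\<^bsup>2w\<^esup>, \<Pi>)\<close> in row \<open>(i, j)\<close> and column \<open>(k, l)\<close>, i.e. the coefficient of
  \<open>E\<^sub>i\<^sub>k \<otimes> E\<^sub>j\<^sub>l\<close>.\<close>

definition Rbar :: "complex \<Rightarrow> complex \<Rightarrow> complex \<Rightarrow> nat \<Rightarrow> nat \<Rightarrow> nat \<Rightarrow> nat \<Rightarrow> merof" where
  "Rbar q p w i j k l =
    (if (i, j, k, l) = (1, 1, 1, 1) \<or> (i, j, k, l) = (2, 2, 2, 2) then 1
     else if (i, j, k, l) = (1, 2, 1, 2) then
       thPi q p 1 * thPi q p (-1) * const (th q p w) / ((thPi q p 0)^2 * const (th q p (w + 1)))
     else if (i, j, k, l) = (2, 1, 2, 1) then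
       const (th q p w) / const (th q p (w + 1))
     else if (i, j, k, l) = (1, 2, 2, 1) then
       const (th q p 1) * thPi q p w / (thPi q p 0 * const (th q p (w + 1)))
     else if (i, j, k, l) = (2, 1, 1, 2) then
       const (th q p 1) * thPi_inv q p w / (thPi_inv q p 0 * const (th q p (w + 1)))
     else 0)"

definition generic_pq :: "complex \<Rightarrow> complex \<Rightarrow> bool" where
  "generic_pq q p \<longleftrightarrow> 0 < norm q \<and> norm q < 1 \<and> 0 < norm p \<and> norm p < 1 \<and>
     (\<forall>m k :: int. q powi m = p powi k \<longrightarrow> m = 0 \<and> k = 0)"


section \<open>Level-0 dynamical representations\<close>

text \<open>The function \<open>g(P)\<close> acts as the scalar \<open>g\<close> of an ambient vector space over the field of
  meromorphic functions, with scalar multiplication \<open>sc\<close>; the representation space \<open>rep_space R\<close> is a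
  subspace. \<open>actPh R g\<close> is the action of \<open>g(P + h)\<close>, \<open>mode R i j n\<close> that of \<open>\<bar>L\<^sub>i\<^sub>j\<^sub>,\<^sub>n\<close>, and
  \<open>cur R i j z\<close> that of \<open>L\<^sup>+\<^sub>i\<^sub>j(z)\<close>.\<close>

record 'v drep =
  rep_space :: "'v set"
  actPh :: "merof \<Rightarrow> 'v \<Rightarrow> 'v"
  mode :: "nat \<Rightarrow> nat \<Rightarrow> int \<Rightarrow> 'v \<Rightarrow> 'v"
  cur :: "nat \<Rightarrow> nat \<Rightarrow> complex \<Rightarrow> 'v \<Rightarrow> 'v"

text \<open>\<open>\<phi>(z) = \<Sum>\<^sub>n c\<^sub>n z\<^bsup>-n\<^esup>\<close> on \<open>\<complex>\<^sup>\<times>\<close> for coefficients \<open>c\<^sub>n\<close> that are meromorphic functions of \<open>P\<close> with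
  a common denominator \<open>D\<close>: the numerators are summed pointwise in \<open>P\<close>.\<close>

definition laurent_sum :: "(int \<Rightarrow> merof) \<Rightarrow> (complex \<Rightarrow> merof) \<Rightarrow> bool" where
  "laurent_sum c \<phi> \<longleftrightarrow>
     (\<exists>D N S. D \<noteq> 0 \<and> (\<forall>n. c n = Fract (N n) D) \<and>
        (\<forall>z. z \<noteq> 0 \<longrightarrow> \<phi> z = Fract (S z) D \<and>
           (\<forall>P. ((\<lambda>n. Rep_entire2 (N n) P * z powi (- n)) has_sum Rep_entire2 (S z) P) UNIV)))"

text \<open>The same for series \<open>X(z) = \<Sum>\<^sub>n x\<^sub>n z\<^bsup>-n\<^esup>\<close> of vectors, with respect to finitely many vectors.\<close>

definition laurent_sum_vec ::
  "(merof \<Rightarrow> 'v::ab_group_add \<Rightarrow> 'v) \<Rightarrow> 'v set \<Rightarrow> (int \<Rightarrow> 'v) \<Rightarrow> (complex \<Rightarrow> 'v) \<Rightarrow> bool" where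
  "laurent_sum_vec sc V x X \<longleftrightarrow>
     (\<exists>B c \<phi>. finite B \<and> B \<subseteq> V \<and> (\<forall>e\<in>B. laurent_sum (c e) (\<phi> e)) \<and>
        (\<forall>n. x n = (\<Sum>e\<in>B. sc (c e n) e)) \<and>
        (\<forall>z. z \<noteq> 0 \<longrightarrow> X z = (\<Sum>e\<in>B. sc (\<phi> e z) e)))"

text \<open>Vectors on which \<open>(P + h)\<^sub>\<epsilon>\<^sub>l\<close> is \<open>P\<^sub>\<epsilon>\<^sub>l + m\<^sub>l\<close>, i.e. on which \<open>h\<^sub>\<epsilon>\<^sub>l\<close> has the eigenvalue \<open>m\<^sub>l\<close>.\<close>

definition weight_space ::
  "(merof \<Rightarrow> 'v \<Rightarrow> 'v) \<Rightarrow> 'v drep \<Rightarrow> complex \<times> complex \<Rightarrow> 'v set" where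
  "weight_space sc R m = {v \<in> rep_space R. \<forall>g. actPh R g v = sc (shift m g) v}"

definition RLL_relation ::
  "complex \<Rightarrow> complex \<Rightarrow> (merof \<Rightarrow> 'v::ab_group_add \<Rightarrow> 'v) \<Rightarrow> 'v drep \<Rightarrow> bool" where
  "RLL_relation q p sc R \<longleftrightarrow>
    (\<forall>u1 u2. th q p (u1 - u2 + 1) \<noteq> 0 \<longrightarrow>
      (let z1 = q powr (2 * u1); z2 = q powr (2 * u2); w = u1 - u2 in
       \<forall>i\<in>{1,2}. \<forall>j\<in>{1,2}. \<forall>k\<in>{1,2}. \<forall>l\<in>{1,2}. \<forall>v\<in>rep_space R.
         (\<Sum>a\<in>{1,2}. \<Sum>b\<in>{1,2}. actPh R (Rbar q p w i j a b) (cur R a k z1 (cur R b l z2 v))) =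
         (\<Sum>a\<in>{1,2}. \<Sum>b\<in>{1,2}. cur R j b z2 (cur R i a z1 (sc (Rbar q p w a b k l) v)))))"

definition level0_rep ::
  "complex \<Rightarrow> complex \<Rightarrow> (merof \<Rightarrow> 'v::ab_group_add \<Rightarrow> 'v) \<Rightarrow> 'v drep \<Rightarrow> bool" where
  "level0_rep q p sc R \<longleftrightarrow>
     module.subspace sc (rep_space R) \<and>
     (\<forall>g. \<forall>v\<in>rep_space R. actPh R g v \<in> rep_space R) \<and>
     (\<forall>g. \<forall>v\<in>rep_space R. \<forall>w\<in>rep_space R. actPh R g (v + w) = actPh R g v + actPh R g w) \<and>
     (\<forall>f g. \<forall>v\<in>rep_space R. actPh R g (sc f v) = sc f (actPh R g v)) \<and>
     rep_space R \<subseteq> module.span sc (\<Union>m. weight_space sc R m) \<and>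
     (\<forall>i\<in>{1,2}. \<forall>j\<in>{1,2}. \<forall>n. \<forall>v\<in>rep_space R. mode R i j n v \<in> rep_space R) \<and>
     (\<forall>i\<in>{1,2}. \<forall>j\<in>{1,2}. \<forall>n. \<forall>v\<in>rep_space R. \<forall>w\<in>rep_space R.
        mode R i j n (v + w) = mode R i j n v + mode R i j n w) \<and>
     (\<forall>i\<in>{1,2}. \<forall>j\<in>{1,2}. \<forall>n g. \<forall>v\<in>rep_space R.
        actPh R g (mode R i j n v) = mode R i j n (actPh R (shift (- epsilon i) g) v) \<and>
        sc g (mode R i j n v) = mode R i j n (sc (shift (- epsilon j) g) v)) \<and>
     (\<forall>i\<in>{1,2}. \<forall>j\<in>{1,2}. \<forall>v\<in>rep_space R.
        laurent_sum_vec sc (rep_space R) (\<lambda>n. sc (const (p ^ nat n)) (mode R i j n v))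
          (\<lambda>z. cur R i j z v)) \<and>
     RLL_relation q p sc R"

definition subrep :: "(merof \<Rightarrow> 'v::ab_group_add \<Rightarrow> 'v) \<Rightarrow> 'v drep \<Rightarrow> 'v set \<Rightarrow> bool" where
  "subrep sc R U \<longleftrightarrow> module.subspace sc U \<and> U \<subseteq> rep_space R \<and>
     (\<forall>g. \<forall>v\<in>U. actPh R g v \<in> U) \<and>
     (\<forall>i\<in>{1,2}. \<forall>j\<in>{1,2}. \<forall>n. \<forall>v\<in>U. mode R i j n v \<in> U)"

definition irreducible_rep :: "(merof \<Rightarrow> 'v::ab_group_add \<Rightarrow> 'v) \<Rightarrow> 'v drep \<Rightarrow> bool" where
  "irreducible_rep sc R \<longleftrightarrow> rep_space R \<noteq> {0} \<and> (\<forall>U. subrep sc R U \<longrightarrow> U = {0} \<or> U = rep_space R)"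

text \<open>Scalar functions by which \<open>L\<^sup>+(z)\<close> may be multiplied, as functions of \<open>u\<close> with \<open>z = q\<^bsup>2u\<^esup>\<close>
  (fractional powers of \<open>z\<close> are needed, since \<open>\<theta>\<close> contains \<open>z\<^bsup>-1/2\<^esup>\<close>).\<close>

definition twist_fun :: "(complex \<Rightarrow> complex) \<Rightarrow> bool" where
  "twist_fun f \<longleftrightarrow> f holomorphic_on UNIV \<and> (\<forall>u. f u \<noteq> 0)"

definition Ltw ::
  "complex \<Rightarrow> (merof \<Rightarrow> 'v \<Rightarrow> 'v) \<Rightarrow> (complex \<Rightarrow> complex) \<Rightarrow> 'v drep \<Rightarrow>
     nat \<Rightarrow> nat \<Rightarrow> complex \<Rightarrow> 'v \<Rightarrow> 'v" where
  "Ltw q sc f R i j u v = sc (const (f u)) (cur R i j (q powr (2 * u)) v)"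

definition highest_weight_vector ::
  "complex \<Rightarrow> (merof \<Rightarrow> 'v::ab_group_add \<Rightarrow> 'v) \<Rightarrow> (complex \<Rightarrow> complex) \<Rightarrow> 'v drep \<Rightarrow>
     (complex \<Rightarrow> complex) \<Rightarrow> (complex \<Rightarrow> complex) \<Rightarrow> 'v \<Rightarrow> bool" where
  "highest_weight_vector q sc f R \<mu> \<nu> v \<longleftrightarrow>
     v \<in> rep_space R \<and> v \<noteq> 0 \<and> (\<forall>U. subrep sc R U \<and> v \<in> U \<longrightarrow> U = rep_space R) \<and>
     (\<forall>u. Ltw q sc f R 2 1 u v = 0 \<and>
          Ltw q sc f R 1 1 u v = sc (const (\<mu> u)) v \<and>
          Ltw q sc f R 2 2 u v = sc (const (\<nu> u)) v)"

text \<open>\<open>R\<close> is \<open>V\<^sub>l(\<tilde>a)\<close> for \<open>\<tilde>a = q\<^bsup>2c\<^esup>\<close>, with highest weight vector \<open>v\<close>. If \<open>l = \<alpha> - \<beta>\<close> and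
  \<open>\<tilde>a = q\<^bsup>-\<alpha>-\<beta>+2\<^esup>a\<close>, then \<open>q\<^bsup>2\<alpha>\<^esup>/a = q\<^bsup>l+2\<^esup>/\<tilde>a\<close> and \<open>q\<^bsup>2\<beta>\<^esup>/a = q\<^bsup>-l+2\<^esup>/\<tilde>a\<close>, so that the highest weight is
  \<open>(\<theta>(q\<^bsup>2\<alpha>\<^esup>z/a), \<theta>(q\<^bsup>2\<beta>\<^esup>z/a))\<close>.\<close>

definition eval_rep ::
  "complex \<Rightarrow> complex \<Rightarrow> (merof \<Rightarrow> 'v::ab_group_add \<Rightarrow> 'v) \<Rightarrow> nat \<Rightarrow> complex \<Rightarrow>
     'v drep \<Rightarrow> 'v \<Rightarrow> bool" where
  "eval_rep q p sc l c R v \<longleftrightarrow>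
     level0_rep q p sc R \<and> irreducible_rep sc R \<and> vector_space.dim sc (rep_space R) = l + 1 \<and>
     (\<exists>f. twist_fun f \<and>
        highest_weight_vector q sc f R
          (\<lambda>u. th q p ((of_nat l + 2) / 2 + u - c)) (\<lambda>u. th q p ((- of_nat l + 2) / 2 + u - c)) v)"


section \<open>The dynamical tensor product\<close>

text \<open>The subgroup of the free abelian group on \<open>V \<times> W\<close> generated by the defining relations of the
  tensor product; the relations \<open>cv \<otimes> w = v \<otimes> cw\<close> for \<open>c \<in> \<complex>\<close> are those with constant \<open>g\<close>.\<close>

inductive_set dtensor_rels ::
  "(merof \<Rightarrow> 'v::ab_group_add \<Rightarrow> 'v) \<Rightarrow> 'v drep \<Rightarrow> 'v drep \<Rightarrow> ('v \<times> 'v \<Rightarrow>\<^sub>0 int) set"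
  for sc V W where
  zero: "0 \<in> dtensor_rels sc V W"
| diff: "x \<in> dtensor_rels sc V W \<Longrightarrow> y \<in> dtensor_rels sc V W \<Longrightarrow> x - y \<in> dtensor_rels sc V W"
| add_left: "v \<in> rep_space V \<Longrightarrow> v' \<in> rep_space V \<Longrightarrow> w \<in> rep_space W \<Longrightarrow>
    Poly_Mapping.single (v + v', w) 1 - Poly_Mapping.single (v, w) 1
      - Poly_Mapping.single (v', w) 1 \<in> dtensor_rels sc V W"
| add_right: "v \<in> rep_space V \<Longrightarrow> w \<in> rep_space W \<Longrightarrow> w' \<in> rep_space W \<Longrightarrow>
    Poly_Mapping.single (v, w + w') 1 - Poly_Mapping.single (v, w) 1
      - Poly_Mapping.single (v, w') 1 \<in> dtensor_rels sc V W"
| balanced: "v \<in> rep_space V \<Longrightarrow> w \<in> rep_space W \<Longrightarrow>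
    Poly_Mapping.single (sc g v, w) 1 - Poly_Mapping.single (v, actPh W g w) 1
      \<in> dtensor_rels sc V W"

text \<open>The image of a formal sum of pairs under the additive extension of \<open>(v, w) \<mapsto> t v w\<close>.\<close>

definition dtensor_eval ::
  "(merof \<Rightarrow> 'v::ab_group_add \<Rightarrow> 'v) \<Rightarrow> ('v \<Rightarrow> 'v \<Rightarrow> 'v) \<Rightarrow> ('v \<times> 'v \<Rightarrow>\<^sub>0 int) \<Rightarrow> 'v" where
  "dtensor_eval sc t x =
     (\<Sum>k\<in>Poly_Mapping.keys x. sc (of_int (Poly_Mapping.lookup x k)) (t (fst k) (snd k)))"

text \<open>\<open>T\<close> is the tensor product of \<open>V\<close> and \<open>W\<close> with universal map \<open>t\<close>: it is the quotient of the free
  abelian group on \<open>V \<times> W\<close> by the relations, with the action given by the comultiplication.\<close>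

definition dtensor ::
  "complex \<Rightarrow> complex \<Rightarrow> (merof \<Rightarrow> 'v::ab_group_add \<Rightarrow> 'v) \<Rightarrow> 'v drep \<Rightarrow> 'v drep \<Rightarrow>
     ('v \<Rightarrow> 'v \<Rightarrow> 'v) \<Rightarrow> 'v drep \<Rightarrow> bool" where
  "dtensor q p sc V W t T \<longleftrightarrow>
     level0_rep q p sc T \<and>
     dtensor_eval sc t ` {x. Poly_Mapping.keys x \<subseteq> rep_space V \<times> rep_space W} = rep_space T \<and>
     (\<forall>x. Poly_Mapping.keys x \<subseteq> rep_space V \<times> rep_space W \<longrightarrow>
        (dtensor_eval sc t x = 0 \<longleftrightarrow> x \<in> dtensor_rels sc V W)) \<and>
     (\<forall>v\<in>rep_space V. \<forall>w\<in>rep_space W.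
        (\<forall>g. sc g (t v w) = t v (sc g w)) \<and>
        (\<forall>g. actPh T g (t v w) = t (actPh V g v) w) \<and>
        (\<forall>i\<in>{1,2}. \<forall>j\<in>{1,2}. \<forall>z. z \<noteq> 0 \<longrightarrow>
           cur T i j z (t v w) = (\<Sum>k\<in>{1,2}. t (cur V i k z v) (cur W k j z w))))"

text \<open>\<open>T = V\<^sub>1 \<otimes> \<dots> \<otimes> V\<^sub>n\<close> (dynamical tensor products) and \<open>\<zeta> = v\<^sub>1 \<otimes> \<dots> \<otimes> v\<^sub>n\<close>.\<close>

inductive iterated_dtensor ::
  "complex \<Rightarrow> complex \<Rightarrow> (merof \<Rightarrow> 'v::ab_group_add \<Rightarrow> 'v) \<Rightarrow> (nat \<Rightarrow> 'v drep) \<Rightarrow> (nat \<Rightarrow> 'v) \<Rightarrow>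
     nat \<Rightarrow> 'v drep \<Rightarrow> 'v \<Rightarrow> bool"
  for q p sc V v where
  one: "iterated_dtensor q p sc V v 1 (V 1) (v 1)"
| step: "iterated_dtensor q p sc V v m T \<zeta> \<Longrightarrow> dtensor q p sc T (V (Suc m)) t T' \<Longrightarrow>
    iterated_dtensor q p sc V v (Suc m) T' (t \<zeta> (v (Suc m)))"


section \<open>The operators and the Gelfand-Tsetlin vectors\<close>

text \<open>\<open>X i j u\<close> stands for the operator \<open>L\<^sup>+\<^sub>i\<^sub>j(q\<^bsup>2u\<^esup>)\<close> on \<open>V\<close>. The operators \<open>k1_op\<close> and \<open>A1_op\<close> are
  meaningful at those \<open>u\<close> where \<open>L\<^sup>+\<^sub>2\<^sub>2(q\<^bsup>2u\<^esup>)\<close> is invertible.\<close>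

type_synonym 'v L_op = "nat \<Rightarrow> nat \<Rightarrow> complex \<Rightarrow> 'v \<Rightarrow> 'v"

abbreviation A2_op :: "'v L_op \<Rightarrow> complex \<Rightarrow> 'v \<Rightarrow> 'v" where "A2_op X \<equiv> X 2 2"
abbreviation B2_op :: "'v L_op \<Rightarrow> complex \<Rightarrow> 'v \<Rightarrow> 'v" where "B2_op X \<equiv> X 1 2"
abbreviation C2_op :: "'v L_op \<Rightarrow> complex \<Rightarrow> 'v \<Rightarrow> 'v" where "C2_op X \<equiv> X 2 1"
abbreviation k2_op :: "'v L_op \<Rightarrow> complex \<Rightarrow> 'v \<Rightarrow> 'v" where "k2_op X \<equiv> X 2 2"

definition k1_op :: "'v::ab_group_add set \<Rightarrow> 'v L_op \<Rightarrow> complex \<Rightarrow> 'v \<Rightarrow> 'v" where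
  "k1_op V X u v = X 1 1 u v - X 1 2 u (inv_into V (X 2 2 u) (X 2 1 u v))"

definition A1_op :: "'v::ab_group_add set \<Rightarrow> 'v L_op \<Rightarrow> complex \<Rightarrow> 'v \<Rightarrow> 'v" where
  "A1_op V X u v = k1_op V X u (k2_op X (u - 1) v)"

definition invertible_L22 :: "'v set \<Rightarrow> 'v L_op \<Rightarrow> complex \<Rightarrow> bool" where
  "invertible_L22 V X u \<longleftrightarrow> bij_betw (X 2 2 u) V V"

definition GT_patterns ::
  "nat \<Rightarrow> (nat \<Rightarrow> complex) \<Rightarrow> (nat \<Rightarrow> complex) \<Rightarrow> (nat \<Rightarrow> complex) set" where
  "GT_patterns n \<alpha> \<beta> = {\<gamma> \<in> extensional {1..n}.
     \<forall>i\<in>{1..n}. \<alpha> i - \<gamma> i \<in> \<nat> \<and> \<gamma> i - \<beta> i \<in> \<nat>}"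

text \<open>\<open>B2_string X s b k v = B\<^sub>2(q\<^bsup>-2(b+k-1)\<^esup>a) \<dots> B\<^sub>2(q\<^bsup>-2b\<^esup>a) v\<close> for \<open>a = q\<^bsup>2s\<^esup>\<close>.\<close>

primrec B2_string :: "'v L_op \<Rightarrow> complex \<Rightarrow> complex \<Rightarrow> nat \<Rightarrow> 'v \<Rightarrow> 'v" where
  "B2_string X s b 0 v = v"
| "B2_string X s b (Suc k) v = B2_op X (s - (b + of_nat k)) (B2_string X s b k v)"

definition xi ::
  "'v::zero L_op \<Rightarrow> 'v \<Rightarrow> nat \<Rightarrow> (nat \<Rightarrow> complex) \<Rightarrow> (nat \<Rightarrow> complex) \<Rightarrow> (nat \<Rightarrow> complex) \<Rightarrow>
     (nat \<Rightarrow> complex) \<Rightarrow> 'v" where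
  "xi X \<zeta> n s \<alpha> \<beta> \<gamma> =
     (if \<gamma> \<in> GT_patterns n \<alpha> \<beta>
      then foldr (\<lambda>i. B2_string X (s i) (\<beta> i) (THE k. \<gamma> i - \<beta> i = of_nat k)) [1..<Suc n] \<zeta>
      else 0)"

text \<open>The family \<open>f\<close> over \<open>I\<close> is a basis of the subspace \<open>V\<close>.\<close>

definition basis_family ::
  "(merof \<Rightarrow> 'v::ab_group_add \<Rightarrow> 'v) \<Rightarrow> 'v set \<Rightarrow> ('i \<Rightarrow> 'v) \<Rightarrow> 'i set \<Rightarrow> bool" where
  "basis_family sc V f I \<longleftrightarrow>
     inj_on f I \<and> \<not> module.dependent sc (f ` I) \<and> module.span sc (f ` I) = V"

text \<open>Modulo powers of \<open>p\<close>, no point \<open>q\<^bsup>-2\<gamma>\<^sub>i\<^esup>a\<^sub>i\<close> with \<open>\<beta>\<^sub>i \<le> \<gamma>\<^sub>i \<le> \<alpha>\<^sub>i\<close> (a possible zero of the \<open>i\<close>-th factor of an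
  eigenvalue of \<open>A\<^sub>2\<close>) is among the points \<open>q\<^bsup>-2\<gamma>\<^sub>j\<^esup>a\<^sub>j\<close> with \<open>\<beta>\<^sub>j \<le> \<gamma>\<^sub>j < \<alpha>\<^sub>j\<close> at which \<open>B\<^sub>2\<close> is evaluated for
  another factor \<open>j\<close>. Without this the vectors \<open>\<xi>\<^sub>\<gamma>\<close> need not be independent: for \<open>n = 2\<close>,
  \<open>\<alpha>\<^sub>1 = \<alpha>\<^sub>2 = 1\<close>, \<open>\<beta>\<^sub>1 = \<beta>\<^sub>2 = 0\<close>, \<open>a\<^sub>1 = a\<^sub>2\<close> the tensor product is irreducible, but
  \<open>\<xi>\<^bsub>(1,0)\<^esub> = \<xi>\<^bsub>(0,1)\<^esub>\<close>.\<close>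

definition separated_strings ::
  "complex \<Rightarrow> complex \<Rightarrow> nat \<Rightarrow> (nat \<Rightarrow> complex) \<Rightarrow> (nat \<Rightarrow> complex) \<Rightarrow> (nat \<Rightarrow> nat) \<Rightarrow> bool" where
  "separated_strings q p n a \<beta> l \<longleftrightarrow>
     (\<forall>i\<in>{1..n}. \<forall>j\<in>{1..n}. i \<noteq> j \<longrightarrow> (\<forall>r\<le>l i. \<forall>s<l j. \<forall>m::int.
        q powr (- 2 * (\<beta> i + of_nat r)) * a i \<noteq> p powi m * (q powr (- 2 * (\<beta> j + of_nat s)) * a j)))"

end

theory Submission
  imports Defs
begin

text \<open>
  Write \<open>L(u)\<close> for \<open>L\<^sup>+(q\<^bsup>2u\<^esup>)\<close>. If \<open>L\<^sub>2\<^sub>2(t) v = 0\<close>, the RLL relations say that \<open>L\<^sub>1\<^sub>2(t)\<close> maps an eigenvector \<open>v\<close> of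
  \<open>L\<^sub>2\<^sub>2(u)\<close> to an eigenvector whose eigenvalue is multiplied by \<open>\<theta>(u - t + 1) / \<theta>(u - t)\<close>, and, by the
  three-term theta identity, that \<open>L\<^sub>1\<^sub>2(t)\<close> commutes with the quantum determinant on \<open>v\<close>. This yields the
  eigenvalues of \<open>A\<^sub>1\<close> and \<open>A\<^sub>2\<close>. At the degenerate point \<open>z\<^sub>1/z\<^sub>2 = q\<^bsup>-2\<^esup>\<close> the relations express
  \<open>L\<^sub>2\<^sub>1(u - 1) L\<^sub>1\<^sub>2(u)\<close> through the quantum determinant and \<open>L\<^sub>2\<^sub>2(u)\<close>, which gives the action of \<open>C\<^sub>2\<close> and
  shows that the vectors \<open>\<xi>\<^sub>\<gamma>\<close> do not vanish. The eigenvalues of \<open>A\<^sub>2\<close> on them have different zeros, so they are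
  linearly independent, and their number \<open>\<Prod> (l\<^sub>i + 1)\<close> bounds the dimension of the tensor product. For the
  same reason a vector \<open>B\<^sub>2(q\<^bsup>-2\<alpha>\<^sub>j\<^esup>a\<^sub>j) \<xi>\<^sub>\<gamma>\<close> with \<open>\<gamma>\<^sub>j = \<alpha>\<^sub>j\<close>, whose eigenvalue would be a further one, is zero.

  One-dimensional tensor factors need extra care: all \<open>L\<^sub>i\<^sub>j\<close> vanish at the zeros of the scalar by which such a
  factor acts, and this scalar has to be divided out. Identities at exceptional values of the spectral
  parameter follow by analytic continuation; analyticity, and the commutation rules for the currents,
  come from the Laurent expansions in the modes.
\<close>

section \<open>The theta function\<close>

text \<open>The currents are only semilinear over the field of meromorphic functions of
  \<open>P\<close>: a scalar passing through \<open>L\<^sub>i\<^sub>j\<close> is shifted by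
  \<open>epsilon j\<close>. The usual proof that eigenvectors are independent, which subtracts a
  multiple of a relation, therefore breaks down; zeros of eigenvalues are used because
  \<open>shift\<close> preserves being zero. The condition \<open>L\<^sub>2\<^sub>2(t) v = 0\<close>
  plays a similar part: it removes the exchange term whose coefficient depends on the dynamical
  parameter. The ratios \<open>\<Theta> 1 / \<Theta> 0\<close> and
  \<open>\<Theta> (-1) / \<Theta> 0\<close> are, up to the factor \<theta>(1), the off-diagonal
  entries of the rescaled R-matrix at the degenerate point. With them the quantum determinant is
  written without the inverse of \<open>L\<^sub>2\<^sub>2\<close>, so it makes sense at the zeros of
  the eigenvalues, exactly where it has to be evaluated. The exchange relations do not show directly
  that a string of \<open>B\<^sub>2\<close> operators ends at \<open>\<alpha>\<^sub>j\<close>; this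
  is a dimension count. Hence the vectors and their eigenvalues are treated for all string lengths,
  before it is known which vectors vanish.\<close>

lemma convergent_qpochhammer:
  assumes "norm p < 1"
  shows "convergent_prod (\<lambda>n. 1 - x * p ^ n :: complex)"
proof -
  have "summable (\<lambda>n. norm ((1 - x * p ^ n) - 1))"
    using assms by (simp add: norm_mult norm_power summable_mult summable_geometric)
  then show ?thesis
    by (intro abs_convergent_prod_imp_convergent_prod summable_imp_abs_convergent_prod)
qed

lemma qpochhammer_inf_step:
  assumes "norm p < 1"
  shows "qpochhammer_inf x p = (1 - x) * qpochhammer_inf (p * x) p"
proof -
  have "(\<lambda>n. 1 - x * p ^ n) has_prod (prod (\<lambda>k. 1 - x * p ^ k) {..<1} * prodinf (\<lambda>k. 1 - x * p ^ (k + 1)))"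
    by (rule has_prod_ignore_initial_segment'[OF convergent_qpochhammer[OF assms]])
  from has_prod_unique[OF this] show ?thesis
    by (simp add: qpochhammer_inf_def mult_ac)
qed

lemma qpochhammer_inf_eq_0_iff:
  assumes "norm p < 1"
  shows "qpochhammer_inf x p = 0 \<longleftrightarrow> (\<exists>n. x * p ^ n = 1)"
proof -
  have "(\<lambda>n. 1 - x * p ^ n) has_prod qpochhammer_inf x p"
    unfolding qpochhammer_inf_def
    using convergent_qpochhammer[OF assms] convergent_prod_has_prod_iff by blast
  from has_prod_eq_0_iff[OF this] show ?thesis
    by (force simp: image_iff)
qed

lemma isCont_entire: "f holomorphic_on UNIV \<Longrightarrow> isCont f x" for f :: "complex \<Rightarrow> complex"
  using holomorphic_on_imp_continuous_on continuous_on_eq_continuous_at open_UNIV by blast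

section \<open>Zeros, parity and quasi-periods of theta\<close>

locale generic_parameters =
  fixes q p :: complex
  assumes generic: "generic_pq q p"
begin

abbreviation \<theta> :: "complex \<Rightarrow> complex" where "\<theta> \<equiv> th q p"

lemma q_nz: "q \<noteq> 0" and p_nz: "p \<noteq> 0" and norm_q: "norm q < 1" and norm_p: "norm p < 1"
  using generic by (auto simp: generic_pq_def)

lemma p_power_Suc_ne_1: "p * p ^ n \<noteq> 1"
proof
  assume "p * p ^ n = 1"
  then have "norm p * norm p ^ n = 1"
    by (metis norm_mult norm_one norm_power)
  moreover have "norm p * norm p ^ n \<le> norm p"
    using norm_p by (simp add: mult_left_le power_le_one)
  ultimately show False using norm_p by simp
qed

lemma powi_q_eq_powi_p: "q powi m = p powi k \<Longrightarrow> m = 0"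
  using generic by (auto simp: generic_pq_def)

lemma holomorphic_theta [holomorphic_intros]:
  "f holomorphic_on S \<Longrightarrow> (\<lambda>u. \<theta> (f u)) holomorphic_on S"
  using holomorphic_on_compose[of f S "th q p"] th_holomorphic[OF norm_p q_nz]
  by (auto simp: o_def intro: holomorphic_on_subset)

text \<open>The even cofactor of \<open>q powr u - q powr (- u)\<close> in theta. The splitting
  makes the oddness of theta and its simple zero at 0 visible.\<close>

definition regular_part :: "complex \<Rightarrow> complex" where
  "regular_part u = qpochhammer_inf (p * q powr (2 * u)) p *
     qpochhammer_inf (p * q powr (- 2 * u)) p * qpochhammer_inf p p"

lemma theta_eq: "\<theta> u = (q powr u - q powr (- u)) * regular_part u"
proof -
  have e: "q powr (2 * u) = q powr u * q powr u"
    using q_nz by (simp add: powr_add[symmetric])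
  have e2: "p / q powr (2 * u) = p * q powr (- 2 * u)"
    using q_nz by (simp add: powr_minus field_simps)
  have i: "q powr (- u) * (q powr u * q powr u) = q powr u"
    using q_nz by (simp add: powr_minus)
  have "\<theta> u = - (q powr (- u)) * (1 - q powr u * q powr u) * regular_part u"
    unfolding th_def Theta_def regular_part_def qpochhammer_inf_step[OF norm_p, of "q powr (2 * u)"] e2
    by (simp only: e[symmetric]) (simp add: mult_ac)
  also have "- (q powr (- u)) * (1 - q powr u * q powr u) = q powr u - q powr (- u)"
    using i by (simp add: algebra_simps)
  finally show ?thesis .
qed

lemma regular_part_minus: "regular_part (- u) = regular_part u"
  by (simp add: regular_part_def)

lemma theta_minus [simp]: "\<theta> (- u) = - \<theta> u"
  by (simp add: theta_eq regular_part_minus algebra_simps)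

lemma theta_diff_commute: "\<theta> (u - v) = - \<theta> (v - u)"
  using theta_minus[of "v - u"] by simp

lemma theta_0 [simp]: "\<theta> 0 = 0"
  by (simp add: theta_eq)

lemma theta_eq_0_iff: "\<theta> u = 0 \<longleftrightarrow> (\<exists>m::int. q powr (2 * u) = p powi m)"
proof -
  let ?z = "q powr (2 * u)"
  have z: "?z \<noteq> 0" using q_nz by simp
  have "\<theta> u = 0 \<longleftrightarrow> (\<exists>n. ?z * p ^ n = 1) \<or> (\<exists>n. p / ?z * p ^ n = 1) \<or> (\<exists>n. p * p ^ n = 1)"
    using q_nz by (simp add: th_def Theta_def qpochhammer_inf_eq_0_iff[OF norm_p])
  also have "(\<exists>n. p * p ^ n = 1) \<longleftrightarrow> False"
    using p_power_Suc_ne_1 by simp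
  also have "(\<exists>n. ?z * p ^ n = 1) \<or> (\<exists>n. p / ?z * p ^ n = 1) \<or> False \<longleftrightarrow> (\<exists>m::int. ?z = p powi m)"
    (is "?A \<or> ?B \<or> False \<longleftrightarrow> ?C")
  proof
    assume "?A \<or> ?B \<or> False"
    then consider n where "?z * p ^ n = 1" | n where "p / ?z * p ^ n = 1" by blast
    then show ?C
    proof cases
      case 1
      then have "?z = p powi (- int n)"
        using p_nz by (simp add: power_int_minus eq_divide_eq inverse_eq_divide)
      then show ?thesis by blast
    next
      case 2
      then have "?z = p powi (int (Suc n))"
        using z by (simp only: power_int_of_nat) (simp add: divide_eq_eq)
      then show ?thesis by blast
    qed
  next
    assume ?C
    then obtain m :: int where *: "?z = p powi m" by blast
    show "?A \<or> ?B \<or> False"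
    \<comment> \<open>Exponents \<open>m \<le> 0\<close> are zeros of the product in
      \<open>z\<close>, positive ones are zeros of the product in \<open>p / z\<close>.\<close>
    proof (cases "m \<le> 0")
      case True
      then have "m = - int (nat (- m))" by simp
      then have "?z = inverse (p ^ nat (- m))"
        using * by (metis power_int_minus power_int_of_nat)
      then have "?z * p ^ nat (- m) = 1" using p_nz by simp
      then show ?thesis by blast
    next
      case False
      then have "m = int (Suc (nat (m - 1)))" by simp
      then have "?z = p ^ Suc (nat (m - 1))"
        using * by (metis power_int_of_nat)
      then have "p / ?z * p ^ nat (m - 1) = 1" using p_nz by simp
      then show ?thesis by blast
    qed
  qed
  finally show ?thesis .
qed

lemma q_powr_int: "q powr (2 * of_int m) = q powi (2 * m)"
  using q_nz complex_powr_of_int[of q "2 * m"] by simp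

text \<open>A zero would make the power \<open>2 * m\<close> of \<open>q\<close> a power of
  \<open>p\<close>, against the multiplicative independence contained in
  \<open>generic_pq\<close>.\<close>

lemma theta_int_nz: "m \<noteq> 0 \<Longrightarrow> \<theta> (of_int m) \<noteq> 0"
  using powi_q_eq_powi_p[of "2 * m"] by (auto simp: theta_eq_0_iff q_powr_int)

lemma theta_1_nz [simp]: "\<theta> 1 \<noteq> 0"
  using theta_int_nz[of 1] by simp

text \<open>In terms of \<open>z = q powr (2 * u)\<close>, adding \<open>period1\<close> fixes
  \<open>z\<close> but changes the sign of its square root, and adding \<open>period2\<close>
  multiplies \<open>z\<close> by \<open>p\<close>.\<close>

definition period1 :: complex where "period1 = \<i> * of_real pi / ln q"
definition period2 :: complex where "period2 = ln p / (2 * ln q)"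

lemma ln_q_nz: "ln q \<noteq> 0"
proof
  assume "ln q = 0"
  then have "exp (ln q) = 1" by simp
  then show False using q_nz norm_q by simp
qed

lemma q_powr_period1: "q powr period1 = -1"
  using q_nz ln_q_nz by (simp add: powr_def period1_def exp_pi_i')

lemma q_powr_period2: "q powr (2 * period2) = p"
  using q_nz p_nz ln_q_nz by (simp add: powr_def period2_def)

lemma theta_period1: "\<theta> (u + period1) = - \<theta> u"
proof -
  have 1: "q powr (2 * u + 2 * period1) = q powr (2 * u)"
  proof -
    have "q powr (2 * period1) = q powr period1 * q powr period1"
      by (simp only: mult_2 powr_add)
    then show ?thesis by (simp add: powr_add q_powr_period1)
  qed
  have 2: "q powr (- u - period1) = - (q powr (- u))"
    by (simp add: powr_diff q_powr_period1)
  show ?thesis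
    by (simp add: th_def distrib_left 1 2)
qed

lemma theta_period2: "\<theta> (u + period2) = - (q powr (- period2) / q powr (2 * u)) * \<theta> u"
proof -
  let ?z = "q powr (2 * u)"
  have z: "?z \<noteq> 0" using q_nz by simp
  have 1: "q powr (2 * u + 2 * period2) = p * ?z"
    by (simp add: powr_add q_powr_period2)
  have 2: "q powr (- u - period2) = q powr (- u) * q powr (- period2)"
    by (simp add: powr_diff powr_minus field_simps)
  have 3: "Theta p (p * ?z) = - Theta p ?z / ?z"
  proof -
    have "Theta p (p * ?z) = qpochhammer_inf (p * ?z) p * qpochhammer_inf (1 / ?z) p * qpochhammer_inf p p"
      using p_nz z by (simp add: Theta_def)
    also have "qpochhammer_inf (1 / ?z) p = (1 - 1 / ?z) * qpochhammer_inf (p / ?z) p"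
      using qpochhammer_inf_step[OF norm_p, of "1 / ?z"] by simp
    also have "qpochhammer_inf (p * ?z) p * ((1 - 1 / ?z) * qpochhammer_inf (p / ?z) p) =
        - ((1 - ?z) * qpochhammer_inf (p * ?z) p) * qpochhammer_inf (p / ?z) p / ?z"
      using z by (simp add: field_simps)
    also have "(1 - ?z) * qpochhammer_inf (p * ?z) p = qpochhammer_inf ?z p"
      by (simp only: qpochhammer_inf_step[OF norm_p, of "q powr (2 * u)"])
    finally show ?thesis by (simp add: Theta_def)
  qed
  show ?thesis
    by (simp add: th_def distrib_left 1 2 3)
qed

lemma theta_zero_lattice:
  assumes "\<theta> u = 0"
  obtains j k :: int where "u = of_int j * period1 + of_int k * period2"
proof -
  from assms obtain m :: int where m: "q powr (2 * u) = p powi m"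
    by (auto simp: theta_eq_0_iff)
  have "exp (2 * u * ln q) = exp (of_int m * ln p)"
    using m q_nz p_nz complex_powr_of_int[of p m] by (simp add: powr_def)
  then obtain n :: int where "2 * u * ln q = of_int m * ln p + of_int (2 * n) * of_real pi * \<i>"
    using exp_eq[of "2 * u * ln q"] by (auto simp: mult_ac)
  then have "u = of_int n * period1 + of_int m * period2"
    using ln_q_nz by (simp add: period1_def period2_def field_simps)
  then show ?thesis using that by blast
qed

lemma regular_part_holomorphic: "regular_part holomorphic_on UNIV"
proof -
  note h = holomorphic_on_compose[OF _ holomorphic_on_subset
      [OF qpochhammer_inf_holomorphic[OF norm_p]], unfolded o_def]
  have "(\<lambda>u. qpochhammer_inf (p * q powr (2 * u)) p) holomorphic_on UNIV"
    by (rule h) (use q_nz in \<open>auto intro!: holomorphic_intros\<close>)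
  moreover have "(\<lambda>u. qpochhammer_inf (p * q powr (- 2 * u)) p) holomorphic_on UNIV"
    by (rule h) (use q_nz in \<open>auto intro!: holomorphic_intros\<close>)
  ultimately show ?thesis
    unfolding regular_part_def[abs_def] by (intro holomorphic_intros) auto
qed

section \<open>The three-term identity by means of an elliptic quotient\<close>

lemma theta_deriv_0: "\<exists>c. c \<noteq> 0 \<and> (\<theta> has_field_derivative c) (at 0)"
proof -
  obtain r' where r: "(regular_part has_field_derivative r') (at 0)"
    using regular_part_holomorphic by (auto simp: holomorphic_on_def field_differentiable_def)
  have "((\<lambda>u. (q powr u - q powr (- u)) * regular_part u) has_field_derivative
      2 * ln q * regular_part 0) (at 0)"
  proof -
    have e: "q powr w = exp (w * ln q)" for w using q_nz by (simp add: powr_def)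
    show ?thesis
      unfolding e by (auto intro!: derivative_eq_intros r)
  qed
  moreover have "regular_part 0 \<noteq> 0"
  proof -
    show ?thesis
      using q_nz by (simp add: regular_part_def qpochhammer_inf_eq_0_iff[OF norm_p] p_power_Suc_ne_1)
  qed
  ultimately show ?thesis
    using ln_q_nz by (intro exI[of _ "2 * ln q * regular_part 0"]) (simp add: theta_eq[abs_def])
qed

text \<open>Theta is not identically zero: the witness \<open>1 - c\<close> brings its argument to
  1. Together with continuity this is what later allows theta factors to be cancelled even at their
  zeros.\<close>

lemma eventually_theta_nz: "\<forall>\<^sub>F u in at u0. \<theta> (u + c) \<noteq> 0"
proof -
  have "\<forall>\<^sub>F u in at u0. \<theta> (u + c) \<noteq> 0 \<and> u \<in> UNIV"
    by (rule non_zero_neighbour_alt[of "\<lambda>u. \<theta> (u + c)" UNIV u0 "1 - c"])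
      (auto intro!: holomorphic_intros)
  then show ?thesis by simp
qed

lemma theta_period:
  assumes "\<And>u. f (u + period1) = f u" "\<And>u. f (u + period2) = f u"
  shows "f (u + (of_int j * period1 + of_int k * period2)) = f u"
proof -
  have *: "f (u + of_int m * c) = f u" if "\<And>u. f (u + c) = f u" for c u and m :: int
  proof (induction m rule: int_induct[of _ 0])
    case (step1 i)
    then show ?case using that[of "u + of_int i * c"] by (simp add: algebra_simps)
  next
    case (step2 i)
    then show ?case using that[of "u + of_int (i - 1) * c"] by (simp add: algebra_simps)
  qed simp
  have "f (u + (of_int j * period1 + of_int k * period2)) = f ((u + of_int j * period1) + of_int k * period2)"
    by (simp add: add.assoc)
  also have "\<dots> = f u"
    using *[OF assms(2)] *[OF assms(1)] by simp
  finally show ?thesis .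
qed

lemma fundamental_domain:
  obtains K where "compact K" "\<And>u. \<exists>(j::int) (k::int). u + (of_int j * period1 + of_int k * period2) \<in> K"
proof -
  define K where "K = (\<lambda>x. x / (2 * ln q)) ` cbox (Complex (ln (norm p)) 0) (Complex 0 (2 * pi))"
  have "compact K"
    unfolding K_def by (intro compact_continuous_image continuous_intros) (use ln_q_nz in auto)
  moreover have "\<exists>(j::int) (k::int). u + (of_int j * period1 + of_int k * period2) \<in> K" for u
  proof -
    define L where "L = ln (norm p)"
    have L: "L < 0" using norm_p p_nz by (simp add: L_def)
    \<comment> \<open>In this coordinate the periods become \<open>2 * pi * \<i>\<close> and
      \<open>ln p\<close>. The real part is reduced first by multiples of \<open>ln p\<close>; the
      reduction of the imaginary part then leaves it unchanged.\<close>
    define x where "x = 2 * ln q * u"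
    define k :: int where "k = - \<lfloor>Re x / L\<rfloor>"
    define y where "y = x + of_int k * ln p"
    define j :: int where "j = - \<lfloor>Im y / (2 * pi)\<rfloor>"
    define z where "z = y + of_int j * (2 * of_real pi * \<i>)"
    have "Re z = Re x + of_int k * L"
      using p_nz by (simp add: z_def y_def L_def)
    also have "\<dots> = L * (Re x / L - \<lfloor>Re x / L\<rfloor>)"
      using L by (simp add: k_def field_simps)
    finally have re: "Re z = L * frac (Re x / L)" by (simp add: frac_def)
    have "Im z = Im y + of_int j * (2 * pi)"
      by (simp add: z_def)
    also have "\<dots> = 2 * pi * (Im y / (2 * pi) - \<lfloor>Im y / (2 * pi)\<rfloor>)"
      by (simp add: j_def field_simps)
    finally have im: "Im z = 2 * pi * frac (Im y / (2 * pi))" by (simp add: frac_def)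
    have "z \<in> cbox (Complex L 0) (Complex 0 (2 * pi))"
      using L frac_ge_0[of "Re x / L"] frac_lt_1[of "Re x / L"]
        frac_ge_0[of "Im y / (2 * pi)"] frac_lt_1[of "Im y / (2 * pi)"]
      by (simp add: in_cbox_complex_iff re im mult_le_0_iff less_imp_le)
    moreover have "u + (of_int j * period1 + of_int k * period2) = z / (2 * ln q)"
      using ln_q_nz by (simp add: z_def y_def x_def period1_def period2_def field_simps)
    ultimately show ?thesis unfolding K_def L_def by blast
  qed
  ultimately show ?thesis using that by blast
qed

text \<open>Liouville's theorem, applied to the quotient of the difference of both sides by \<open>\<theta>(w)\<^sup>2\<close>.\<close>

lemma theta_three_term:
  "\<theta> (y + 1) * \<theta> (y - 1) * (\<theta> w)^2 + (\<theta> 1)^2 * \<theta> (w + y) * \<theta> (w - y) =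
   \<theta> (w + 1) * \<theta> (w - 1) * (\<theta> y)^2"
proof -
  define G where "G w = \<theta> (y + 1) * \<theta> (y - 1) * (\<theta> w)^2 + (\<theta> 1)^2 * \<theta> (w + y) * \<theta> (w - y) -
    \<theta> (w + 1) * \<theta> (w - 1) * (\<theta> y)^2" for w
  have holG: "G holomorphic_on UNIV"
    unfolding G_def[abs_def] by (intro holomorphic_intros)
  have G0: "G 0 = 0"
    using theta_minus[of y] theta_minus[of 1] by (simp add: G_def power2_eq_square)
  have Geven: "G (- u) = G u" for u
  proof -
    have "\<theta> (- u + y) = - \<theta> (u - y)" "\<theta> (- u - y) = - \<theta> (u + y)"
      "\<theta> (- u + 1) = - \<theta> (u - 1)" "\<theta> (- u - 1) = - \<theta> (u + 1)"
      using theta_minus[of "u - y"] theta_minus[of "u + y"] theta_minus[of "u - 1"] theta_minus[of "u + 1"]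
      by (simp_all add: add.commute minus_diff_commute)
    then show ?thesis by (simp add: G_def)
  qed
  \<comment> \<open>The denominator has a double zero at 0, so \<open>G\<close> has to be divisible
    by the square of \<open>u\<close>: once because \<open>G 0 = 0\<close>, and a second time
    because \<open>G\<close> is even, which makes \<open>G1\<close> odd and hence zero at 0.\<close>
  define G1 where "G1 u = (if u = 0 then deriv G 0 else (G u - G 0) / (u - 0))" for u
  have holG1: "G1 holomorphic_on UNIV"
    unfolding G1_def[abs_def] by (rule pole_lemma_open[OF holG]) auto
  have G1: "G u = u * G1 u" for u
    by (simp add: G1_def G0)
  have G1odd: "G1 (- u) = - G1 u" if "u \<noteq> 0" for u
    using that Geven[of u] by (simp add: G1_def G0)
  have G10: "G1 0 = 0"
  proof -
    have c: "isCont G1 0"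
      by (rule isCont_entire[OF holG1])
    have "((\<lambda>u. G1 (- u)) \<longlongrightarrow> G1 0) (at 0)"
      by (rule isCont_tendsto_compose[OF c]) (auto intro!: tendsto_eq_intros)
    moreover have "((\<lambda>u. G1 (- u)) \<longlongrightarrow> - G1 0) (at 0)"
    proof (rule Lim_transform_eventually)
      show "((\<lambda>u. - G1 u) \<longlongrightarrow> - G1 0) (at 0)"
        using c by (intro tendsto_minus) (simp add: isCont_def)
      show "\<forall>\<^sub>F u in at 0. - G1 u = G1 (- u)"
        by (auto simp: eventually_at_filter G1odd)
    qed
    ultimately have "G1 0 = - G1 0" by (rule tendsto_unique[rotated]) simp
    then show ?thesis by simp
  qed
  define G2 where "G2 u = (if u = 0 then deriv G1 0 else (G1 u - G1 0) / (u - 0))" for u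
  have holG2: "G2 holomorphic_on UNIV"
    unfolding G2_def[abs_def] by (rule pole_lemma_open[OF holG1]) auto
  have G2: "G u = u^2 * G2 u" for u
    by (simp add: G2_def G1 G10 power2_eq_square)
  \<comment> \<open>The exceptional value is the limit at 0. It serves for all zeros of theta, since
    these are the translates of 0 by the periods of \<open>g\<close>.\<close>
  define g where "g u = (if \<theta> u = 0 then G2 0 / (deriv \<theta> 0)^2 else G u / (\<theta> u)^2)" for u
  have per1: "g (u + period1) = g u" for u
  proof -
    have e: "\<theta> (u + c + period1) = - \<theta> (u + c)" for c by (rule theta_period1)
    have "G (u + period1) = G u"
      using e[of y] e[of "- y"] e[of 1] e[of "-1"] theta_period1[of u]
      by (simp add: G_def algebra_simps)
    then show ?thesis by (simp add: g_def theta_period1)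
  qed
  have per2: "g (u + period2) = g u" for u
  proof -
    define k where "k = - (q powr (- period2))"
    define z where "z = q powr (2 * u)"
    have k: "k \<noteq> 0" "z \<noteq> 0" using q_nz by (simp_all add: k_def z_def)
    have e: "\<theta> (u + c + period2) = k / z / q powr (2 * c) * \<theta> (u + c)" for c
      using theta_period2[of "u + c"] by (simp add: k_def z_def powr_add distrib_left field_simps)
    \<comment> \<open>The contributions of \<open>c\<close> and \<open>- c\<close> to the multiplier
      cancel, so all three terms of \<open>G\<close> acquire the same factor as the square of
      theta.\<close>
    have e': "\<theta> (u + period2 + c) * \<theta> (u + period2 - c) = (k / z)^2 * (\<theta> (u + c) * \<theta> (u - c))" for c
      using e[of c] e[of "- c"] q_nz
      by (simp add: algebra_simps powr_minus power2_eq_square)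
    have e0: "\<theta> (u + period2) = k / z * \<theta> u" using e[of 0] q_nz by simp
    have "G (u + period2) = (k / z)^2 * G u"
      unfolding G_def right_diff_distrib distrib_left mult.assoc e'
      by (simp add: e0 power2_eq_square mult_ac)
    then show ?thesis using k by (simp add: g_def e0 power_mult_distrib power_divide)
  qed
  note per = theta_period[of g, OF per1 per2]
  obtain d where d: "d \<noteq> 0" "(\<theta> has_field_derivative d) (at 0)"
    using theta_deriv_0 by blast
  have dd: "deriv \<theta> 0 = d" using d(2) by (rule DERIV_imp_deriv)
  have lim: "((\<lambda>u. \<theta> u / u) \<longlongrightarrow> d) (at 0)"
    using d(2) by (simp add: has_field_derivative_iff)
  have diff0: "g field_differentiable (at 0)"
  proof -
    obtain r where r: "r > 0" "\<And>u. u \<in> ball 0 r \<Longrightarrow> u \<noteq> 0 \<Longrightarrow> \<theta> u \<noteq> 0"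
      using eventually_theta_nz[of 0 0, simplified] unfolding eventually_at by (auto simp: dist_norm)
    have "g holomorphic_on ball 0 r"
    proof (rule no_isolated_singularity'[of "{0}"])
      have "g holomorphic_on ball 0 r - {0} \<longleftrightarrow> (\<lambda>u. G u / (\<theta> u)^2) holomorphic_on ball 0 r - {0}"
        by (rule holomorphic_cong) (use r in \<open>auto simp: g_def\<close>)
      also have "\<dots>"
        by (intro holomorphic_intros holomorphic_on_subset[OF holG]) (use r in auto)
      finally show "g holomorphic_on ball 0 r - {0}" .
      fix z :: complex assume "z \<in> {0}"
      moreover have "(g \<longlongrightarrow> g 0) (at 0)"
      proof (rule Lim_transform_eventually)
        have "(G2 \<longlongrightarrow> G2 0) (at 0)"
          using isCont_entire[OF holG2] by (simp add: isCont_def)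
        then have "((\<lambda>u. G2 u / (\<theta> u / u)^2) \<longlongrightarrow> G2 0 / d^2) (at 0)"
          using d(1) by (intro tendsto_intros lim) auto
        then show "((\<lambda>u. G2 u / (\<theta> u / u)^2) \<longlongrightarrow> g 0) (at 0)"
          by (simp add: g_def dd)
        show "\<forall>\<^sub>F u in at 0. G2 u / (\<theta> u / u)^2 = g u"
          using eventually_theta_nz[of 0 0, simplified]
          by (auto simp: eventually_at_filter g_def G2 power_divide elim!: eventually_mono)
      qed
      ultimately show "(g \<longlongrightarrow> g z) (at z within ball 0 r)"
        using tendsto_within_subset[of g "nhds (g 0)" 0 UNIV "ball 0 r"] by simp
    qed (use r in auto)
    then show ?thesis using r(1) holomorphic_on_imp_differentiable_at[of g "ball 0 r" 0] by simp
  qed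
  have "g field_differentiable (at u)" for u
  proof (cases "\<theta> u = 0")
    case True
    then obtain j k :: int where u: "u = of_int j * period1 + of_int k * period2"
      using theta_zero_lattice by blast
    obtain D where "(g has_field_derivative D) (at (u + - u))"
      using diff0 by (auto simp: field_differentiable_def)
    then have "((\<lambda>w. g (w + - u)) has_field_derivative D) (at u)"
      by (simp only: DERIV_shift)
    moreover have "g (w + - u) = g w" for w
      using per[of "w + - u" j k] unfolding u by simp
    ultimately show ?thesis by (auto simp: field_differentiable_def)
  next
    case False
    let ?S = "{u. \<theta> u \<noteq> 0}"
    have o: "open ?S"
      using open_Collect_neq[of \<theta> "\<lambda>_. 0"] th_holomorphic[OF norm_p q_nz]
      by (auto intro: holomorphic_on_imp_continuous_on)
    have "g holomorphic_on ?S \<longleftrightarrow> (\<lambda>u. G u / (\<theta> u)^2) holomorphic_on ?S"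
      by (rule holomorphic_cong) (auto simp: g_def)
    also have "\<dots>" by (intro holomorphic_intros holomorphic_on_subset[OF holG]) auto
    finally show ?thesis using False o holomorphic_on_imp_differentiable_at[of g ?S u] by simp
  qed
  then have holg: "g holomorphic_on UNIV" by (simp add: holomorphic_on_def)
  obtain K where K: "compact K" "\<And>u. \<exists>(j::int) (k::int). u + (of_int j * period1 + of_int k * period2) \<in> K"
    using fundamental_domain by blast
  have "range g \<subseteq> g ` K"
    using K(2) per by (metis image_iff image_subsetI)
  moreover have "bounded (g ` K)"
    using K(1) holg by (meson compact_continuous_image compact_imp_bounded continuous_on_subset
        holomorphic_on_imp_continuous_on subset_UNIV)
  ultimately have "g constant_on UNIV"
    using Liouville_theorem[OF holg] bounded_subset by blast
  then obtain c where c: "g u = c" for u by (auto simp: constant_on_def)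
  \<comment> \<open>The constant value of \<open>g\<close> is read off at \<open>w = 1\<close>: the
    right-hand side contains \<theta>(0) and the left-hand side cancels by oddness, while
    \<theta>(1) is nonzero.\<close>
  have "G 1 = 0"
    using theta_minus[of "y - 1"] by (simp add: G_def power2_eq_square algebra_simps)
  then have "c = 0" using c[of 1] by (simp add: g_def)
  then have "G u = 0" if "\<theta> u \<noteq> 0" for u
    using c[of u] that by (simp add: g_def)
  then have ev: "\<forall>\<^sub>F u in at w. G u = 0"
    using eventually_theta_nz[of 0 w, simplified] by (auto elim: eventually_mono)
  have "(G \<longlongrightarrow> G w) (at w)"
    using isCont_entire[OF holG] by (simp add: isCont_def)
  moreover have "(G \<longlongrightarrow> 0) (at w)"
    using ev by (rule tendsto_eventually)
  ultimately have "G w = 0" by (rule tendsto_unique[rotated]) simp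
  then show ?thesis by (simp add: G_def)
qed

end

section \<open>Meromorphic functions of the dynamical parameters\<close>

lemma Rep_Abs_entire2: "entire_on_C2 f \<Longrightarrow> Rep_entire2 (Abs_entire2 f) = f"
  by (simp add: Abs_entire2_inverse)

lemma entire2_eqI: "(\<And>P. Rep_entire2 f P = Rep_entire2 g P) \<Longrightarrow> f = g"
  by (simp add: Rep_entire2_inject[symmetric] fun_eq_iff)

lemma mero_mult:
  assumes "entire_on_C2 f" "entire_on_C2 g"
  shows "mero f * mero g = mero (\<lambda>x. f x * g x)"
proof -
  have "Abs_entire2 f * Abs_entire2 g = Abs_entire2 (\<lambda>x. f x * g x)"
    by (rule entire2_eqI) (simp add: times_entire2.rep_eq Rep_Abs_entire2 assms entire_on_C2_mult)
  then show ?thesis by (simp add: mero_def)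
qed

lemma mero_add:
  assumes "entire_on_C2 f" "entire_on_C2 g"
  shows "mero f + mero g = mero (\<lambda>x. f x + g x)"
proof -
  have "Abs_entire2 f + Abs_entire2 g = Abs_entire2 (\<lambda>x. f x + g x)"
    by (rule entire2_eqI) (simp add: plus_entire2.rep_eq Rep_Abs_entire2 assms entire_on_C2_add)
  then show ?thesis by (simp add: mero_def)
qed

lemma mero_eq_iff:
  assumes "entire_on_C2 f" "entire_on_C2 g"
  shows "mero f = mero g \<longleftrightarrow> f = g"
  using assms by (simp add: mero_def eq_fract Abs_entire2_inject)

lemma const_mult: "const (a * b) = const a * const b"
  by (simp add: mero_mult entire_on_C2_const)

lemma const_add: "const (a + b) = const a + const b"
  by (simp add: mero_add entire_on_C2_const)

lemma const_0 [simp]: "const 0 = 0"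
  by (simp add: mero_def zero_entire2_def[symmetric] Zero_fract_def)

lemma const_1 [simp]: "const 1 = 1"
  by (simp add: mero_def one_entire2_def[symmetric] One_fract_def)

lemma const_eq_iff [simp]: "const a = const b \<longleftrightarrow> a = b"
  using fun_cong[of "\<lambda>_. a" "\<lambda>_. b"] by (auto simp: mero_eq_iff entire_on_C2_const)

lemma const_eq_0_iff [simp]: "const a = 0 \<longleftrightarrow> a = 0"
  using const_eq_iff[of a 0] by (simp del: const_eq_iff)

lemma const_minus: "const (- a) = - const a"
  using const_add[of a "- a"] by (simp add: eq_neg_iff_add_eq_0 add.commute)

lemma const_diff: "const (a - b) = const a - const b"
  using const_add[of a "- b"] by (simp add: const_minus)

lemma shift_entire_add: "shift_entire m (f + g) = shift_entire m f + shift_entire m g"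
  by (rule entire2_eqI) (simp add: Rep_shift_entire plus_entire2.rep_eq)

lemma shift_entire_1 [simp]: "shift_entire m 1 = 1"
  by (rule entire2_eqI) (simp add: Rep_shift_entire one_entire2.rep_eq)

lemma shift_entire_0 [simp]: "shift_entire m 0 = 0"
  by (rule entire2_eqI) (simp add: Rep_shift_entire zero_entire2.rep_eq)

lemma shift_mult: "shift m (f * g) = shift m f * shift m g"
proof -
  obtain a b c d where "f = Fract a b" "b \<noteq> 0" "g = Fract c d" "d \<noteq> 0"
    by (metis Fract_cases)
  then show ?thesis
    by (simp add: shift_Fract shift_entire_mult)
qed

lemma shift_add: "shift m (f + g) = shift m f + shift m g"
proof -
  obtain a b c d where "f = Fract a b" "b \<noteq> 0" "g = Fract c d" "d \<noteq> 0"
    by (metis Fract_cases)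
  then show ?thesis
    by (simp add: shift_Fract shift_entire_mult shift_entire_add shift_entire_eq_0_iff)
qed

lemma shift_1 [simp]: "shift m 1 = 1"
  by (simp add: One_fract_def shift_Fract)

lemma shift_0_right [simp]: "shift m 0 = 0"
  by (simp add: Zero_fract_def shift_Fract)

lemma shift_eq_0_iff [simp]: "shift m f = 0 \<longleftrightarrow> f = 0"
proof -
  obtain a b where "f = Fract a b" "b \<noteq> 0" by (metis Fract_cases)
  then show ?thesis
    by (simp add: shift_Fract Zero_fract_def eq_fract shift_entire_eq_0_iff)
qed

lemma shift_minus: "shift m (- f) = - shift m f"
  using shift_add[of m f "- f"] by (simp add: eq_neg_iff_add_eq_0 add.commute)

lemma shift_diff: "shift m (f - g) = shift m f - shift m g"
  using shift_add[of m f "- g"] by (simp add: shift_minus)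

lemma shift_divide: "shift m (f / g) = shift m f / shift m g"
proof (cases "g = 0")
  case False
  then have "shift m (f / g) * shift m g = shift m f" by (simp add: shift_mult[symmetric])
  then show ?thesis using False by (simp add: eq_divide_eq)
qed simp

lemma shift_shift [simp]: "shift m (shift n f) = shift (m + n) f"
proof -
  obtain a b where f: "f = Fract a b" by (metis Fract_cases)
  have "shift_entire m (shift_entire n c) = shift_entire (m + n) c" for c
    by (rule entire2_eqI) (simp add: Rep_shift_entire add.assoc)
  then show ?thesis by (simp add: f shift_Fract)
qed

lemma shift_0_left [simp]: "shift 0 f = f"
proof -
  obtain a b where f: "f = Fract a b" by (metis Fract_cases)
  have "shift_entire 0 c = c" for c
    by (rule entire2_eqI) (simp add: Rep_shift_entire)
  then show ?thesis by (simp add: f shift_Fract)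
qed

lemma shift_mero:
  assumes "entire_on_C2 f"
  shows "shift m (mero f) = mero (\<lambda>P. f (P + m))"
proof -
  have "shift_entire m (Abs_entire2 f) = Abs_entire2 (\<lambda>P. f (P + m))"
    by (rule entire2_eqI) (simp add: Rep_shift_entire Rep_Abs_entire2 assms entire_on_C2_shift)
  then show ?thesis by (simp add: mero_def shift_Fract)
qed

lemma shift_const [simp]: "shift m (const c) = const c"
  by (simp add: shift_mero entire_on_C2_const)

section \<open>Analytic families\<close>

text \<open>Analyticity is only required for each fixed value of \<open>P\<close>, with a denominator independent of the
  parameter.\<close>

definition entire_family :: "(complex \<Rightarrow> merof) \<Rightarrow> bool" where
  "entire_family \<phi> \<longleftrightarrow> (\<exists>D S. D \<noteq> 0 \<and> (\<forall>u. \<phi> u = Fract (S u) D) \<and>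
     (\<forall>P. (\<lambda>u. Rep_entire2 (S u) P) holomorphic_on UNIV))"

lemma entire_familyI:
  "D \<noteq> 0 \<Longrightarrow> (\<And>u. \<phi> u = Fract (S u) D) \<Longrightarrow>
   (\<And>P. (\<lambda>u. Rep_entire2 (S u) P) holomorphic_on UNIV) \<Longrightarrow> entire_family \<phi>"
  unfolding entire_family_def by blast

lemma entire_family_constant: "entire_family (\<lambda>_. g)"
proof -
  obtain a b where "g = Fract a b" "b \<noteq> 0" by (metis Fract_cases)
  then show ?thesis by (intro entire_familyI[of b _ "\<lambda>_. a"]) auto
qed

lemma entire_family_add:
  assumes "entire_family \<phi>" "entire_family \<psi>"
  shows "entire_family (\<lambda>u. \<phi> u + \<psi> u)"
proof -
  obtain D S where 1: "D \<noteq> 0" "\<And>u. \<phi> u = Fract (S u) D"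
    "\<And>P. (\<lambda>u. Rep_entire2 (S u) P) holomorphic_on UNIV"
    using assms(1) unfolding entire_family_def by blast
  obtain D' S' where 2: "D' \<noteq> 0" "\<And>u. \<psi> u = Fract (S' u) D'"
    "\<And>P. (\<lambda>u. Rep_entire2 (S' u) P) holomorphic_on UNIV"
    using assms(2) unfolding entire_family_def by blast
  show ?thesis
  proof (rule entire_familyI[of "D * D'" _ "\<lambda>u. S u * D' + S' u * D"])
    show "(\<lambda>u. Rep_entire2 (S u * D' + S' u * D) P) holomorphic_on UNIV" for P
      by (simp add: plus_entire2.rep_eq times_entire2.rep_eq) (intro holomorphic_intros 1 2)
  qed (use 1 2 in simp_all)
qed

lemma entire_family_mult:
  assumes "entire_family \<phi>" "entire_family \<psi>"
  shows "entire_family (\<lambda>u. \<phi> u * \<psi> u)"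
proof -
  obtain D S where 1: "D \<noteq> 0" "\<And>u. \<phi> u = Fract (S u) D"
    "\<And>P. (\<lambda>u. Rep_entire2 (S u) P) holomorphic_on UNIV"
    using assms(1) unfolding entire_family_def by blast
  obtain D' S' where 2: "D' \<noteq> 0" "\<And>u. \<psi> u = Fract (S' u) D'"
    "\<And>P. (\<lambda>u. Rep_entire2 (S' u) P) holomorphic_on UNIV"
    using assms(2) unfolding entire_family_def by blast
  show ?thesis
  proof (rule entire_familyI[of "D * D'" _ "\<lambda>u. S u * S' u"])
    show "(\<lambda>u. Rep_entire2 (S u * S' u) P) holomorphic_on UNIV" for P
      by (simp add: times_entire2.rep_eq) (intro holomorphic_intros 1 2)
  qed (use 1 2 in simp_all)
qed

lemma entire_family_minus: "entire_family \<phi> \<Longrightarrow> entire_family (\<lambda>u. - \<phi> u)"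
  using entire_family_mult[OF entire_family_constant[of "-1"], of \<phi>] by simp

lemma entire_family_shift:
  assumes "entire_family \<phi>"
  shows "entire_family (\<lambda>u. shift m (\<phi> u))"
proof -
  obtain D S where 1: "D \<noteq> 0" "\<And>u. \<phi> u = Fract (S u) D"
    "\<And>P. (\<lambda>u. Rep_entire2 (S u) P) holomorphic_on UNIV"
    using assms(1) unfolding entire_family_def by blast
  show ?thesis
    by (rule entire_familyI[of "shift_entire m D" _ "\<lambda>u. shift_entire m (S u)"])
      (use 1 in \<open>simp_all add: shift_entire_eq_0_iff shift_Fract Rep_shift_entire\<close>)
qed

lemma entire_family_compose:
  assumes "entire_family \<phi>" "h holomorphic_on UNIV"
  shows "entire_family (\<lambda>u. \<phi> (h u))"
proof -
  obtain D S where 1: "D \<noteq> 0" "\<And>u. \<phi> u = Fract (S u) D"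
    "\<And>P. (\<lambda>u. Rep_entire2 (S u) P) holomorphic_on UNIV"
    using assms(1) unfolding entire_family_def by blast
  show ?thesis
  proof (rule entire_familyI[of D _ "\<lambda>u. S (h u)"])
    show "(\<lambda>u. Rep_entire2 (S (h u)) P) holomorphic_on UNIV" for P
      using holomorphic_on_compose[OF assms(2) holomorphic_on_subset[OF 1(3)[of P]]]
      by (simp add: o_def)
  qed (use 1 in simp_all)
qed

lemma entire_family_const:
  assumes "f holomorphic_on UNIV"
  shows "entire_family (\<lambda>u. const (f u))"
proof (rule entire_familyI[of 1 _ "\<lambda>u. Abs_entire2 (\<lambda>_. f u)"])
  show "(\<lambda>u. Rep_entire2 (Abs_entire2 (\<lambda>_. f u)) P) holomorphic_on UNIV" for P
    using assms by (simp add: Rep_Abs_entire2 entire_on_C2_const)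
qed (simp_all add: mero_def)

lemma eventually_zero_entire: 
  assumes "f holomorphic_on UNIV" "\<forall>\<^sub>F u in at u0. f u = (0::complex)"
  shows "f u0 = 0"
proof -
  have "(f \<longlongrightarrow> f u0) (at u0)"
    using isCont_entire[OF assms(1)] by (simp add: isCont_def)
  moreover have "(f \<longlongrightarrow> 0) (at u0)"
    using assms(2) by (rule tendsto_eventually)
  ultimately show ?thesis by (rule tendsto_unique[rotated]) simp
qed

lemma entire_family_zero:
  assumes "entire_family \<phi>" "\<forall>\<^sub>F u in at u0. \<phi> u = 0"
  shows "\<phi> u0 = 0"
proof -
  obtain D S where 1: "D \<noteq> 0" "\<And>u. \<phi> u = Fract (S u) D"
    "\<And>P. (\<lambda>u. Rep_entire2 (S u) P) holomorphic_on UNIV"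
    using assms(1) unfolding entire_family_def by blast
  have z: "\<phi> u = 0 \<longleftrightarrow> S u = 0" for u
    using 1(1) by (simp add: 1(2) Zero_fract_def eq_fract)
  have "Rep_entire2 (S u0) P = 0" for P
  proof (rule eventually_zero_entire[OF 1(3)])
    show "\<forall>\<^sub>F u in at u0. Rep_entire2 (S u) P = 0"
      using assms(2) by eventually_elim (simp add: z zero_entire2.rep_eq)
  qed
  then have "S u0 = 0" by (intro entire2_eqI) (simp add: zero_entire2.rep_eq)
  then show ?thesis by (simp add: z)
qed

subsection \<open>Laurent series\<close>

text \<open>A two-sided series that converges at every nonzero \<open>z\<close> splits into a power
  series in \<open>z\<close> and one in \<open>1 / z\<close>, both with infinite radius of
  convergence.\<close>

lemma laurent_series_holomorphic:
  fixes c :: "int \<Rightarrow> complex"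
  assumes "\<And>z. z \<noteq> 0 \<Longrightarrow> ((\<lambda>n. c n * z powi (- n)) has_sum S z) UNIV"
  shows "\<exists>F G. F holomorphic_on UNIV \<and> G holomorphic_on UNIV \<and>
    (\<forall>z. z \<noteq> 0 \<longrightarrow> S z = F z + G (1 / z))"
proof -
  define a where "a n = c (- int n)" for n :: nat
  \<comment> \<open>The constant term is already counted in \<open>a\<close>.\<close>
  define b where "b n = (if n = 0 then 0 else c (int n))" for n :: nat
  have a: "(\<lambda>n. a n * z ^ n) summable_on UNIV" if "z \<noteq> 0" for z
  proof -
    have "(\<lambda>n. c n * z powi (- n)) summable_on ((\<lambda>n. - int n) ` UNIV)"
      by (rule summable_on_subset_banach[OF has_sum_imp_summable[OF assms[OF that]]]) simp
    then have "((\<lambda>n. c n * z powi (- n)) \<circ> (\<lambda>n. - int n)) summable_on UNIV"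
      by (rule iffD1[OF summable_on_reindex, rotated]) (simp add: inj_on_def)
    moreover have "(\<lambda>n. c n * z powi (- n)) \<circ> (\<lambda>n. - int n) = (\<lambda>n. a n * z ^ n)"
      by (simp add: fun_eq_iff a_def)
    ultimately show ?thesis by simp
  qed
  have b: "(\<lambda>n. b n * z ^ n) summable_on UNIV" if "z \<noteq> 0" for z
  proof -
    have "(\<lambda>n. c n * inverse z powi (- n)) summable_on (int ` {1..})"
      by (rule summable_on_subset_banach[OF has_sum_imp_summable[OF assms]]) (use that in auto)
    then have "((\<lambda>n. c n * inverse z powi (- n)) \<circ> int) summable_on {1..}"
      by (rule iffD1[OF summable_on_reindex, rotated]) (simp add: inj_on_def)
    then have "(\<lambda>n. c (int n) * z ^ n) summable_on {1..}"
      by (simp add: o_def power_int_minus power_inverse)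
    moreover have "(\<lambda>n. c (int n) * z ^ n) summable_on {1..} \<longleftrightarrow> (\<lambda>n. b n * z ^ n) summable_on UNIV"
      by (rule summable_on_cong_neutral) (auto simp: b_def)
    ultimately show ?thesis by simp
  qed
  define F where "F z = suminf (\<lambda>n. a n * z ^ n)" for z
  define G where "G z = suminf (\<lambda>n. b n * z ^ n)" for z
  have sa: "(\<lambda>n. a n * z ^ n) sums F z" for z
    using a[of z] unfolding F_def
    by (cases "z = 0") (auto intro!: summable_sums summable_on_imp_summable)
  have sb: "(\<lambda>n. b n * z ^ n) sums G z" for z
    using b[of z] unfolding G_def
    by (cases "z = 0") (auto intro!: summable_sums summable_on_imp_summable)
  have hol: "h holomorphic_on UNIV" if "\<And>z. (\<lambda>n. d n * z ^ n) sums h z" for h :: "complex \<Rightarrow> complex" and d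
  proof -
    have "h holomorphic_on ball 0 r" for r
      by (rule power_series_holomorphic[of 0 r d]) (use that in simp)
    then have "h field_differentiable at z" for z
      using holomorphic_on_imp_differentiable_at[of h "ball 0 (norm z + 1)" z] by simp
    then show ?thesis by (simp add: holomorphic_on_def)
  qed
  have "S z = F z + G (1 / z)" if z: "z \<noteq> 0" for z
  proof -
    have ha: "((\<lambda>n. a n * z ^ n) has_sum F z) UNIV"
      using a[OF z] sa[of z] by (metis has_sum_imp_sums has_sum_infsum sums_unique2)
    have hb: "((\<lambda>n. b n * (1 / z) ^ n) has_sum G (1 / z)) UNIV"
      using b[of "1 / z"] z sb[of "1 / z"] by (metis divide_eq_0_iff has_sum_imp_sums has_sum_infsum sums_unique2 zero_neq_one)
    have "((\<lambda>n. c n * z powi (- n)) has_sum F z) (range (\<lambda>n. - int n))"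
      using ha by (subst has_sum_reindex) (auto simp: inj_on_def o_def a_def)
    moreover have "((\<lambda>n. c n * z powi (- n)) has_sum G (1 / z)) (int ` {1..})"
    proof (subst has_sum_reindex)
      have "((\<lambda>n. c (int n) * z powi - int n) has_sum G (1 / z)) {1..} \<longleftrightarrow>
          ((\<lambda>n. b n * (1 / z) ^ n) has_sum G (1 / z)) UNIV"
        by (rule has_sum_cong_neutral) (auto simp: b_def power_int_minus power_inverse divide_inverse)
      then show "((\<lambda>n. c n * z powi - n) \<circ> int has_sum G (1 / z)) {1..}"
        using hb by (simp add: o_def)
    qed (auto simp: inj_on_def)
    ultimately have "((\<lambda>n. c n * z powi (- n)) has_sum F z + G (1 / z)) (range (\<lambda>n. - int n) \<union> int ` {1..})"
      by (intro has_sum_Un_disjoint) auto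
    moreover have "range (\<lambda>n. - int n) \<union> int ` {1..} = UNIV"
    proof -
      have "x \<in> range (\<lambda>n. - int n) \<union> int ` {1..}" for x
      proof (cases "x \<le> 0")
        case True
        then have "x = - int (nat (- x))" by simp
        then show ?thesis by blast
      next
        case False
        then have "x = int (nat x)" "nat x \<in> {1..}" by auto
        then show ?thesis by blast
      qed
      then show ?thesis by blast
    qed
    ultimately show ?thesis
      using assms[OF z] by (simp add: has_sum_unique)
  qed
  then show ?thesis using hol[OF sa] hol[OF sb] by blast
qed

lemma laurent_sum_entire_family:
  assumes "laurent_sum c \<phi>" "h holomorphic_on UNIV" "\<And>u. h u \<noteq> 0"
  shows "entire_family (\<lambda>u. \<phi> (h u))"
proof -
  obtain D N S where D: "D \<noteq> 0" and z: "\<And>z. z \<noteq> 0 \<Longrightarrow> \<phi> z = Fract (S z) D"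
    and s: "\<And>z P. z \<noteq> 0 \<Longrightarrow> ((\<lambda>n. Rep_entire2 (N n) P * z powi (- n)) has_sum Rep_entire2 (S z) P) UNIV"
    using assms(1) unfolding laurent_sum_def by blast
  show ?thesis
  proof (rule entire_familyI[of D _ "\<lambda>u. S (h u)"])
    fix P
    obtain F G where FG: "F holomorphic_on UNIV" "G holomorphic_on UNIV"
      "\<And>z. z \<noteq> 0 \<Longrightarrow> Rep_entire2 (S z) P = F z + G (1 / z)"
      using laurent_series_holomorphic[of "\<lambda>n. Rep_entire2 (N n) P" "\<lambda>z. Rep_entire2 (S z) P"] s by blast
    have "(\<lambda>u. 1 / h u) holomorphic_on UNIV"
      using assms by (intro holomorphic_intros) auto
    then have "(\<lambda>u. G (1 / h u)) holomorphic_on UNIV"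
      using holomorphic_on_compose[OF _ holomorphic_on_subset[OF FG(2)], of "\<lambda>u. 1 / h u" UNIV]
      by (simp add: o_def)
    then have "(\<lambda>u. F (h u) + G (1 / h u)) holomorphic_on UNIV"
      using holomorphic_on_compose[OF assms(2) holomorphic_on_subset[OF FG(1)]]
      by (auto simp: o_def intro!: holomorphic_intros)
    then show "(\<lambda>u. Rep_entire2 (S (h u)) P) holomorphic_on UNIV"
      by (simp add: FG(3) assms(3))
  qed (use D z assms in auto)
qed

lemma laurent_sum_add:
  assumes "laurent_sum c \<phi>" "laurent_sum d \<psi>"
  shows "laurent_sum (\<lambda>n. c n + d n) (\<lambda>z. \<phi> z + \<psi> z)"
proof -
  obtain D N S where 1: "D \<noteq> 0" "\<And>n. c n = Fract (N n) D" "\<And>z. z \<noteq> 0 \<Longrightarrow> \<phi> z = Fract (S z) D"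
    "\<And>z P. z \<noteq> 0 \<Longrightarrow> ((\<lambda>n. Rep_entire2 (N n) P * z powi (- n)) has_sum Rep_entire2 (S z) P) UNIV"
    using assms(1) unfolding laurent_sum_def by blast
  obtain D' N' S' where 2: "D' \<noteq> 0" "\<And>n. d n = Fract (N' n) D'" "\<And>z. z \<noteq> 0 \<Longrightarrow> \<psi> z = Fract (S' z) D'"
    "\<And>z P. z \<noteq> 0 \<Longrightarrow> ((\<lambda>n. Rep_entire2 (N' n) P * z powi (- n)) has_sum Rep_entire2 (S' z) P) UNIV"
    using assms(2) unfolding laurent_sum_def by blast
  have "((\<lambda>n. Rep_entire2 (N n * D' + N' n * D) P * z powi (- n)) has_sum
      Rep_entire2 (S z * D' + S' z * D) P) UNIV" if "z \<noteq> 0" for z P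
    using has_sum_add[OF has_sum_cmult_right[OF 1(4)[OF that, of P], of "Rep_entire2 D' P"]
        has_sum_cmult_right[OF 2(4)[OF that, of P], of "Rep_entire2 D P"]]
    by (simp add: plus_entire2.rep_eq times_entire2.rep_eq algebra_simps)
  then show ?thesis
    unfolding laurent_sum_def
    using 1 2 by (intro exI[of _ "D * D'"] exI[of _ "\<lambda>n. N n * D' + N' n * D"]
        exI[of _ "\<lambda>z. S z * D' + S' z * D"]) simp
qed

lemma laurent_sum_cmult:
  assumes "laurent_sum c \<phi>"
  shows "laurent_sum (\<lambda>n. g * c n) (\<lambda>z. g * \<phi> z)"
proof -
  obtain D N S where 1: "D \<noteq> 0" "\<And>n. c n = Fract (N n) D" "\<And>z. z \<noteq> 0 \<Longrightarrow> \<phi> z = Fract (S z) D"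
    "\<And>z P. z \<noteq> 0 \<Longrightarrow> ((\<lambda>n. Rep_entire2 (N n) P * z powi (- n)) has_sum Rep_entire2 (S z) P) UNIV"
    using assms(1) unfolding laurent_sum_def by blast
  obtain a b where g: "g = Fract a b" "b \<noteq> 0" by (metis Fract_cases)
  have "((\<lambda>n. Rep_entire2 (a * N n) P * z powi (- n)) has_sum
      Rep_entire2 (a * S z) P) UNIV" if "z \<noteq> 0" for z P
    using has_sum_cmult_right[OF 1(4)[OF that, of P], of "Rep_entire2 a P"]
    by (simp add: times_entire2.rep_eq algebra_simps)
  then show ?thesis
    unfolding laurent_sum_def
    using 1 g by (intro exI[of _ "b * D"] exI[of _ "\<lambda>n. a * N n"] exI[of _ "\<lambda>z. a * S z"]) simp
qed

lemma laurent_sum_0: "laurent_sum (\<lambda>_. 0) \<phi> \<Longrightarrow> z \<noteq> 0 \<Longrightarrow> \<phi> z = 0"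
proof -
  assume "laurent_sum (\<lambda>_. 0) \<phi>" and z: "z \<noteq> 0"
  then obtain D N S where 1: "D \<noteq> 0" "\<And>n::int. 0 = Fract (N n) D" "\<And>z. z \<noteq> 0 \<Longrightarrow> \<phi> z = Fract (S z) D"
    "\<And>z P. z \<noteq> 0 \<Longrightarrow> ((\<lambda>n. Rep_entire2 (N n) P * z powi (- n)) has_sum Rep_entire2 (S z) P) UNIV"
    unfolding laurent_sum_def by blast
  have "N n = 0" for n
    using 1(1) 1(2)[of n] by (simp add: Zero_fract_def eq_fract)
  then have "((\<lambda>n::int. 0) has_sum Rep_entire2 (S z) P) UNIV" for P
    using 1(4)[OF z, of P] by (simp add: zero_entire2.rep_eq)
  then have "Rep_entire2 (S z) P = 0" for P
    using has_sum_unique[OF _ has_sum_0] by blast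
  then have "S z = 0" by (intro entire2_eqI) (simp add: zero_entire2.rep_eq)
  then show ?thesis using 1(1) z by (simp add: 1(3) Zero_fract_def eq_fract)
qed

lemma laurent_sum_zero: "laurent_sum (\<lambda>_. 0) (\<lambda>_. 0)"
  unfolding laurent_sum_def
  by (intro exI[of _ 1] exI[of _ "\<lambda>_. 0"]) (simp add: Zero_fract_def zero_entire2.rep_eq)

lemma laurent_sum_unique:
  assumes "laurent_sum c \<phi>" "laurent_sum c \<psi>" "z \<noteq> 0"
  shows "\<phi> z = \<psi> z"
  using laurent_sum_0[OF _ assms(3), of "\<lambda>z. \<phi> z + -1 * \<psi> z"]
    laurent_sum_add[OF assms(1) laurent_sum_cmult[OF assms(2), of "-1"]] by simp

section \<open>Analytic families of vectors\<close>

text \<open>Finite sums of fixed vectors with analytic coefficients. This needs neither a basis nor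
  a topology on \<open>V\<close>, and closure properties follow by rule induction.\<close>

inductive analytic_family ::
  "(merof \<Rightarrow> 'v::ab_group_add \<Rightarrow> 'v) \<Rightarrow> 'v set \<Rightarrow> (complex \<Rightarrow> 'v) \<Rightarrow> bool" for sc V where
  single: "e \<in> V \<Longrightarrow> entire_family \<phi> \<Longrightarrow> analytic_family sc V (\<lambda>u. sc (\<phi> u) e)"
| add: "analytic_family sc V X \<Longrightarrow> analytic_family sc V Y \<Longrightarrow> analytic_family sc V (\<lambda>u. X u + Y u)"

locale merof_space = vector_space sc for sc :: "merof \<Rightarrow> 'v::ab_group_add \<Rightarrow> 'v"
begin

lemma separating_functional:
  assumes "x \<noteq> 0"
  obtains m :: "'v \<Rightarrow> merof" where "\<And>x y. m (x + y) = m x + m y" "\<And>g x. m (sc g x) = g * m x" "m x = 1"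
proof -
  interpret M: vector_space "(*) :: merof \<Rightarrow> merof \<Rightarrow> merof"
    by unfold_locales (simp_all add: algebra_simps)
  interpret P: vector_space_pair sc "(*) :: merof \<Rightarrow> merof \<Rightarrow> merof" ..
  have "independent {x}" using assms by simp
  from P.linear_independent_extend[OF this, of "\<lambda>_. 1"]
  obtain m where m: "Vector_Spaces.linear sc (*) m" "\<forall>y\<in>{x}. m y = 1"
    by blast
  interpret L: Vector_Spaces.linear sc "(*)" m by fact
  show ?thesis using that[of m] L.add L.scale m(2) by simp
qed

text \<open>Linear functionals reduce identities of vectors to identities of meromorphic functions,
  for which analytic continuation and comparison of Laurent coefficients are available.\<close>

lemma functional_eqI:
  assumes "\<And>m :: 'v \<Rightarrow> merof. (\<And>x y. m (x + y) = m x + m y) \<Longrightarrow> (\<And>g x. m (sc g x) = g * m x) \<Longrightarrow> m x = m y"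
  shows "x = y"
proof (rule ccontr)
  assume "x \<noteq> y"
  then have "x - y \<noteq> 0" by simp
  then obtain m :: "'v \<Rightarrow> merof" where m: "\<And>x y. m (x + y) = m x + m y" "\<And>g x. m (sc g x) = g * m x" "m (x - y) = 1"
    using separating_functional by blast
  have "m (x - y) + m y = m x" using m(1)[of "x - y" y] by simp
  then show False using assms[of m] m by simp
qed

lemma analytic_family_eq:
  assumes "analytic_family sc V X" "analytic_family sc V Y" "\<forall>\<^sub>F u in at u0. X u = Y u"
  shows "X u0 = Y u0"
proof (rule functional_eqI)
  fix m :: "'v \<Rightarrow> merof"
  assume m: "\<And>x y. m (x + y) = m x + m y" "\<And>g x. m (sc g x) = g * m x"
  have e: "entire_family (\<lambda>u. m (X u))" if "analytic_family sc V X" for X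
    using that by induction (simp_all add: m entire_family_mult entire_family_add entire_family_constant)
  have "entire_family (\<lambda>u. m (X u) + - m (Y u))"
    by (intro entire_family_add entire_family_minus e assms)
  moreover have "\<forall>\<^sub>F u in at u0. m (X u) + - m (Y u) = 0"
    using assms(3) by eventually_elim simp
  ultimately show "m (X u0) = m (Y u0)"
    using entire_family_zero[of "\<lambda>u. m (X u) + - m (Y u)" u0] by simp
qed

lemma analytic_family_scale:
  assumes "analytic_family sc V X" "entire_family \<phi>"
  shows "analytic_family sc V (\<lambda>u. sc (\<phi> u) (X u))"
  using assms(1)
proof induction
  case (single e \<psi>)
  then show ?case
    using analytic_family.single[OF single(1) entire_family_mult[OF assms(2) single(2)], of sc] by simp
next
  case (add X Y)
  then show ?case by (simp add: scale_right_distrib analytic_family.add)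
qed

lemma analytic_family_constant: "v \<in> V \<Longrightarrow> analytic_family sc V (\<lambda>_. v)"
  using analytic_family.single[OF _ entire_family_constant, of v V sc 1] by simp

lemma analytic_family_sum:
  assumes "subspace V" "\<And>i. i \<in> I \<Longrightarrow> analytic_family sc V (X i)"
  shows "analytic_family sc V (\<lambda>u. \<Sum>i\<in>I. X i u)"
  using assms(2)
  by (induction I rule: infinite_finite_induct)
    (simp_all add: analytic_family.add analytic_family_constant subspace_0 assms(1))

lemma analytic_family_mem:
  assumes "subspace V" "analytic_family sc V X"
  shows "X u \<in> V"
  using assms(2) by induction (simp_all add: assms(1) subspace_scale subspace_add)

text \<open>The operators are semilinear: they shift the coefficients by a fixed \<open>m\<close>.
  Since shifting preserves entire families, an operator depending analytically on \<open>u\<close>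
  may be applied to a vector depending analytically on \<open>u\<close>.\<close>

lemma analytic_family_apply:
  assumes V: "subspace V" and add: "\<And>u x y. x \<in> V \<Longrightarrow> y \<in> V \<Longrightarrow> F u (x + y) = F u x + F u y"
    and scale: "\<And>u g x. x \<in> V \<Longrightarrow> F u (sc g x) = sc (shift m g) (F u x)"
    and F: "\<And>x. x \<in> V \<Longrightarrow> analytic_family sc W (\<lambda>u. F u x)"
    and Z: "analytic_family sc V Z"
  shows "analytic_family sc W (\<lambda>u. F u (Z u))"
  using Z
proof induction
  case (single e \<phi>)
  then show ?case
    by (simp add: scale analytic_family_scale F entire_family_shift)
next
  case (add X Y)
  then show ?case
    using analytic_family.add[OF add(3,4)] by (simp add: assms(2) analytic_family_mem[OF V])
qed

lemma analytic_family_compose: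
  assumes "analytic_family sc V X" "h holomorphic_on UNIV"
  shows "analytic_family sc V (\<lambda>u. X (h u))"
  using assms(1)
proof induction
  case (single e \<phi>)
  show ?case
    by (rule analytic_family.single[OF single(1) entire_family_compose[OF single(2) assms(2)]])
qed (rule analytic_family.add)

text \<open>Linearity of \<open>m\<close> is required on \<open>V\<close> only, so that
  \<open>m\<close> may be a functional composed with the action of \<open>g(P + h)\<close>, which is
  linear only there.\<close>

lemma laurent_sum_vec_functional:
  fixes m :: "'v \<Rightarrow> merof"
  assumes V: "subspace V" and m: "\<And>x y. x \<in> V \<Longrightarrow> y \<in> V \<Longrightarrow> m (x + y) = m x + m y" "\<And>g x. x \<in> V \<Longrightarrow> m (sc g x) = g * m x"
    and L: "laurent_sum_vec sc V x X"
  shows "laurent_sum (\<lambda>n. m (x n)) (\<lambda>z. m (X z))"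
proof -
  obtain B c \<phi> where B: "finite B" "B \<subseteq> V" and c: "\<And>e. e \<in> B \<Longrightarrow> laurent_sum (c e) (\<phi> e)"
    and x: "\<And>n. x n = (\<Sum>e\<in>B. sc (c e n) e)" and X: "\<And>z. z \<noteq> 0 \<Longrightarrow> X z = (\<Sum>e\<in>B. sc (\<phi> e z) e)"
    using L unfolding laurent_sum_vec_def by blast
  have m0: "m 0 = 0" using m(2)[of 0 0] V subspace_0 by simp
  have m_sum: "m (\<Sum>e\<in>B. sc (d e) e) = (\<Sum>e\<in>B. d e * m e)" for d
    using B
  proof (induction B rule: finite_induct)
    case (insert e B)
    have "(\<Sum>e\<in>B. sc (d e) e) \<in> V"
      using insert.prems by (intro subspace_sum[OF V] subspace_scale[OF V]) auto
    then show ?case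
      using insert m V subspace_scale[OF V, of e "d e"] by simp
  qed (simp add: m0)
  have "laurent_sum (\<lambda>n. \<Sum>e\<in>B. c e n * m e) (\<lambda>z. \<Sum>e\<in>B. \<phi> e z * m e)"
    using B(1) c
  proof (induction B rule: finite_induct)
    case (insert e B)
    then show ?case
      using laurent_sum_add[OF laurent_sum_cmult[OF insert.prems[of e], of "m e"] insert.IH]
      by (simp add: mult.commute)
  qed (simp add: laurent_sum_zero)
  then have *: "laurent_sum (\<lambda>n. m (x n)) (\<lambda>z. \<Sum>e\<in>B. \<phi> e z * m e)"
    by (simp add: x m_sum)
  then show ?thesis
    unfolding laurent_sum_def by (simp add: X m_sum)
qed

lemma laurent_sum_vec_analytic:
  assumes V: "subspace V" and L: "laurent_sum_vec sc V x X" and h: "h holomorphic_on UNIV" "\<And>u. h u \<noteq> 0"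
  shows "analytic_family sc V (\<lambda>u. X (h u))"
proof -
  obtain B c \<phi> where B: "finite B" "B \<subseteq> V" and c: "\<And>e. e \<in> B \<Longrightarrow> laurent_sum (c e) (\<phi> e)"
    and X: "\<And>z. z \<noteq> 0 \<Longrightarrow> X z = (\<Sum>e\<in>B. sc (\<phi> e z) e)"
    using L unfolding laurent_sum_vec_def by blast
  have "analytic_family sc V (\<lambda>u. \<Sum>e\<in>B. sc (\<phi> e (h u)) e)"
    using B c by (intro analytic_family_sum V analytic_family.single laurent_sum_entire_family[OF _ h]) auto
  then show ?thesis by (simp add: X h(2))
qed

end

section \<open>Theta functions of the dynamical parameter and the rescaled R-matrix\<close>

context generic_parameters
begin

lemma entire_thPi: "entire_on_C2 (\<lambda>P. \<theta> (c + (fst P - snd P)))"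
  by (rule thPi_entire[OF norm_p q_nz])

abbreviation \<Theta> :: "complex \<Rightarrow> merof" where "\<Theta> \<equiv> thPi q p"

lemma shift_thPi: "shift m (\<Theta> c) = \<Theta> (c + fst m - snd m)"
  by (simp add: thPi_def shift_mero[OF entire_thPi]) (simp add: algebra_simps)

lemma thPi_inv_eq: "thPi_inv q p c = - \<Theta> (- c)"
proof -
  have "thPi_inv q p c = mero (\<lambda>P. (-1) * \<theta> (- c + (fst P - snd P)))"
    unfolding thPi_inv_def
  proof (intro arg_cong[of _ _ mero] ext)
    show "\<theta> (c - (fst P - snd P)) = - 1 * \<theta> (- c + (fst P - snd P))" for P
      using theta_diff_commute[of c "fst P - snd P"] by (simp add: add.commute[of "- c"])
  qed
  also have "\<dots> = const (-1) * \<Theta> (- c)"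
    unfolding thPi_def by (rule mero_mult[symmetric, OF entire_on_C2_const entire_thPi])
  finally show ?thesis by (simp add: const_minus)
qed

lemma thPi_nz [simp]: "\<Theta> c \<noteq> 0"
proof
  assume "\<Theta> c = 0"
  then have "mero (\<lambda>P. \<theta> (c + (fst P - snd P))) = mero (\<lambda>_. 0)"
    by (simp add: thPi_def)
  then have "(\<lambda>P. \<theta> (c + (fst P - snd P))) = (\<lambda>_. 0)"
    by (simp only: mero_eq_iff[OF entire_thPi entire_on_C2_const])
  from fun_cong[OF this, of "(1 - c, 0)"] show False by simp
qed

lemma entire_family_thPi:
  assumes "h holomorphic_on UNIV"
  shows "entire_family (\<lambda>u. \<Theta> (h u))"
proof (rule entire_familyI[of 1 _ "\<lambda>u. Abs_entire2 (\<lambda>P. \<theta> (h u + (fst P - snd P)))"])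
  show "(\<lambda>u. Rep_entire2 (Abs_entire2 (\<lambda>P. \<theta> (h u + (fst P - snd P)))) P) holomorphic_on UNIV" for P
    unfolding Rep_Abs_entire2[OF entire_thPi] by (intro holomorphic_intros assms)
qed (simp_all add: thPi_def mero_def)

lemma thPi_three_term:
  "\<Theta> (c + 1) * \<Theta> (c - 1) * const (\<theta> w)^2 =
   const (\<theta> (w - 1) * \<theta> (w + 1)) * (\<Theta> c)^2 + const (\<theta> 1)^2 * \<Theta> (c + w) * \<Theta> (c - w)"
proof -
  note e = entire_thPi entire_on_C2_const entire_on_C2_mult entire_on_C2_add
  have *: "\<theta> (y + 1) * \<theta> (y - 1) * (\<theta> w * \<theta> w) =
      \<theta> (w - 1) * \<theta> (w + 1) * (\<theta> y * \<theta> y) + \<theta> 1 * \<theta> 1 * \<theta> (y + w) * \<theta> (y - w)" for y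
  proof -
    have e1: "\<theta> (y - w) = - \<theta> (w - y)" by (rule theta_diff_commute)
    have e2: "\<theta> (y + w) = \<theta> (w + y)" by (simp only: add.commute)
    show ?thesis
      unfolding e1 e2 using theta_three_term[of y w] unfolding power2_eq_square by algebra
  qed
  have arg: "c + 1 + x = (c + x) + 1" "c - 1 + x = (c + x) - 1" "c + w + x = (c + x) + w" "c - w + x = (c + x) - w"
    for x by simp_all
  have "mero (\<lambda>P. \<theta> (c + 1 + (fst P - snd P)) * \<theta> (c - 1 + (fst P - snd P)) * (\<theta> w * \<theta> w)) =
    mero (\<lambda>P. \<theta> (w - 1) * \<theta> (w + 1) * (\<theta> (c + (fst P - snd P)) * \<theta> (c + (fst P - snd P))) +
      \<theta> 1 * \<theta> 1 * \<theta> (c + w + (fst P - snd P)) * \<theta> (c - w + (fst P - snd P)))"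
    unfolding arg * by (rule refl)
  then show ?thesis
    by (simp only: mero_mult[symmetric] mero_add[symmetric] e thPi_def power2_eq_square)
qed

text \<open>The entries of the R-matrix times \<open>\<theta>(q\<^sup>2z)\<close>, which makes them entire in the spectral parameter.\<close>

definition Rt :: "complex \<Rightarrow> nat \<Rightarrow> nat \<Rightarrow> nat \<Rightarrow> nat \<Rightarrow> merof" where
  "Rt w i j k l =
    (if (i, j, k, l) = (1, 1, 1, 1) \<or> (i, j, k, l) = (2, 2, 2, 2) then const (\<theta> (w + 1))
     else if (i, j, k, l) = (1, 2, 1, 2) then const (\<theta> w) * (\<Theta> 1 * \<Theta> (-1) / (\<Theta> 0)^2)
     else if (i, j, k, l) = (2, 1, 2, 1) then const (\<theta> w)
     else if (i, j, k, l) = (1, 2, 2, 1) then const (\<theta> 1) * (\<Theta> w / \<Theta> 0)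
     else if (i, j, k, l) = (2, 1, 1, 2) then const (\<theta> 1) * (\<Theta> (- w) / \<Theta> 0)
     else 0)"

text \<open>The two signs that arise when \<open>thPi_inv\<close> is rewritten by
  \<open>thPi_inv_eq\<close> in numerator and denominator cancel.\<close>

lemma Rt_Rbar:
  assumes "\<theta> (w + 1) \<noteq> 0"
  shows "Rt w i j k l = const (\<theta> (w + 1)) * Rbar q p w i j k l"
  using assms unfolding Rt_def Rbar_def
  by (simp add: thPi_inv_eq power2_eq_square)

lemma entire_family_Rt:
  assumes "h holomorphic_on UNIV"
  shows "entire_family (\<lambda>u. Rt (h u) i j k l)"
proof -
  have if_rule: "entire_family (\<lambda>u. if b then \<phi> u else \<psi> u)"
    if "b \<Longrightarrow> entire_family \<phi>" "\<not> b \<Longrightarrow> entire_family \<psi>" for b \<phi> \<psi>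
    using that by (cases b) simp_all
  show ?thesis
    unfolding Rt_def divide_inverse
    by (intro if_rule entire_family_mult entire_family_const entire_family_thPi entire_family_constant
        holomorphic_intros assms)
qed

end

section \<open>Consequences of the RLL relations\<close>

declare One_nat_def [simp del]

lemma sum_12: "(\<Sum>a\<in>{1, 2::nat}. f a) = f 1 + f 2"
  by simp

lemma epsilon_1 [simp]: "epsilon 1 = (1, 0)" and epsilon_2 [simp]: "epsilon 2 = (0, 1)"
  by (simp_all add: epsilon_def)

text \<open>The setting is stated for operators \<open>X i j u\<close> in the additive parameter, so
  that it applies both to the currents and to their twists by a scalar function. \<open>aP g\<close>
  is \<open>g(P + h)\<close>, a function of \<Pi>, while \<open>sc g\<close> is \<open>g(P)\<close>,
  a function of \<Pi>*.\<close>

locale rll_operators = generic_parameters q p + merof_space sc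
  for q p :: complex and sc :: "merof \<Rightarrow> 'v::ab_group_add \<Rightarrow> 'v" +
  fixes V :: "'v set" and aP :: "merof \<Rightarrow> 'v \<Rightarrow> 'v" and X :: "nat \<Rightarrow> nat \<Rightarrow> complex \<Rightarrow> 'v \<Rightarrow> 'v"
  assumes V: "subspace V"
    and aP_closed [simp]: "v \<in> V \<Longrightarrow> aP g v \<in> V"
    and aP_add: "v \<in> V \<Longrightarrow> w \<in> V \<Longrightarrow> aP g (v + w) = aP g v + aP g w"
    and aP_scale: "v \<in> V \<Longrightarrow> aP g (sc f v) = sc f (aP g v)"
    and weights: "V \<subseteq> span (\<Union>m. {v \<in> V. \<forall>g. aP g v = sc (shift m g) v})"
    and X_closed: "i \<in> {1,2} \<Longrightarrow> j \<in> {1,2} \<Longrightarrow> v \<in> V \<Longrightarrow> X i j u v \<in> V"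
    and X_add: "i \<in> {1,2} \<Longrightarrow> j \<in> {1,2} \<Longrightarrow> v \<in> V \<Longrightarrow> w \<in> V \<Longrightarrow> X i j u (v + w) = X i j u v + X i j u w"
    and X_scale: "i \<in> {1,2} \<Longrightarrow> j \<in> {1,2} \<Longrightarrow> v \<in> V \<Longrightarrow> X i j u (sc g v) = sc (shift (epsilon j) g) (X i j u v)"
    and X_aP: "i \<in> {1,2} \<Longrightarrow> j \<in> {1,2} \<Longrightarrow> v \<in> V \<Longrightarrow> aP g (X i j u v) = X i j u (aP (shift (- epsilon i) g) v)"
    and X_analytic: "i \<in> {1,2} \<Longrightarrow> j \<in> {1,2} \<Longrightarrow> v \<in> V \<Longrightarrow> analytic_family sc V (\<lambda>u. X i j u v)"
    and RLL: "\<theta> (u1 - u2 + 1) \<noteq> 0 \<Longrightarrow> i \<in> {1,2} \<Longrightarrow> j \<in> {1,2} \<Longrightarrow> k \<in> {1,2} \<Longrightarrow> l \<in> {1,2} \<Longrightarrow> v \<in> V \<Longrightarrow>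
      (\<Sum>a\<in>{1,2}. \<Sum>b\<in>{1,2}. aP (Rbar q p (u1 - u2) i j a b) (X a k u1 (X b l u2 v))) =
      (\<Sum>a\<in>{1,2}. \<Sum>b\<in>{1,2}. X j b u2 (X i a u1 (sc (Rbar q p (u1 - u2) a b k l) v)))"
begin

lemmas V_intros [simp, intro] = subspace_0[OF V] subspace_add[OF V] subspace_scale[OF V]

lemma V_diff [simp]: "v \<in> V \<Longrightarrow> w \<in> V \<Longrightarrow> v - w \<in> V" and V_neg [simp]: "v \<in> V \<Longrightarrow> - v \<in> V"
  using V by (auto intro: subspace_diff subspace_neg)

lemma X_closed' [simp]: "v \<in> V \<Longrightarrow> X 1 1 u v \<in> V" "v \<in> V \<Longrightarrow> X 1 2 u v \<in> V"
  "v \<in> V \<Longrightarrow> X 2 1 u v \<in> V" "v \<in> V \<Longrightarrow> X 2 2 u v \<in> V"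
  by (simp_all add: X_closed)

lemma X_const: "i \<in> {1,2} \<Longrightarrow> j \<in> {1,2} \<Longrightarrow> v \<in> V \<Longrightarrow> X i j u (sc (const c) v) = sc (const c) (X i j u v)"
  by (simp add: X_scale)

lemma X_const_mult: "i \<in> {1,2} \<Longrightarrow> j \<in> {1,2} \<Longrightarrow> v \<in> V \<Longrightarrow>
    X i j u (sc (const c * g) v) = sc (const c) (X i j u (sc g v))"
  using X_const[of i j "sc g v" u c] by simp

lemma X_0: "i \<in> {1,2} \<Longrightarrow> j \<in> {1,2} \<Longrightarrow> X i j u 0 = 0"
  using X_const[of i j 0 u 0] by simp

lemma X_neg: "i \<in> {1,2} \<Longrightarrow> j \<in> {1,2} \<Longrightarrow> v \<in> V \<Longrightarrow> X i j u (- v) = - X i j u v"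
  using X_const[of i j v u "-1"] by (simp add: const_minus)

lemma X_diff: "i \<in> {1,2} \<Longrightarrow> j \<in> {1,2} \<Longrightarrow> v \<in> V \<Longrightarrow> w \<in> V \<Longrightarrow> X i j u (v - w) = X i j u v - X i j u w"
  using X_add[of i j v "- w" u] X_neg[of i j w u] by simp

lemma weight_induct [consumes 1, case_names weight add scale]:
  assumes "v \<in> V" "\<And>m v. v \<in> V \<Longrightarrow> (\<And>g. aP g v = sc (shift m g) v) \<Longrightarrow> P v"
    "\<And>v w. v \<in> V \<Longrightarrow> w \<in> V \<Longrightarrow> P v \<Longrightarrow> P w \<Longrightarrow> P (v + w)" "\<And>c v. v \<in> V \<Longrightarrow> P v \<Longrightarrow> P (sc c v)"
  shows "P v"
proof -
  have 0: "aP g 0 = 0" for g using aP_scale[of 0 g 0] by simp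
  have "v \<in> span (\<Union>m. {v \<in> V. \<forall>g. aP g v = sc (shift m g) v})" using assms(1) weights by blast
  then have "v \<in> V \<and> P v"
  proof (rule span_induct)
    show "subspace {v. v \<in> V \<and> P v}"
      by (rule subspaceI) (use assms(3,4) assms(2)[of 0] 0 in auto)
  qed (use assms(2) in auto)
  then show ?thesis by blast
qed

text \<open>Multiplicativity in \<open>g\<close> is not among the axioms. On a weight vector
  \<open>aP g\<close> is multiplication by a shift of \<open>g\<close>, and shifting is a ring
  homomorphism; weight vectors span.\<close>

lemma aP_mult: "v \<in> V \<Longrightarrow> aP (f * g) v = aP f (aP g v)"
  by (induction v rule: weight_induct) (simp_all add: aP_add aP_scale shift_mult mult.commute)

lemma aP_add_left: "v \<in> V \<Longrightarrow> aP (f + g) v = aP f v + aP g v"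
  by (induction v rule: weight_induct)
    (simp_all add: aP_add aP_scale shift_add scale_left_distrib scale_right_distrib add_ac)

lemma aP_const [simp]: "v \<in> V \<Longrightarrow> aP (const c) v = sc (const c) v"
  by (induction v rule: weight_induct) (simp_all add: aP_add aP_scale scale_right_distrib mult.commute)

lemma aP_0 [simp]: "v \<in> V \<Longrightarrow> aP 0 v = 0"
  using aP_const[of v 0] by simp

lemma aP_1 [simp]: "v \<in> V \<Longrightarrow> aP 1 v = v"
  using aP_const[of v 1] by simp

lemma aP_zero [simp]: "aP g 0 = 0"
  using aP_scale[of 0 g 0] by simp

lemma analytic_X:
  assumes "i \<in> {1,2}" "j \<in> {1,2}" "analytic_family sc V Z" "h holomorphic_on UNIV"
  shows "analytic_family sc V (\<lambda>u. X i j (h u) (Z u))"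
  by (rule analytic_family_apply[OF V _ _ _ assms(3), of "\<lambda>u. X i j (h u)" "epsilon j"])
    (use assms in \<open>auto intro: X_add X_scale analytic_family_compose[OF X_analytic]\<close>)

lemma analytic_aP:
  assumes Z: "analytic_family sc V Z" and \<phi>: "entire_family \<phi>"
  shows "analytic_family sc V (\<lambda>u. aP (\<phi> u) (Z u))"
proof -
  have *: "analytic_family sc V (\<lambda>u. aP (\<phi> u) e)" if "e \<in> V" for e
    using that
  proof (induction e rule: weight_induct)
    case (weight m v)
    show ?case unfolding weight(2)
      by (rule analytic_family.single[OF weight(1) entire_family_shift[OF \<phi>]])
  next
    case (add v w)
    then show ?case by (simp add: aP_add analytic_family.add)
  next
    case (scale c v)
    then show ?case by (simp add: aP_scale analytic_family_scale entire_family_constant)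
  qed
  show ?thesis using Z
    by induction
      (simp_all add: * aP_add aP_scale analytic_family.add analytic_family_scale analytic_family_mem[OF V])
qed

text \<open>Multiplied by \<theta>(u1 - u2 + 1), both sides are analytic in \<open>u1\<close>, so
  the relation extends to the zeros of this factor that \<open>RLL\<close> excludes. The case
  \<open>u1 = u2 - 1\<close> gained here is the source of the quantum determinant.\<close>

lemma RLL_entire:
  assumes ijkl: "i \<in> {1,2}" "j \<in> {1,2}" "k \<in> {1,2}" "l \<in> {1,2}" and v: "v \<in> V"
  shows "(\<Sum>a\<in>{1,2}. \<Sum>b\<in>{1,2}. aP (Rt (u1 - u2) i j a b) (X a k u1 (X b l u2 v))) =
      (\<Sum>a\<in>{1,2}. \<Sum>b\<in>{1,2}. X j b u2 (X i a u1 (sc (Rt (u1 - u2) a b k l) v)))"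
proof (rule analytic_family_eq[of V "\<lambda>u1. (\<Sum>a\<in>{1,2}. \<Sum>b\<in>{1,2}. aP (Rt (u1 - u2) i j a b) (X a k u1 (X b l u2 v)))"
      "\<lambda>u1. (\<Sum>a\<in>{1,2}. \<Sum>b\<in>{1,2}. X j b u2 (X i a u1 (sc (Rt (u1 - u2) a b k l) v)))"])
  have h: "(\<lambda>u1. u1 - u2) holomorphic_on UNIV" by (intro holomorphic_intros)
  show "analytic_family sc V (\<lambda>u1. \<Sum>a\<in>{1,2}. \<Sum>b\<in>{1,2}. aP (Rt (u1 - u2) i j a b) (X a k u1 (X b l u2 v)))"
    by (intro analytic_family_sum V analytic_aP analytic_X analytic_family_constant X_closed
        entire_family_Rt ijkl v h) (auto intro!: holomorphic_intros)
  show "analytic_family sc V (\<lambda>u1. \<Sum>a\<in>{1,2}. \<Sum>b\<in>{1,2}. X j b u2 (X i a u1 (sc (Rt (u1 - u2) a b k l) v)))"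
    by (intro analytic_family_sum V analytic_X analytic_family_scale analytic_family_constant
        entire_family_Rt ijkl v h) (auto intro!: holomorphic_intros)
  have "(\<Sum>a\<in>{1,2}. \<Sum>b\<in>{1,2}. aP (Rt (u1 - u2) i j a b) (X a k u1 (X b l u2 v))) =
      (\<Sum>a\<in>{1,2}. \<Sum>b\<in>{1,2}. X j b u2 (X i a u1 (sc (Rt (u1 - u2) a b k l) v)))"
    if nz: "\<theta> (u1 + (1 - u2)) \<noteq> 0" for u1
  proof -
    have nz: "\<theta> (u1 - u2 + 1) \<noteq> 0" using nz by (simp add: algebra_simps)
    let ?c = "const (\<theta> (u1 - u2 + 1))"
    have "(\<Sum>a\<in>{1,2}. \<Sum>b\<in>{1,2}. aP (Rt (u1 - u2) i j a b) (X a k u1 (X b l u2 v))) =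
      sc ?c (\<Sum>a\<in>{1,2}. \<Sum>b\<in>{1,2}. aP (Rbar q p (u1 - u2) i j a b) (X a k u1 (X b l u2 v)))"
      unfolding scale_sum_right Rt_Rbar[OF nz]
      by (intro sum.cong refl) (use ijkl v in \<open>simp add: aP_mult X_closed del: insert_iff\<close>)
    also have "\<dots> = (\<Sum>a\<in>{1,2}. \<Sum>b\<in>{1,2}. X j b u2 (X i a u1 (sc (Rt (u1 - u2) a b k l) v)))"
      unfolding RLL[OF nz ijkl v] scale_sum_right Rt_Rbar[OF nz]
      by (intro sum.cong refl)
        (use ijkl v in \<open>simp add: X_closed X_const scale_scale[symmetric] del: insert_iff scale_scale\<close>)
    finally show ?thesis .
  qed
  then show "\<forall>\<^sub>F u1 in at u1. (\<Sum>a\<in>{1,2}. \<Sum>b\<in>{1,2}. aP (Rt (u1 - u2) i j a b) (X a k u1 (X b l u2 v))) =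
      (\<Sum>a\<in>{1,2}. \<Sum>b\<in>{1,2}. X j b u2 (X i a u1 (sc (Rt (u1 - u2) a b k l) v)))"
    using eventually_theta_nz[of "1 - u2" u1] by (rule eventually_mono[rotated])
qed

section \<open>Exchange relations in components\<close>

lemma Rt_simps:
  "Rt w 1 1 1 1 = const (\<theta> (w + 1))" "Rt w 1 1 1 2 = 0" "Rt w 1 1 2 1 = 0" "Rt w 1 1 2 2 = 0"
  "Rt w 1 2 1 1 = 0" "Rt w 1 2 1 2 = const (\<theta> w) * (\<Theta> 1 * \<Theta> (-1) / (\<Theta> 0)^2)"
  "Rt w 1 2 2 1 = const (\<theta> 1) * (\<Theta> w / \<Theta> 0)" "Rt w 1 2 2 2 = 0"
  "Rt w 2 1 1 1 = 0" "Rt w 2 1 1 2 = const (\<theta> 1) * (\<Theta> (- w) / \<Theta> 0)"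
  "Rt w 2 1 2 1 = const (\<theta> w)" "Rt w 2 1 2 2 = 0"
  "Rt w 2 2 1 1 = 0" "Rt w 2 2 1 2 = 0" "Rt w 2 2 2 1 = 0" "Rt w 2 2 2 2 = const (\<theta> (w + 1))"
  by (simp_all add: Rt_def)

text \<open>The four digits in each name are the row pair \<open>i j\<close> followed by the column
  pair \<open>k l\<close> of the matrix relation.\<close>

lemma
  assumes v: "v \<in> V"
  shows RLL_1122: "sc (const (\<theta> (u1 - u2 + 1))) (X 1 2 u1 (X 1 2 u2 v)) =
      sc (const (\<theta> (u1 - u2 + 1))) (X 1 2 u2 (X 1 2 u1 v))"
    and RLL_2122: "sc (const (\<theta> (u1 - u2))) (X 2 2 u1 (X 1 2 u2 v)) +
      aP (const (\<theta> 1) * (\<Theta> (- (u1 - u2)) / \<Theta> 0)) (X 1 2 u1 (X 2 2 u2 v)) =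
      sc (const (\<theta> (u1 - u2 + 1))) (X 1 2 u2 (X 2 2 u1 v))"
    and RLL_2112: "sc (const (\<theta> (u1 - u2))) (X 2 1 u1 (X 1 2 u2 v)) +
      aP (const (\<theta> 1) * (\<Theta> (- (u1 - u2)) / \<Theta> 0)) (X 1 1 u1 (X 2 2 u2 v)) =
      X 1 2 u2 (X 2 1 u1 (sc (const (\<theta> (u1 - u2)) * (\<Theta> 1 * \<Theta> (-1) / (\<Theta> 0)^2)) v)) +
      X 1 1 u2 (X 2 2 u1 (sc (const (\<theta> 1) * (\<Theta> (- (u1 - u2)) / \<Theta> 0)) v))"
    and RLL_2221: "sc (const (\<theta> (u1 - u2 + 1))) (X 2 2 u1 (X 2 1 u2 v)) =
      sc (const (\<theta> (u1 - u2))) (X 2 1 u2 (X 2 2 u1 v)) +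
      X 2 2 u2 (X 2 1 u1 (sc (const (\<theta> 1) * (\<Theta> (u1 - u2) / \<Theta> 0)) v))"
    and RLL_1112: "sc (const (\<theta> (u1 - u2 + 1))) (X 1 1 u1 (X 1 2 u2 v)) =
      X 1 2 u2 (X 1 1 u1 (sc (const (\<theta> (u1 - u2)) * (\<Theta> 1 * \<Theta> (-1) / (\<Theta> 0)^2)) v)) +
      X 1 1 u2 (X 1 2 u1 (sc (const (\<theta> 1) * (\<Theta> (- (u1 - u2)) / \<Theta> 0)) v))"
    and RLL_1121: "sc (const (\<theta> (u1 - u2 + 1))) (X 1 2 u1 (X 1 1 u2 v)) =
      X 1 1 u2 (X 1 2 u1 (sc (const (\<theta> (u1 - u2))) v)) +
      X 1 2 u2 (X 1 1 u1 (sc (const (\<theta> 1) * (\<Theta> (u1 - u2) / \<Theta> 0)) v))"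
  using RLL_entire[of 1 1 2 2 v u1 u2] RLL_entire[of 2 1 2 2 v u1 u2] RLL_entire[of 2 1 1 2 v u1 u2]
    RLL_entire[of 2 2 2 1 v u1 u2] RLL_entire[of 1 1 1 2 v u1 u2] RLL_entire[of 1 1 2 1 v u1 u2] v
  unfolding sum_12 Rt_simps
  by (simp_all add: X_0 X_const add.commute)

text \<open>The coefficient \<theta>(u1 - u2 + 1) can be cancelled unless it vanishes, and then the
  one with \<open>u1\<close> and \<open>u2\<close> exchanged can: if both vanished, the sum 2 of
  their arguments would make the fourth power of \<open>q\<close> a power of
  \<open>p\<close>.\<close>

lemma X12_commute:
  assumes v: "v \<in> V"
  shows "X 1 2 u1 (X 1 2 u2 v) = X 1 2 u2 (X 1 2 u1 v)"
proof (cases "\<theta> (u1 - u2 + 1) = 0")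
  case False
  then show ?thesis using RLL_1122[OF v, of u1 u2] by simp
next
  case True
  have "\<theta> (u2 - u1 + 1) \<noteq> 0"
  proof
    assume "\<theta> (u2 - u1 + 1) = 0"
    with True obtain m k :: int where m: "q powr (2 * (u1 - u2 + 1)) = p powi m" "q powr (2 * (u2 - u1 + 1)) = p powi k"
      unfolding theta_eq_0_iff by blast
    have "q powi 4 = q powr (2 * (u1 - u2 + 1) + 2 * (u2 - u1 + 1))"
      using q_powr_int[of 2] by simp
    also have "\<dots> = p powi (m + k)"
      using p_nz power_int_add[of p m k] by (simp only: powr_add m) simp
    finally show False using powi_q_eq_powi_p[of 4 "m + k"] by simp
  qed
  then show ?thesis using RLL_1122[OF v, of u2 u1] by simp
qed

lemma X22_X12:
  assumes v: "v \<in> V" and t: "X 2 2 t v = 0"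
  shows "sc (const (\<theta> (u - t))) (X 2 2 u (X 1 2 t v)) = sc (const (\<theta> (u - t + 1))) (X 1 2 t (X 2 2 u v))"
  using RLL_2122[OF v, of u t] by (simp add: t X_0)

text \<open>In the \<open>2112\<close> relation every term but the first contains one of the three
  vanishing vectors. This carries the vanishing of \<open>C\<^sub>2\<close> at the start of one
  string along the other strings.\<close>

lemma X21_X12_zero:
  assumes v: "v \<in> V" and "X 2 2 t v = 0" "X 2 2 u v = 0" "X 2 1 u v = 0" "\<theta> (u - t) \<noteq> 0"
  shows "X 2 1 u (X 1 2 t v) = 0"
  using RLL_2112[OF v, of u t] assms by (simp add: X_0 X_scale)

subsection \<open>The quantum determinant\<close>

text \<open>This is \<open>A\<^sub>1\<close> with the inverse of \<open>L\<^sub>2\<^sub>2\<close>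
  eliminated by means of \<open>X21_X22\<close>; it is defined for every \<open>u\<close>, also
  where \<open>L\<^sub>2\<^sub>2\<close> is not invertible.\<close>

definition qdet :: "complex \<Rightarrow> 'v \<Rightarrow> 'v" where
  "qdet u v = X 1 1 u (X 2 2 (u - 1) v) - X 1 2 u (X 2 1 (u - 1) (sc (\<Theta> (-1) / \<Theta> 0) v))"

lemma qdet_closed [simp]: "v \<in> V \<Longrightarrow> qdet u v \<in> V"
  by (simp add: qdet_def)

text \<open>The \<open>2221\<close> relation at the parameters \<open>u - 1\<close> and
  \<open>u\<close>: its left-hand side has the coefficient \<theta>(0), and \<theta>(-1) =
  -\<theta>(1) turns the other two terms into an equality.\<close>

lemma X21_X22:
  assumes v: "v \<in> V"
  shows "X 2 1 u (X 2 2 (u - 1) v) = X 2 2 u (X 2 1 (u - 1) (sc (\<Theta> (-1) / \<Theta> 0) v))"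
proof -
  have "0 = sc (const (\<theta> (-1))) (X 2 1 u (X 2 2 (u - 1) v)) +
      sc (const (\<theta> 1)) (X 2 2 u (X 2 1 (u - 1) (sc (\<Theta> (-1) / \<Theta> 0) v)))"
    using RLL_2221[OF v, of "u - 1" u] v
    by (simp add: X_const_mult X_const del: times_divide_eq_right times_divide_eq_left)
  also have "\<dots> = sc (const (\<theta> 1)) (X 2 2 u (X 2 1 (u - 1) (sc (\<Theta> (-1) / \<Theta> 0) v)) - X 2 1 u (X 2 2 (u - 1) v))"
    using v theta_minus[of 1] by (simp add: X_const const_minus scale_right_diff_distrib)
  finally show ?thesis using theta_1_nz by simp
qed

text \<open>The \<open>2112\<close> relation at the same degenerate point. It produces the opposite
  order of spectral parameters, and with it the product
  \<open>L\<^sub>2\<^sub>1(u - 1) L\<^sub>1\<^sub>2(u)\<close> needed for the action of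
  \<open>C\<^sub>2\<close>.\<close>

lemma qdet_X21_X12:
  assumes v: "v \<in> V"
  shows "sc (\<Theta> 1 / \<Theta> 0) (qdet u v) =
    aP (\<Theta> 1 / \<Theta> 0) (X 1 1 (u - 1) (X 2 2 u v)) - X 2 1 (u - 1) (X 1 2 u v)"
proof -
  let ?c = "sc (const (\<theta> 1))" and ?t = "\<Theta> 1 / \<Theta> 0" and ?s = "\<Theta> (-1) / \<Theta> 0"
  have "- ?c (X 2 1 (u - 1) (X 1 2 u v)) + ?c (aP ?t (X 1 1 (u - 1) (X 2 2 u v))) =
      - ?c (X 1 2 u (X 2 1 (u - 1) (sc (?t * ?s) v))) + ?c (X 1 1 u (X 2 2 (u - 1) (sc ?t v)))"
  proof -
    have e: "u - 1 - u = -1" "- (-1::complex) = 1" "\<Theta> 1 * \<Theta> (-1) / (\<Theta> 0)^2 = ?t * ?s"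
      by (simp_all add: power2_eq_square)
    note R = RLL_2112[OF v, of "u - 1" u, unfolded e]
    show ?thesis
      using R v
      by (simp add: aP_mult X_const_mult X_const X_neg const_minus del: times_divide_eq_right
          times_divide_eq_left times_divide_times_eq mult_minus_left)
  qed
  then have "?c (aP ?t (X 1 1 (u - 1) (X 2 2 u v)) - X 2 1 (u - 1) (X 1 2 u v)) =
      ?c (X 1 1 u (X 2 2 (u - 1) (sc ?t v)) - X 1 2 u (X 2 1 (u - 1) (sc (?t * ?s) v)))"
    by (simp add: scale_right_diff_distrib)
  then have "aP ?t (X 1 1 (u - 1) (X 2 2 u v)) - X 2 1 (u - 1) (X 1 2 u v) =
      X 1 1 u (X 2 2 (u - 1) (sc ?t v)) - X 1 2 u (X 2 1 (u - 1) (sc (?t * ?s) v))"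
    by (rule scale_left_imp_eq[rotated]) simp
  \<comment> \<open>The total shift is \<open>epsilon 1 + epsilon 2\<close>, which does not change
    the difference of the two dynamical variables; such products commute with functions of
    \<Pi>*.\<close>
  also have "X 1 1 u (X 2 2 (u - 1) (sc ?t v)) = sc ?t (X 1 1 u (X 2 2 (u - 1) v))"
    using v by (simp add: X_scale shift_divide shift_thPi)
  also have "X 1 2 u (X 2 1 (u - 1) (sc (?t * ?s) v)) = sc ?t (X 1 2 u (X 2 1 (u - 1) (sc ?s v)))"
    using v by (simp add: X_scale shift_divide shift_thPi shift_mult)
  finally show ?thesis by (simp add: qdet_def scale_right_diff_distrib)
qed

lemma analytic_qdet: "v \<in> V \<Longrightarrow> analytic_family sc V (\<lambda>u. qdet u v)"
proof -
  assume v: "v \<in> V"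
  have h: "(\<lambda>u::complex. u - 1) holomorphic_on UNIV" "(\<lambda>u::complex. u) holomorphic_on UNIV"
    by (intro holomorphic_intros)+
  have "analytic_family sc V (\<lambda>u. X 1 1 u (X 2 2 (u - 1) v) +
      sc (const (-1)) (X 1 2 u (X 2 1 (u - 1) (sc (\<Theta> (-1) / \<Theta> 0) v))))"
    by (intro analytic_family.add analytic_family_scale analytic_X analytic_family_constant h
        entire_family_constant) (use v in auto)
  then show ?thesis by (simp add: qdet_def const_minus)
qed

text \<open>Moving \<open>X 1 2 t\<close> through the two products in \<open>qdet\<close> creates
  the same unwanted term twice, with opposite signs. The coefficients that remain agree by the
  three-term identity. Theta factors with arguments \<open>u - t - 1\<close> and
  \<open>u - t + 1\<close> are cancelled on the way, hence the continuation in
  \<open>u\<close>.\<close>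

lemma qdet_X12:
  assumes v: "v \<in> V" and t: "X 2 2 t v = 0"
  shows "qdet u (X 1 2 t v) = X 1 2 t (qdet u v)"
proof (rule analytic_family_eq[of V "\<lambda>u. qdet u (X 1 2 t v)" "\<lambda>u. X 1 2 t (qdet u v)"])
  show "analytic_family sc V (\<lambda>u. qdet u (X 1 2 t v))"
    using v by (intro analytic_qdet) simp
  show "analytic_family sc V (\<lambda>u. X 1 2 t (qdet u v))"
    using v by (intro analytic_X analytic_qdet) (auto intro!: holomorphic_intros)
  have *: "qdet u (X 1 2 t v) = X 1 2 t (qdet u v)"
    if nz: "\<theta> (u - t - 1) \<noteq> 0" "\<theta> (u - t + 1) \<noteq> 0" for u
  proof -
    define w where "w = u - t"
    define y where "y = X 2 2 (u - 1) v"
    define z where "z = X 2 1 (u - 1) (sc (\<Theta> (-1) / \<Theta> 0) v)"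
    define h where "h = const (\<theta> 1) * (\<Theta> (- w) / \<Theta> 0)"
    have [simp]: "y \<in> V" "z \<in> V" using v by (simp_all add: y_def z_def)
    note C = X_const const_mult scale_right_distrib scale_right_diff_distrib
    have e1: "sc (const (\<theta> (w - 1))) (X 2 2 (u - 1) (X 1 2 t v)) = sc (const (\<theta> w)) (X 1 2 t y)"
    proof -
      have e: "u - 1 - t = w - 1" by (simp add: w_def)
      show ?thesis using X22_X12[OF v t, of "u - 1"] by (simp add: y_def e)
    qed
    \<comment> \<open>Chosen so that the shift by \<open>epsilon 2\<close> turns its coefficient
      into the \<open>\<Theta> (-1) / \<Theta> 0\<close> of \<open>qdet\<close> outside
      \<open>X 1 2 t\<close>.\<close>
    let ?v = "sc (\<Theta> 0 / \<Theta> 1) v"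
    have v': "?v \<in> V" "X 2 2 t ?v = 0" using v t by (simp_all add: X_scale)
    have sv: "sc (\<Theta> (-1) / \<Theta> 0) (X 1 2 t v) = X 1 2 t ?v"
      using v by (simp add: X_scale shift_divide shift_thPi)
    have e2: "sc (const (\<theta> (w - 1))) (X 2 1 (u - 1) (X 1 2 t ?v)) =
        sc (const (\<theta> (w - 1))) (X 1 2 t z) + X 1 1 t (sc h y)"
    proof -
      have "sc (const (\<theta> (w - 1))) (X 2 1 (u - 1) (X 1 2 t ?v)) =
        X 1 2 t (X 2 1 (u - 1) (sc (const (\<theta> (w - 1)) * (\<Theta> 1 * \<Theta> (-1) / (\<Theta> 0)^2)) ?v)) +
        X 1 1 t (X 2 2 (u - 1) (sc (const (\<theta> 1) * (\<Theta> (- (w - 1)) / \<Theta> 0)) ?v))"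
      proof -
        have e: "u - 1 - t = w - 1" by (simp add: w_def)
        show ?thesis using RLL_2112[OF v'(1), of "u - 1" t, unfolded e] by (simp add: v'(2) X_0)
      qed
      also have "sc (const (\<theta> (w - 1)) * (\<Theta> 1 * \<Theta> (-1) / (\<Theta> 0)^2)) ?v =
          sc (const (\<theta> (w - 1))) (sc (\<Theta> (-1) / \<Theta> 0) v)"
        by (simp add: power2_eq_square)
      also have "X 2 1 (u - 1) (sc (const (\<theta> (w - 1))) (sc (\<Theta> (-1) / \<Theta> 0) v)) = sc (const (\<theta> (w - 1))) z"
        using v by (simp add: X_const z_def del: scale_scale)
      also have "X 2 2 (u - 1) (sc (const (\<theta> 1) * (\<Theta> (- (w - 1)) / \<Theta> 0)) ?v) = sc h y"
        using v by (simp add: X_scale h_def y_def shift_divide shift_thPi shift_mult)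
      finally show ?thesis by (simp add: X_const)
    qed
    have e3: "sc (const (\<theta> (w + 1))) (X 1 1 u (X 1 2 t y)) =
        sc (const (\<theta> w)) (X 1 2 t (X 1 1 u (sc (\<Theta> 1 * \<Theta> (-1) / (\<Theta> 0)^2) y))) + X 1 1 t (X 1 2 u (sc h y))"
    proof -
      have "X 1 2 t (X 1 1 u (sc (const (\<theta> w) * (\<Theta> 1 * \<Theta> (-1) / (\<Theta> 0)^2)) y)) =
          sc (const (\<theta> w)) (X 1 2 t (X 1 1 u (sc (\<Theta> 1 * \<Theta> (-1) / (\<Theta> 0)^2) y)))"
        by (simp add: X_const_mult X_const del: times_divide_eq_right times_divide_eq_left)
      then show ?thesis using RLL_1112[of y u t] by (simp add: w_def h_def)
    qed
    have e4: "sc (const (\<theta> (w + 1))) (X 1 2 u (X 1 1 t (sc h y))) =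
        sc (const (\<theta> w)) (X 1 1 t (X 1 2 u (sc h y))) +
        X 1 2 t (X 1 1 u (sc (const (\<theta> 1) * (\<Theta> w / \<Theta> 0) * h) y))"
    proof -
      have "X 1 1 t (X 1 2 u (sc (const (\<theta> w)) (sc h y))) = sc (const (\<theta> w)) (X 1 1 t (X 1 2 u (sc h y)))"
        by (simp add: X_const del: scale_scale)
      then show ?thesis using RLL_1121[of "sc h y" u t] unfolding w_def[symmetric] by simp
    qed
    \<comment> \<open>The unwanted term: it occurs in both \<open>p1\<close> and \<open>p2\<close>
      and cancels in their difference.\<close>
    define A where "A = sc (const (\<theta> w)) (X 1 1 t (X 1 2 u (sc h y)))"
    have "sc (const (\<theta> (w - 1) * \<theta> (w + 1))) (X 1 1 u (X 2 2 (u - 1) (X 1 2 t v))) =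
        sc (const (\<theta> (w + 1))) (X 1 1 u (sc (const (\<theta> (w - 1))) (X 2 2 (u - 1) (X 1 2 t v))))"
      using v by (simp add: C mult.commute)
    also have "\<dots> = sc (const (\<theta> w)) (sc (const (\<theta> (w + 1))) (X 1 1 u (X 1 2 t y)))"
      by (simp add: e1 C mult.commute)
    also have "\<dots> = sc (const (\<theta> w) * const (\<theta> w)) (X 1 2 t (X 1 1 u (sc (\<Theta> 1 * \<Theta> (-1) / (\<Theta> 0)^2) y))) + A"
      unfolding e3 by (simp add: C A_def)
    also have "\<dots> = X 1 2 t (X 1 1 u (sc ((const (\<theta> w))^2 * (\<Theta> 1 * \<Theta> (-1) / (\<Theta> 0)^2)) y)) + A"
      by (simp add: power2_eq_square const_mult[symmetric] X_const_mult X_const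
          del: times_divide_eq_right times_divide_eq_left)
    finally have p1: "sc (const (\<theta> (w - 1) * \<theta> (w + 1))) (X 1 1 u (X 2 2 (u - 1) (X 1 2 t v))) =
        X 1 2 t (X 1 1 u (sc ((const (\<theta> w))^2 * (\<Theta> 1 * \<Theta> (-1) / (\<Theta> 0)^2)) y)) + A" .
    have "sc (const (\<theta> (w - 1) * \<theta> (w + 1))) (X 1 2 u (X 2 1 (u - 1) (X 1 2 t ?v))) =
        sc (const (\<theta> (w + 1))) (X 1 2 u (sc (const (\<theta> (w - 1))) (X 2 1 (u - 1) (X 1 2 t ?v))))"
      using v'(1) by (simp add: C mult.commute)
    also have "\<dots> = sc (const (\<theta> (w - 1) * \<theta> (w + 1))) (X 1 2 u (X 1 2 t z)) + sc (const (\<theta> (w + 1))) (X 1 2 u (X 1 1 t (sc h y)))"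
      unfolding e2 by (simp add: X_add C mult.commute)
    also have "X 1 2 u (X 1 2 t z) = X 1 2 t (X 1 2 u z)" by (simp add: X12_commute)
    finally have p2: "sc (const (\<theta> (w - 1) * \<theta> (w + 1))) (X 1 2 u (X 2 1 (u - 1) (X 1 2 t ?v))) =
        sc (const (\<theta> (w - 1) * \<theta> (w + 1))) (X 1 2 t (X 1 2 u z)) + (A +
        X 1 2 t (X 1 1 u (sc (const (\<theta> 1) * (\<Theta> w / \<Theta> 0) * h) y)))"
      unfolding e4 A_def[symmetric] .
    \<comment> \<open>The three-term identity at \<open>c = 0\<close>, divided by the square of
      \<open>\<Theta> 0\<close>.\<close>
    have th3: "(const (\<theta> w))^2 * (\<Theta> 1 * \<Theta> (-1) / (\<Theta> 0)^2) =
        const (\<theta> (w - 1) * \<theta> (w + 1)) + const (\<theta> 1) * (\<Theta> w / \<Theta> 0) * h"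
      using thPi_three_term[of 0 w]
      by (simp add: h_def power2_eq_square field_simps)
    have "sc (const (\<theta> (w - 1) * \<theta> (w + 1))) (qdet u (X 1 2 t v)) =
      sc (const (\<theta> (w - 1) * \<theta> (w + 1))) (X 1 1 u (X 2 2 (u - 1) (X 1 2 t v))) -
      sc (const (\<theta> (w - 1) * \<theta> (w + 1))) (X 1 2 u (X 2 1 (u - 1) (X 1 2 t ?v)))"
      unfolding qdet_def sv by (simp only: scale_right_diff_distrib)
    also have "\<dots> = X 1 2 t (X 1 1 u (sc (const (\<theta> (w - 1) * \<theta> (w + 1))) y)) -
        sc (const (\<theta> (w - 1) * \<theta> (w + 1))) (X 1 2 t (X 1 2 u z))"
      unfolding p1 p2 th3 by (simp add: scale_left_distrib X_add)
    also have "\<dots> = sc (const (\<theta> (w - 1) * \<theta> (w + 1))) (X 1 2 t (X 1 1 u y - X 1 2 u z))"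
      by (simp add: X_const X_diff scale_right_diff_distrib)
    also have "X 1 1 u y - X 1 2 u z = qdet u v"
      by (simp add: qdet_def y_def z_def)
    finally show ?thesis
      using nz by (simp add: w_def)
  qed
  have e: "u + (- t - 1) = u - t - 1" "u + (- t + 1) = u - t + 1" for u by simp_all
  show "\<forall>\<^sub>F u in at u. qdet u (X 1 2 t v) = X 1 2 t (qdet u v)"
    using eventually_theta_nz[of "- t - 1" u] eventually_theta_nz[of "- t + 1" u]
    unfolding e by eventually_elim (rule *)
qed

end

section \<open>Level-0 representations\<close>

locale level0_representation = generic_parameters q p + merof_space sc
  for q p :: complex and sc :: "merof \<Rightarrow> 'v::ab_group_add \<Rightarrow> 'v" +
  fixes R :: "'v drep"
  assumes level0: "level0_rep q p sc R"
begin

abbreviation V :: "'v set" where "V \<equiv> rep_space R"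

lemma subspace_V: "subspace V"
  and aP_closed: "v \<in> V \<Longrightarrow> actPh R g v \<in> V"
  and aP_add: "v \<in> V \<Longrightarrow> w \<in> V \<Longrightarrow> actPh R g (v + w) = actPh R g v + actPh R g w"
  and aP_scale: "v \<in> V \<Longrightarrow> actPh R g (sc f v) = sc f (actPh R g v)"
  and V_weights: "V \<subseteq> span (\<Union>m. weight_space sc R m)"
  using level0 unfolding level0_rep_def by simp_all

lemma mode_closed: "i \<in> {1,2} \<Longrightarrow> j \<in> {1,2} \<Longrightarrow> v \<in> V \<Longrightarrow> mode R i j n v \<in> V"
  and mode_add: "i \<in> {1,2} \<Longrightarrow> j \<in> {1,2} \<Longrightarrow> v \<in> V \<Longrightarrow> w \<in> V \<Longrightarrow>
    mode R i j n (v + w) = mode R i j n v + mode R i j n w"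
  and mode_aP: "i \<in> {1,2} \<Longrightarrow> j \<in> {1,2} \<Longrightarrow> v \<in> V \<Longrightarrow>
    actPh R g (mode R i j n v) = mode R i j n (actPh R (shift (- epsilon i) g) v)"
  and mode_scale': "i \<in> {1,2} \<Longrightarrow> j \<in> {1,2} \<Longrightarrow> v \<in> V \<Longrightarrow>
    sc g (mode R i j n v) = mode R i j n (sc (shift (- epsilon j) g) v)"
  and cur_laurent: "i \<in> {1,2} \<Longrightarrow> j \<in> {1,2} \<Longrightarrow> v \<in> V \<Longrightarrow>
    laurent_sum_vec sc V (\<lambda>n. sc (const (p ^ nat n)) (mode R i j n v)) (\<lambda>z. cur R i j z v)"
  and RLL_cur: "RLL_relation q p sc R"
  using level0 unfolding level0_rep_def by blast+

lemma mode_scale: "i \<in> {1,2} \<Longrightarrow> j \<in> {1,2} \<Longrightarrow> v \<in> V \<Longrightarrow>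
    mode R i j n (sc g v) = sc (shift (epsilon j) g) (mode R i j n v)"
  using mode_scale'[of i j v "shift (epsilon j) g" n] by simp

text \<open>\<open>level0_rep\<close> states additivity, semilinearity and commutation with
  \<open>g(P + h)\<close> only for the modes. They pass to the currents by testing with functionals
  and comparing Laurent coefficients.\<close>

lemma cur_functional:
  fixes m :: "'v \<Rightarrow> merof"
  assumes "\<And>x y. x \<in> V \<Longrightarrow> y \<in> V \<Longrightarrow> m (x + y) = m x + m y" "\<And>g x. x \<in> V \<Longrightarrow> m (sc g x) = g * m x"
    "i \<in> {1,2}" "j \<in> {1,2}" "v \<in> V"
  shows "laurent_sum (\<lambda>n. const (p ^ nat n) * m (mode R i j n v)) (\<lambda>z. m (cur R i j z v))"
  using laurent_sum_vec_functional[OF subspace_V assms(1,2) cur_laurent[OF assms(3-5)]]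
  by (simp add: assms mode_closed del: insert_iff)

lemma cur_eqI:
  assumes "laurent_sum c \<phi>" "\<phi> z = x" "laurent_sum d \<psi>" "\<psi> z = y" "c = d" "z \<noteq> 0"
  shows "x = y"
  using laurent_sum_unique[of c \<phi> \<psi> z] assms by simp

lemma cur_closed: "i \<in> {1,2} \<Longrightarrow> j \<in> {1,2} \<Longrightarrow> v \<in> V \<Longrightarrow> z \<noteq> 0 \<Longrightarrow> cur R i j z v \<in> V"
  using analytic_family_mem[OF subspace_V laurent_sum_vec_analytic[OF subspace_V cur_laurent, of i j v "\<lambda>_. z"]]
  by simp

lemma cur_add:
  assumes ij: "i \<in> {1,2}" "j \<in> {1,2}" and v: "v \<in> V" "w \<in> V" and z: "z \<noteq> 0"
  shows "cur R i j z (v + w) = cur R i j z v + cur R i j z w"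
proof (rule functional_eqI)
  fix m :: "'v \<Rightarrow> merof"
  assume m: "\<And>x y. m (x + y) = m x + m y" "\<And>g x. m (sc g x) = g * m x"
  have vw: "v + w \<in> V" using v subspace_V by (rule subspace_add[rotated])
  note L = cur_functional[of m, OF m ij]
  show "m (cur R i j z (v + w)) = m (cur R i j z v + cur R i j z w)"
    by (rule cur_eqI[OF L[OF vw] refl laurent_sum_add[OF L[OF v(1)] L[OF v(2)]] _ _ z])
      (simp_all add: m mode_add[OF ij v] distrib_left)
qed

lemma cur_scale:
  assumes ij: "i \<in> {1,2}" "j \<in> {1,2}" and v: "v \<in> V" and z: "z \<noteq> 0"
  shows "cur R i j z (sc g v) = sc (shift (epsilon j) g) (cur R i j z v)"
proof (rule functional_eqI)
  fix m :: "'v \<Rightarrow> merof"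
  assume m: "\<And>x y. m (x + y) = m x + m y" "\<And>g x. m (sc g x) = g * m x"
  have gv: "sc g v \<in> V" using v subspace_V by (rule subspace_scale[rotated])
  note L = cur_functional[of m, OF m ij]
  show "m (cur R i j z (sc g v)) = m (sc (shift (epsilon j) g) (cur R i j z v))"
    by (rule cur_eqI[OF L[OF gv] refl laurent_sum_cmult[OF L[OF v], of "shift (epsilon j) g"] _ _ z])
      (simp_all add: m mode_scale[OF ij v] mult.left_commute)
qed

lemma cur_aP:
  assumes ij: "i \<in> {1,2}" "j \<in> {1,2}" and v: "v \<in> V" and z: "z \<noteq> 0"
  shows "actPh R g (cur R i j z v) = cur R i j z (actPh R (shift (- epsilon i) g) v)"
proof (rule functional_eqI)
  fix m :: "'v \<Rightarrow> merof"
  assume m: "\<And>x y. m (x + y) = m x + m y" "\<And>g x. m (sc g x) = g * m x"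
  have L: "laurent_sum (\<lambda>n. const (p ^ nat n) * m (actPh R g (mode R i j n v))) (\<lambda>z. m (actPh R g (cur R i j z v)))"
    by (rule cur_functional[of "\<lambda>x. m (actPh R g x)"]) (simp_all add: m aP_add aP_scale assms del: insert_iff)
  show "m (actPh R g (cur R i j z v)) = m (cur R i j z (actPh R (shift (- epsilon i) g) v))"
    by (rule cur_eqI[OF L refl cur_functional[of m, OF m ij aP_closed[OF v]] refl _ z])
      (simp add: mode_aP[OF ij v])
qed

text \<open>The scalars \<open>f u\<close> do not depend on \<open>P\<close>, so shifts leave them
  alone, and both sides of the exchange relation acquire the same factor
  \<open>f u1 * f u2\<close>.\<close>

lemma rll_operators_Ltw:
  assumes f: "f holomorphic_on UNIV"
  shows "rll_operators q p sc V (actPh R) (Ltw q sc f R)"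
proof
  show "subspace V" by (rule subspace_V)
  show "V \<subseteq> span (\<Union>m. {v \<in> V. \<forall>g. actPh R g v = sc (shift m g) v})"
    using V_weights by (simp add: weight_space_def)
  fix g h v w u and i j :: nat
  show "v \<in> V \<Longrightarrow> actPh R g v \<in> V" by (rule aP_closed)
  show "v \<in> V \<Longrightarrow> w \<in> V \<Longrightarrow> actPh R g (v + w) = actPh R g v + actPh R g w" by (rule aP_add)
  show "v \<in> V \<Longrightarrow> actPh R g (sc h v) = sc h (actPh R g v)" by (rule aP_scale)
  have q2: "q powr (2 * u) \<noteq> 0" for u using q_nz by simp
  {
    assume ij: "i \<in> {1,2}" "j \<in> {1,2}" and v: "v \<in> V"
    show "Ltw q sc f R i j u v \<in> V"
      unfolding Ltw_def by (intro subspace_scale subspace_V cur_closed ij v q2)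
    show "w \<in> V \<Longrightarrow> Ltw q sc f R i j u (v + w) = Ltw q sc f R i j u v + Ltw q sc f R i j u w"
      unfolding Ltw_def by (simp only: cur_add[OF ij v _ q2] scale_right_distrib)
    show "Ltw q sc f R i j u (sc g v) = sc (shift (epsilon j) g) (Ltw q sc f R i j u v)"
      unfolding Ltw_def cur_scale[OF ij v q2] scale_scale by (simp only: mult.commute)
    show "actPh R g (Ltw q sc f R i j u v) = Ltw q sc f R i j u (actPh R (shift (- epsilon i) g) v)"
      unfolding Ltw_def by (simp only: aP_scale[OF cur_closed[OF ij v q2]] cur_aP[OF ij v q2])
    show "analytic_family sc V (\<lambda>u. Ltw q sc f R i j u v)"
      unfolding Ltw_def
      by (intro analytic_family_scale entire_family_const f
          laurent_sum_vec_analytic[OF subspace_V cur_laurent[OF ij v]])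
        (use q_nz in \<open>auto intro!: holomorphic_intros\<close>)
  }
  fix u1 u2 and k l :: nat
  assume nz: "\<theta> (u1 - u2 + 1) \<noteq> 0" and ijkl: "i \<in> {1,2}" "j \<in> {1,2}" "k \<in> {1,2}" "l \<in> {1,2}" and v: "v \<in> V"
  let ?c = "const (f u1) * const (f u2)" and ?R = "Rbar q p (u1 - u2)"
  let ?z1 = "q powr (2 * u1)" and ?z2 = "q powr (2 * u2)"
  have L: "Ltw q sc f R a b u (Ltw q sc f R c d u' x) =
      sc (const (f u) * const (f u')) (cur R a b (q powr (2 * u)) (cur R c d (q powr (2 * u')) x))"
    if "a \<in> {1,2}" "b \<in> {1,2}" "c \<in> {1,2}" "d \<in> {1,2}" "x \<in> V" for a b c d u u' x
    unfolding Ltw_def using cur_scale[OF that(1,2) cur_closed[OF that(3-5) q2] q2] by simp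
  have "(\<Sum>a\<in>{1,2}. \<Sum>b\<in>{1,2}. actPh R (?R i j a b) (Ltw q sc f R a k u1 (Ltw q sc f R b l u2 v))) =
      sc ?c (\<Sum>a\<in>{1,2}. \<Sum>b\<in>{1,2}. actPh R (?R i j a b) (cur R a k ?z1 (cur R b l ?z2 v)))"
    unfolding scale_sum_right
    by (intro sum.cong refl) (simp add: L ijkl v aP_scale cur_closed q_nz del: insert_iff)
  also have "(\<Sum>a\<in>{1,2}. \<Sum>b\<in>{1,2}. actPh R (?R i j a b) (cur R a k ?z1 (cur R b l ?z2 v))) =
      (\<Sum>a\<in>{1,2}. \<Sum>b\<in>{1,2}. cur R j b ?z2 (cur R i a ?z1 (sc (?R a b k l) v)))"
    using RLL_cur nz ijkl v unfolding RLL_relation_def Let_def by blast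
  also have "sc ?c \<dots> = (\<Sum>a\<in>{1,2}. \<Sum>b\<in>{1,2}. Ltw q sc f R j b u2 (Ltw q sc f R i a u1 (sc (?R a b k l) v)))"
    unfolding scale_sum_right
    by (intro sum.cong refl) (simp add: L ijkl subspace_scale[OF subspace_V v] mult.commute q_nz del: insert_iff)
  finally show "(\<Sum>a\<in>{1,2}. \<Sum>b\<in>{1,2}. actPh R (?R i j a b) (Ltw q sc f R a k u1 (Ltw q sc f R b l u2 v))) =
      (\<Sum>a\<in>{1,2}. \<Sum>b\<in>{1,2}. Ltw q sc f R j b u2 (Ltw q sc f R i a u1 (sc (?R a b k l) v)))" .
qed

lemma Ltw_1 [simp]: "Ltw q sc (\<lambda>_. 1) R i j u = cur R i j (q powr (2 * u))"
  by (simp add: Ltw_def fun_eq_iff)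

sublocale rll: rll_operators q p sc V "actPh R" "\<lambda>i j u. cur R i j (q powr (2 * u))"
  using rll_operators_Ltw[of "\<lambda>_. 1"] by (simp add: Ltw_1[abs_def])

end

section \<open>Dynamical tensor products\<close>

text \<open>The function \<open>g\<close> collects the scalars by which the one-dimensional tensor factors act.\<close>

definition highest_weight_data ::
  "complex \<Rightarrow> (merof \<Rightarrow> 'v::ab_group_add \<Rightarrow> 'v) \<Rightarrow> 'v drep \<Rightarrow> 'v \<Rightarrow> (complex \<Rightarrow> complex) \<Rightarrow>
     (complex \<Rightarrow> complex) \<Rightarrow> nat \<Rightarrow> (complex \<Rightarrow> complex) \<Rightarrow> bool" where
  "highest_weight_data q sc R \<zeta> \<mu> \<nu> N g \<longleftrightarrow>
     \<zeta> \<in> rep_space R \<and> \<zeta> \<noteq> 0 \<and>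
     (\<forall>u. cur R 2 1 (q powr (2 * u)) \<zeta> = 0 \<and>
          cur R 1 1 (q powr (2 * u)) \<zeta> = sc (const (\<mu> u)) \<zeta> \<and>
          cur R 2 2 (q powr (2 * u)) \<zeta> = sc (const (\<nu> u)) \<zeta>) \<and>
     (\<exists>S. finite S \<and> S \<subseteq> rep_space R \<and> rep_space R \<subseteq> module.span sc S \<and> card S \<le> N) \<and>
     (\<forall>i\<in>{1,2}. \<forall>j\<in>{1,2}. \<forall>x\<in>rep_space R. \<exists>Y. analytic_family sc (rep_space R) Y \<and>
        (\<forall>u. cur R i j (q powr (2 * u)) x = sc (const (g u)) (Y u)))"

text \<open>Divisibility has content only for \<open>l = 0\<close>. On a one-dimensional module the
  off-diagonal currents vanish and both diagonal ones act by the same theta function up to the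
  twist, which can therefore be divided out.\<close>

lemma (in level0_representation) highest_weight_data_eval:
  assumes ev: "eval_rep q p sc l c R v"
  shows "\<exists>f. twist_fun f \<and> highest_weight_data q sc R v
    (\<lambda>u. \<theta> ((of_nat l + 2) / 2 + u - c) / f u) (\<lambda>u. \<theta> ((- of_nat l + 2) / 2 + u - c) / f u) (l + 1)
    (\<lambda>u. if l = 0 then \<theta> (1 + u - c) else 1)"
proof -
  obtain f where f: "twist_fun f" and hw: "highest_weight_vector q sc f R
      (\<lambda>u. \<theta> ((of_nat l + 2) / 2 + u - c)) (\<lambda>u. \<theta> ((- of_nat l + 2) / 2 + u - c)) v"
    and dim: "dim V = l + 1"
    using ev unfolding eval_rep_def by blast
  have fnz: "f u \<noteq> 0" and fh: "f holomorphic_on UNIV" for u using f by (auto simp: twist_fun_def)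
  have v: "v \<in> V" "v \<noteq> 0" using hw by (auto simp: highest_weight_vector_def)
  have untwist: "cur R i j (q powr (2 * u)) v = sc (const (x / f u)) v"
    if "Ltw q sc f R i j u v = sc (const x) v" for i j u x
  proof -
    have "sc (const (f u)) (cur R i j (q powr (2 * u)) v) = sc (const (f u)) (sc (const (x / f u)) v)"
      using that fnz[of u] by (simp add: Ltw_def const_mult[symmetric])
    then show ?thesis by (rule scale_left_imp_eq[rotated]) (simp add: fnz)
  qed
  have cur_v: "cur R 2 1 (q powr (2 * u)) v = 0"
    "cur R 1 1 (q powr (2 * u)) v = sc (const (\<theta> ((of_nat l + 2) / 2 + u - c) / f u)) v"
    "cur R 2 2 (q powr (2 * u)) v = sc (const (\<theta> ((- of_nat l + 2) / 2 + u - c) / f u)) v" for u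
    using hw untwist[of 2 1 u 0] by (auto simp: highest_weight_vector_def intro: untwist)
  obtain B where B: "B \<subseteq> V" "independent B" "V \<subseteq> span B" "card B = l + 1"
    using basis_exists[of V] dim by metis
  have finB: "finite B" using B(4) by (metis add_is_0 card.infinite one_neq_zero)
  have "\<exists>Y. analytic_family sc V Y \<and>
      (\<forall>u. cur R i j (q powr (2 * u)) x = sc (const (if l = 0 then \<theta> (1 + u - c) else 1)) (Y u))"
    if ij: "i \<in> {1,2}" "j \<in> {1,2}" and x: "x \<in> V" for i j x
  proof (cases "l = 0")
    case False
    then show ?thesis
      using rll.X_analytic[OF ij x] by (intro exI[of _ "\<lambda>u. cur R i j (q powr (2 * u)) x"]) simp
  next
    case True
    then obtain b where b: "B = {b}" using B(4) card_1_singletonE[of B] by auto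
    have mult: "\<exists>g. y = sc g v" if y: "y \<in> V" for y
    proof -
      obtain k where k: "v = sc k b" using v(1) B(3) by (auto simp: b span_singleton)
      obtain k' where k': "y = sc k' b" using y B(3) by (auto simp: b span_singleton)
      have "k \<noteq> 0" using k v(2) by auto
      then have "y = sc (k' / k) v" by (simp add: k k')
      then show ?thesis by blast
    qed
    \<comment> \<open>Weight vectors span, so a nonzero one exists; being a multiple of
      \<open>v\<close>, it passes its weight on to \<open>v\<close>.\<close>
    have weight: "\<exists>m. \<forall>g. actPh R g v = sc (shift m g) v"
    proof (rule ccontr)
      assume no: "\<nexists>m. \<forall>g. actPh R g v = sc (shift m g) v"
      have "y = 0" if y: "y \<in> weight_space sc R m" for y m
      proof (rule ccontr)
        assume "y \<noteq> 0"
        obtain k where k: "y = sc k v" using mult y by (auto simp: weight_space_def)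
        then have "k \<noteq> 0" using \<open>y \<noteq> 0\<close> by auto
        have "actPh R g v = sc (shift m g) v" for g
        proof -
          have "sc k (actPh R g v) = sc k (sc (shift m g) v)"
            using y v(1) by (simp add: weight_space_def k aP_scale mult.commute)
          then show ?thesis by (rule scale_left_imp_eq[OF \<open>k \<noteq> 0\<close>])
        qed
        with no show False by blast
      qed
      then have "span (\<Union>m. weight_space sc R m) \<subseteq> {0}"
        by (intro span_minimal) auto
      then show False using V_weights v by auto
    qed
    then obtain m where m: "\<And>g. actPh R g v = sc (shift m g) v" by blast
    have cur12: "cur R 1 2 (q powr (2 * u)) v = 0" for u
    proof -
      let ?L = "cur R 1 2 (q powr (2 * u))"
      obtain h where h: "?L v = sc h v" using mult[of "?L v"] v(1) by auto
      \<comment> \<open>The first dynamical variable detects the change of weight: moving it through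
        \<open>L\<^sub>1\<^sub>2\<close> subtracts 1, which is impossible for a nonzero
        \<open>h\<close> when there is only one weight.\<close>
      define x1 :: merof where "x1 = mero (\<lambda>P. fst P)"
      have ent: "entire_on_C2 (\<lambda>P. fst P + k)" for k
        unfolding entire_on_C2_def
      proof
        fix x :: "complex \<times> complex"
        have "((\<lambda>P. fst P + k) has_derivative (\<lambda>h. 1 * fst h + 0 * snd h)) (at x)"
          by (auto intro!: derivative_eq_intros)
        then show "\<exists>a b. ((\<lambda>P. fst P + k) has_derivative (\<lambda>h. a * fst h + b * snd h)) (at x)" by blast
      qed
      have sx: "shift k x1 = x1 + const (fst k)" for k
        using ent[of 0] by (simp add: x1_def shift_mero mero_add entire_on_C2_const)
      have "actPh R x1 (?L v) = ?L (actPh R (shift (- epsilon 1) x1) v)"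
        by (rule rll.X_aP) (use v in auto)
      also have "\<dots> = sc (shift (epsilon 2) (shift m (shift (- epsilon 1) x1))) (?L v)"
        unfolding m by (rule rll.X_scale) (use v in auto)
      finally have "actPh R x1 (sc h v) = sc (shift (epsilon 2) (shift m (shift (- epsilon 1) x1))) (sc h v)"
        by (simp only: h)
      then have "sc (h * (x1 + const (fst m))) v = sc (h * (x1 + const (fst m) - 1)) v"
        using v(1) by (simp add: aP_scale m sx shift_add shift_diff const_add const_diff const_minus mult.commute)
      then have "h * (x1 + const (fst m)) = h * (x1 + const (fst m) - 1)"
        using v(2) by (rule scale_right_imp_eq[rotated])
      then have "h = 0" by (simp add: algebra_simps)
      then show ?thesis using h by simp
    qed
    obtain g where g: "x = sc g v" using mult[OF x] by blast
    let ?Y = "\<lambda>u. sc ((if i = j then const (1 / f u) else 0) * shift (epsilon j) g) v"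
    have "entire_family (\<lambda>u. if i = j then const (1 / f u) else 0)"
    proof -
      have "(\<lambda>u. 1 / f u) holomorphic_on UNIV"
        by (intro holomorphic_intros fh) (simp add: fnz)
      then show ?thesis
        by (cases "i = j") (simp_all add: entire_family_const entire_family_constant)
    qed
    then have "analytic_family sc V ?Y"
      by (intro analytic_family.single entire_family_mult entire_family_constant v)
    moreover have "cur R i j (q powr (2 * u)) x = sc (const (\<theta> (1 + u - c))) (?Y u)" for u
    proof -
      have "cur R i j (q powr (2 * u)) x = sc (shift (epsilon j) g) (cur R i j (q powr (2 * u)) v)"
        unfolding g by (rule rll.X_scale[OF ij v(1)])
      also have "cur R i j (q powr (2 * u)) v = sc (if i = j then const (\<theta> (1 + u - c) / f u) else 0) v"
        using ij cur_v[of u] cur12[of u] True by auto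
      finally have *: "cur R i j (q powr (2 * u)) x =
          sc (shift (epsilon j) g) (sc (if i = j then const (\<theta> (1 + u - c) / f u) else 0) v)" .
      show ?thesis
      proof -
        have "const (\<theta> (1 + u - c) / f u) = const (\<theta> (1 + u - c)) * const (1 / f u)"
          by (simp add: const_mult[symmetric])
        then show ?thesis using * by (simp add: mult_ac)
      qed
    qed
    ultimately show ?thesis using True by auto
  qed
  then have "highest_weight_data q sc R v
    (\<lambda>u. \<theta> ((of_nat l + 2) / 2 + u - c) / f u) (\<lambda>u. \<theta> ((- of_nat l + 2) / 2 + u - c) / f u) (l + 1)
    (\<lambda>u. if l = 0 then \<theta> (1 + u - c) else 1)"
    unfolding highest_weight_data_def using v cur_v B finB by auto
  with f show ?thesis by blast
qed

section \<open>Formal sums of pairs and the tensor product as their quotient\<close>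

context merof_space
begin

lemma dtensor_eval_superset:
  assumes "finite S" "Poly_Mapping.keys x \<subseteq> S"
  shows "dtensor_eval sc t x = (\<Sum>k\<in>S. sc (of_int (Poly_Mapping.lookup x k)) (t (fst k) (snd k)))"
  unfolding dtensor_eval_def
  by (rule sum.mono_neutral_left) (use assms in \<open>auto simp: in_keys_iff\<close>)

lemma dtensor_eval_add: "dtensor_eval sc t (x + y) = dtensor_eval sc t x + dtensor_eval sc t y"
proof -
  let ?S = "Poly_Mapping.keys x \<union> Poly_Mapping.keys y"
  have k: "Poly_Mapping.keys (x + y) \<subseteq> ?S" by (rule keys_add)
  show ?thesis
    by (subst (1 2 3) dtensor_eval_superset[of ?S])
      (use k in \<open>auto simp: lookup_add scale_left_distrib sum.distrib\<close>)
qed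

lemma dtensor_eval_diff: "dtensor_eval sc t (x - y) = dtensor_eval sc t x - dtensor_eval sc t y"
  using dtensor_eval_add[of t "x - y" y] by simp

lemma dtensor_eval_single: "dtensor_eval sc t (Poly_Mapping.single (v, w) 1) = t v w"
  by (simp add: dtensor_eval_def)

end

locale dynamical_tensor = generic_parameters q p + merof_space sc
  for q p :: complex and sc :: "merof \<Rightarrow> 'v::ab_group_add \<Rightarrow> 'v" +
  fixes V W :: "'v drep" and t :: "'v \<Rightarrow> 'v \<Rightarrow> 'v" and T :: "'v drep"
  assumes level0_V: "level0_rep q p sc V" and level0_W: "level0_rep q p sc W"
    and dtensor: "dtensor q p sc V W t T"
begin

sublocale V: level0_representation q p sc V by unfold_locales (rule level0_V)
sublocale W: level0_representation q p sc W by unfold_locales (rule level0_W)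
sublocale T: level0_representation q p sc T
  by unfold_locales (use dtensor in \<open>simp add: dtensor_def\<close>)

lemma eval_image: "dtensor_eval sc t ` {x. Poly_Mapping.keys x \<subseteq> V.V \<times> W.V} = T.V"
  and eval_eq_0_iff: "Poly_Mapping.keys x \<subseteq> V.V \<times> W.V \<Longrightarrow>
    dtensor_eval sc t x = 0 \<longleftrightarrow> x \<in> dtensor_rels sc V W"
  using dtensor by (simp_all add: dtensor_def)

lemma t_scale: "v \<in> V.V \<Longrightarrow> w \<in> W.V \<Longrightarrow> sc g (t v w) = t v (sc g w)"
  and cur_t: "v \<in> V.V \<Longrightarrow> w \<in> W.V \<Longrightarrow> i \<in> {1,2} \<Longrightarrow> j \<in> {1,2} \<Longrightarrow> z \<noteq> 0 \<Longrightarrow>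
    cur T i j z (t v w) = (\<Sum>k\<in>{1,2}. t (cur V i k z v) (cur W k j z w))"
  using dtensor unfolding dtensor_def by (elim conjE; blast)+

lemma t_mem [simp]: "v \<in> V.V \<Longrightarrow> w \<in> W.V \<Longrightarrow> t v w \<in> T.V"
  unfolding eval_image[symmetric]
  by (rule image_eqI[of _ _ "Poly_Mapping.single (v, w) 1"]) (auto simp: dtensor_eval_single)

lemma keys_diff_diff: "Poly_Mapping.keys (a - b - c) \<subseteq> Poly_Mapping.keys a \<union> Poly_Mapping.keys b \<union> Poly_Mapping.keys c"
  using keys_diff[of "a - b" c] keys_diff[of a b] by blast

lemma t_add_left:
  assumes "v \<in> V.V" "v' \<in> V.V" "w \<in> W.V"
  shows "t (v + v') w = t v w + t v' w"
proof -
  let ?x = "Poly_Mapping.single (v + v', w) (1::int) - Poly_Mapping.single (v, w) 1 - Poly_Mapping.single (v', w) 1"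
  have "Poly_Mapping.keys ?x \<subseteq> V.V \<times> W.V"
    by (rule order_trans[OF keys_diff_diff]) (use assms in auto)
  then have "dtensor_eval sc t ?x = 0"
    using eval_eq_0_iff dtensor_rels.add_left[OF assms] by blast
  then show ?thesis by (simp add: dtensor_eval_diff dtensor_eval_add dtensor_eval_single algebra_simps)
qed

lemma t_add_right:
  assumes "v \<in> V.V" "w \<in> W.V" "w' \<in> W.V"
  shows "t v (w + w') = t v w + t v w'"
proof -
  let ?x = "Poly_Mapping.single (v, w + w') (1::int) - Poly_Mapping.single (v, w) 1 - Poly_Mapping.single (v, w') 1"
  have "Poly_Mapping.keys ?x \<subseteq> V.V \<times> W.V"
    by (rule order_trans[OF keys_diff_diff]) (use assms in auto)
  then have "dtensor_eval sc t ?x = 0"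
    using eval_eq_0_iff dtensor_rels.add_right[OF assms] by blast
  then show ?thesis by (simp add: dtensor_eval_diff dtensor_eval_add dtensor_eval_single algebra_simps)
qed

lemma t_balanced:
  assumes "v \<in> V.V" "w \<in> W.V"
  shows "t (sc g v) w = t v (actPh W g w)"
proof -
  let ?x = "Poly_Mapping.single (sc g v, w) (1::int) - Poly_Mapping.single (v, actPh W g w) 1"
  have "Poly_Mapping.keys ?x \<subseteq> V.V \<times> W.V"
    by (rule order_trans[OF keys_diff]) (use assms in auto)
  then have "dtensor_eval sc t ?x = 0"
    using eval_eq_0_iff dtensor_rels.balanced[OF assms] by blast
  then show ?thesis by (simp add: dtensor_eval_diff dtensor_eval_add dtensor_eval_single algebra_simps)
qed

lemma t_const: "v \<in> V.V \<Longrightarrow> w \<in> W.V \<Longrightarrow> t (sc (const c) v) w = sc (const c) (t v w)"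
  by (simp add: t_balanced t_scale)

lemma t_0: "v \<in> V.V \<Longrightarrow> t v 0 = 0" "w \<in> W.V \<Longrightarrow> t 0 w = 0"
  using t_add_right[of v 0 0] t_add_left[of 0 0 w] by simp_all

lemma tensor_induct [consumes 1, case_names zero tensor add]:
  assumes "x \<in> T.V" "P 0" "\<And>v w. v \<in> V.V \<Longrightarrow> w \<in> W.V \<Longrightarrow> P (t v w)"
    "\<And>x y. x \<in> T.V \<Longrightarrow> y \<in> T.V \<Longrightarrow> P x \<Longrightarrow> P y \<Longrightarrow> P (x + y)"
  shows "P x"
proof -
  have "x \<in> dtensor_eval sc t ` {y. Poly_Mapping.keys y \<subseteq> V.V \<times> W.V}"
    using assms(1) eval_image by simp
  then obtain y where y: "Poly_Mapping.keys y \<subseteq> V.V \<times> W.V" "x = dtensor_eval sc t y"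
    by blast
  have "(\<Sum>k\<in>K. sc (of_int (Poly_Mapping.lookup y k)) (t (fst k) (snd k))) \<in> T.V \<and>
      P (\<Sum>k\<in>K. sc (of_int (Poly_Mapping.lookup y k)) (t (fst k) (snd k)))"
    if "K \<subseteq> V.V \<times> W.V" for K
    using that
  proof (induction K rule: infinite_finite_induct)
    case (insert k K)
    have k: "fst k \<in> V.V" "snd k \<in> W.V" and K: "K \<subseteq> V.V \<times> W.V"
      using insert.prems by (simp_all add: mem_Times_iff)
    let ?x = "sc (of_int (Poly_Mapping.lookup y k)) (t (fst k) (snd k))"
    have "?x \<in> T.V \<and> P ?x"
      using k assms(3) by (simp add: t_scale)
    then show ?case
      using insert.IH[OF K] assms(4) insert.hyps by simp
  qed (use assms(2) in auto)
  from this[OF y(1)] show ?thesis by (simp add: y(2) dtensor_eval_def)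
qed

text \<open>For a linear functional \<open>m\<close> on \<open>V\<close>, the map \<open>(v, w) \<mapsto> m(v)(P + h) w\<close> respects the relations.\<close>

lemma t_nonzero:
  assumes v: "v \<in> V.V" "v \<noteq> 0" and w: "w \<in> W.V" "w \<noteq> 0"
  shows "t v w \<noteq> 0"
proof
  assume 0: "t v w = 0"
  have "Poly_Mapping.keys (Poly_Mapping.single (v, w) (1::int)) \<subseteq> V.V \<times> W.V"
    using v w by simp
  from eval_eq_0_iff[OF this] have rel: "Poly_Mapping.single (v, w) 1 \<in> dtensor_rels sc V W"
    by (simp only: dtensor_eval_single 0 simp_thms)
  obtain m :: "'v \<Rightarrow> merof" where m: "\<And>x y. m (x + y) = m x + m y" "\<And>g x. m (sc g x) = g * m x" "m v = 1"
    using separating_functional[OF v(2)] by blast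
  define t' where "t' a b = actPh W (m a) b" for a b
  have "dtensor_eval sc t' x = 0" if "x \<in> dtensor_rels sc V W" for x
    using that
  proof induction
    case zero
    then show ?case by (simp add: dtensor_eval_def)
  next
    case (balanced v w g)
    then show ?case
      by (simp add: dtensor_eval_diff dtensor_eval_single t'_def m W.rll.aP_mult[symmetric] mult.commute)
  qed (simp_all add: dtensor_eval_diff dtensor_eval_single t'_def m W.rll.aP_add_left W.rll.aP_add)
  from this[OF rel] show False
    using w by (simp add: dtensor_eval_single t'_def m)
qed

text \<open>A coefficient of the left vector that depends on \<open>P\<close> cannot be pulled out
  of \<open>t\<close>; it crosses to the right vector as \<open>g(P + h)\<close>, where
  \<open>analytic_aP\<close> applies.\<close>

lemma analytic_t:
  assumes Y: "analytic_family sc V.V Y" and Z: "analytic_family sc W.V Z"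
  shows "analytic_family sc T.V (\<lambda>u. t (Y u) (Z u))"
  using Y
proof induction
  case (single e \<phi>)
  have "analytic_family sc T.V (\<lambda>u. t e (actPh W (\<phi> u) (Z u)))"
  proof (rule analytic_family_apply[OF W.subspace_V, where F = "\<lambda>_. t e" and m = 0])
    show "analytic_family sc W.V (\<lambda>u. actPh W (\<phi> u) (Z u))"
      by (rule W.rll.analytic_aP[OF Z single(2)])
    show "analytic_family sc T.V (\<lambda>u. t e x)" if "x \<in> W.V" for x
      by (rule analytic_family_constant) (use that single in simp)
  qed (use single in \<open>simp_all add: t_add_right t_scale\<close>)
  then show ?case
    using single analytic_family_mem[OF W.subspace_V Z] by (simp add: t_balanced)
next
  case (add X Y)
  then show ?case
    using analytic_family.add[OF add(3,4)] analytic_family_mem[OF V.subspace_V add(1)]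
      analytic_family_mem[OF V.subspace_V add(2)] analytic_family_mem[OF W.subspace_V Z]
    by (simp add: t_add_left)
qed

lemma tensor_spanning:
  assumes A: "A \<subseteq> V.V" "V.V \<subseteq> span A" and B: "B \<subseteq> W.V" "W.V \<subseteq> span B"
  shows "T.V \<subseteq> span ((\<lambda>(a, b). t a b) ` (A \<times> B))" (is "_ \<subseteq> ?S")
proof -
  have 1: "w \<in> W.V \<and> t a w \<in> ?S" if a: "a \<in> A" and w: "w \<in> span B" for a w
    using w
  proof (rule span_induct)
    have aV: "a \<in> V.V" using a A by blast
    show "subspace {w. w \<in> W.V \<and> t a w \<in> ?S}"
    proof (rule subspaceI)
      show "0 \<in> {w. w \<in> W.V \<and> t a w \<in> ?S}"
        by (simp add: t_0(1)[OF aV] span_zero)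
      show "x + y \<in> {w. w \<in> W.V \<and> t a w \<in> ?S}"
        if "x \<in> {w. w \<in> W.V \<and> t a w \<in> ?S}" "y \<in> {w. w \<in> W.V \<and> t a w \<in> ?S}" for x y
        using that by (simp add: t_add_right[OF aV] span_add)
      show "sc c x \<in> {w. w \<in> W.V \<and> t a w \<in> ?S}"
        if "x \<in> {w. w \<in> W.V \<and> t a w \<in> ?S}" for c x
        using that by (simp add: t_scale[OF aV, symmetric] span_scale)
    qed
    show "w \<in> W.V \<and> t a w \<in> ?S" if "w \<in> B" for w
    proof
      show "w \<in> W.V" using B that by blast
      show "t a w \<in> ?S" by (rule span_base) (use a that in force)
    qed
  qed
  \<comment> \<open>All \<open>w\<close> are needed at once, because a scalar on the left vector
    turns into \<open>actPh W c\<close> on \<open>w\<close>.\<close>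
  have 2: "v \<in> V.V \<and> (\<forall>w\<in>W.V. t v w \<in> ?S)" if v: "v \<in> span A" for v
    using v
  proof (rule span_induct)
    show "subspace {v. v \<in> V.V \<and> (\<forall>w\<in>W.V. t v w \<in> ?S)}"
    proof (rule subspaceI)
      show "0 \<in> {v. v \<in> V.V \<and> (\<forall>w\<in>W.V. t v w \<in> ?S)}"
        by (simp add: t_0(2) span_zero)
      show "x + y \<in> {v. v \<in> V.V \<and> (\<forall>w\<in>W.V. t v w \<in> ?S)}"
        if "x \<in> {v. v \<in> V.V \<and> (\<forall>w\<in>W.V. t v w \<in> ?S)}" "y \<in> {v. v \<in> V.V \<and> (\<forall>w\<in>W.V. t v w \<in> ?S)}" for x y
        using that by (simp add: t_add_left span_add)
      show "sc c x \<in> {v. v \<in> V.V \<and> (\<forall>w\<in>W.V. t v w \<in> ?S)}"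
        if "x \<in> {v. v \<in> V.V \<and> (\<forall>w\<in>W.V. t v w \<in> ?S)}" for c x
        using that by (simp add: t_balanced)
    qed
    show "v \<in> V.V \<and> (\<forall>w\<in>W.V. t v w \<in> ?S)" if "v \<in> A" for v
      using that A B 1 by blast
  qed
  show ?thesis
  proof
    fix x assume "x \<in> T.V"
    then show "x \<in> ?S"
    proof (induction rule: tensor_induct)
      case (tensor v w)
      then show ?case using 2 A by blast
    qed (simp_all add: span_zero span_add)
  qed
qed

text \<open>Every unwanted summand of the comultiplication contains \<open>L\<^sub>2\<^sub>1\<close>
  applied to a highest weight vector. The remaining scalars do not depend on \<open>P\<close>, so
  they pass through the tensor sign unchanged.\<close>

lemma highest_weight_data_tensor:
  assumes 1: "highest_weight_data q sc V \<zeta> \<mu> \<nu> N g" and 2: "highest_weight_data q sc W \<zeta>' \<mu>' \<nu>' N' g'"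
  shows "highest_weight_data q sc T (t \<zeta> \<zeta>') (\<lambda>u. \<mu> u * \<mu>' u) (\<lambda>u. \<nu> u * \<nu>' u) (N * N') (\<lambda>u. g u * g' u)"
proof -
  have q2: "q powr (2 * u) \<noteq> 0" for u using q_nz by simp
  have z1: "\<zeta> \<in> V.V" "\<zeta> \<noteq> 0" "\<And>u. cur V 2 1 (q powr (2 * u)) \<zeta> = 0"
    "\<And>u. cur V 1 1 (q powr (2 * u)) \<zeta> = sc (const (\<mu> u)) \<zeta>"
    "\<And>u. cur V 2 2 (q powr (2 * u)) \<zeta> = sc (const (\<nu> u)) \<zeta>"
    using 1 unfolding highest_weight_data_def by blast+
  have z2: "\<zeta>' \<in> W.V" "\<zeta>' \<noteq> 0" "\<And>u. cur W 2 1 (q powr (2 * u)) \<zeta>' = 0"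
    "\<And>u. cur W 1 1 (q powr (2 * u)) \<zeta>' = sc (const (\<mu>' u)) \<zeta>'"
    "\<And>u. cur W 2 2 (q powr (2 * u)) \<zeta>' = sc (const (\<nu>' u)) \<zeta>'"
    using 2 unfolding highest_weight_data_def by blast+
  obtain A where A: "finite A" "A \<subseteq> V.V" "V.V \<subseteq> span A" "card A \<le> N"
    using 1 unfolding highest_weight_data_def by blast
  obtain B where B: "finite B" "B \<subseteq> W.V" "W.V \<subseteq> span B" "card B \<le> N'"
    using 2 unfolding highest_weight_data_def by blast
  have div: "\<exists>Y. analytic_family sc T.V Y \<and> (\<forall>u. cur T i j (q powr (2 * u)) x = sc (const (g u * g' u)) (Y u))"
    if ij: "i \<in> {1,2}" "j \<in> {1,2}" and x: "x \<in> T.V" for i j x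
    using x
  proof (induction x rule: tensor_induct)
    case zero
    then show ?case
      using T.rll.X_0[OF ij] analytic_family_constant[of 0 T.V]
      by (intro exI[of _ "\<lambda>_. 0"]) simp
  next
    case (add x y)
    then obtain Y Z where Y: "analytic_family sc T.V Y"
        "\<And>u. cur T i j (q powr (2 * u)) x = sc (const (g u * g' u)) (Y u)"
      and Z: "analytic_family sc T.V Z" "\<And>u. cur T i j (q powr (2 * u)) y = sc (const (g u * g' u)) (Z u)"
      by blast
    show ?case
      by (intro exI[of _ "\<lambda>u. Y u + Z u"] conjI analytic_family.add Y Z allI)
        (simp add: T.rll.X_add[OF ij add(1,2)] Y(2) Z(2) scale_right_distrib)
  next
    case (tensor v w)
    have "\<forall>k\<in>{1,2}. \<exists>Y. analytic_family sc V.V Y \<and> (\<forall>u. cur V i k (q powr (2 * u)) v = sc (const (g u)) (Y u))"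
      using 1 ij tensor(1) unfolding highest_weight_data_def by blast
    then obtain Y where Y: "\<And>k. k \<in> {1,2} \<Longrightarrow> analytic_family sc V.V (Y k)"
      "\<And>k u. k \<in> {1,2} \<Longrightarrow> cur V i k (q powr (2 * u)) v = sc (const (g u)) (Y k u)"
      by metis
    have "\<forall>k\<in>{1,2}. \<exists>Z. analytic_family sc W.V Z \<and> (\<forall>u. cur W k j (q powr (2 * u)) w = sc (const (g' u)) (Z u))"
      using 2 ij tensor(2) unfolding highest_weight_data_def by blast
    then obtain Z where Z: "\<And>k. k \<in> {1,2} \<Longrightarrow> analytic_family sc W.V (Z k)"
      "\<And>k u. k \<in> {1,2} \<Longrightarrow> cur W k j (q powr (2 * u)) w = sc (const (g' u)) (Z k u)"
      by metis
    have "cur T i j (q powr (2 * u)) (t v w) = sc (const (g u * g' u)) (\<Sum>k\<in>{1,2}. t (Y k u) (Z k u))" for u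
      unfolding cur_t[OF tensor ij q2] scale_sum_right
    proof (intro sum.cong refl)
      fix k :: nat assume k: "k \<in> {1,2}"
      have m: "Y k u \<in> V.V" "Z k u \<in> W.V"
        using analytic_family_mem[OF V.subspace_V Y(1)[OF k]] analytic_family_mem[OF W.subspace_V Z(1)[OF k]] by auto
      then show "t (cur V i k (q powr (2 * u)) v) (cur W k j (q powr (2 * u)) w) =
          sc (const (g u * g' u)) (t (Y k u) (Z k u))"
        unfolding Y(2)[OF k] Z(2)[OF k] by (simp add: t_const t_scale const_mult)
    qed
    then show ?case
      by (intro exI[of _ "\<lambda>u. \<Sum>k\<in>{1,2}. t (Y k u) (Z k u)"] conjI analytic_family_sum T.subspace_V
          analytic_t Y Z) auto
  qed
  have "card ((\<lambda>(a, b). t a b) ` (A \<times> B)) \<le> N * N'"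
    using A(1,4) B(1,4) card_image_le[of "A \<times> B"] mult_le_mono
    by (metis card_cartesian_product finite_cartesian_product order_trans)
  moreover have "(\<lambda>(a, b). t a b) ` (A \<times> B) \<subseteq> T.V"
    using A(2) B(2) t_mem by (auto simp del: t_mem)
  moreover have "cur T 2 1 (q powr (2 * u)) (t \<zeta> \<zeta>') = 0"
    "cur T 1 1 (q powr (2 * u)) (t \<zeta> \<zeta>') = sc (const (\<mu> u * \<mu>' u)) (t \<zeta> \<zeta>')"
    "cur T 2 2 (q powr (2 * u)) (t \<zeta> \<zeta>') = sc (const (\<nu> u * \<nu>' u)) (t \<zeta> \<zeta>')" for u
    using cur_t[OF z1(1) z2(1) _ _ q2[of u]] z1 z2 V.rll.X_closed[of 1 2 \<zeta> u] W.rll.X_closed[of 1 2 \<zeta>' u]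
    by (simp_all add: sum_12 t_0 t_const t_scale[symmetric] const_mult del: sum.insert)
  moreover have "finite ((\<lambda>(a, b). t a b) ` (A \<times> B))" using A(1) B(1) by simp
  moreover note tensor_spanning[OF A(2,3) B(2,3)]
  ultimately show ?thesis
    unfolding highest_weight_data_def
    by (intro conjI allI ballI t_mem t_nonzero z1(1,2) z2(1,2) div exI[of _ "(\<lambda>(a, b). t a b) ` (A \<times> B)"])
qed

end

lemma (in generic_parameters) highest_weight_data_iterated:
  fixes sc :: "merof \<Rightarrow> 'v::ab_group_add \<Rightarrow> 'v"
  assumes sc: "vector_space sc" and T: "iterated_dtensor q p sc V v m T \<zeta>"
    and V: "\<And>i. i \<in> {1..m} \<Longrightarrow> level0_rep q p sc (V i) \<and> highest_weight_data q sc (V i) (v i) (\<mu> i) (\<nu> i) (N i) (g i)"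
  shows "level0_rep q p sc T \<and> highest_weight_data q sc T \<zeta> (\<lambda>u. \<Prod>i=1..m. \<mu> i u) (\<lambda>u. \<Prod>i=1..m. \<nu> i u)
    (\<Prod>i=1..m. N i) (\<lambda>u. \<Prod>i=1..m. g i u)"
  using T V
proof induction
  case one
  then show ?case by simp
next
  case (step m T \<zeta> t T')
  interpret vector_space sc by (rule sc)
  have IH: "level0_rep q p sc T" "highest_weight_data q sc T \<zeta> (\<lambda>u. \<Prod>i=1..m. \<mu> i u) (\<lambda>u. \<Prod>i=1..m. \<nu> i u)
    (\<Prod>i=1..m. N i) (\<lambda>u. \<Prod>i=1..m. g i u)"
    using step.IH step.prems by auto
  have S: "level0_rep q p sc (V (Suc m))"
    "highest_weight_data q sc (V (Suc m)) (v (Suc m)) (\<mu> (Suc m)) (\<nu> (Suc m)) (N (Suc m)) (g (Suc m))"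
    using step.prems[of "Suc m"] by auto
  interpret dynamical_tensor q p sc T "V (Suc m)" t T'
    by unfold_locales (use IH S step.hyps in auto)
  show ?case
    using highest_weight_data_tensor[OF IH(2) S(2)] T.level0 by simp
qed

section \<open>The Gelfand-Tsetlin basis\<close>

context rll_operators
begin

text \<open>Applying \<open>A\<^sub>2(u)\<close> at a zero of one eigenvalue but not of another shortens a linear relation.\<close>

lemma eigenvectors_independent:
  assumes F: "finite F" and v: "\<And>k. k \<in> F \<Longrightarrow> v k \<in> V \<and> v k \<noteq> 0"
    and eig: "\<And>k u. k \<in> F \<Longrightarrow> X 2 2 u (v k) = sc (const (\<Lambda> k u)) (v k)"
    and sep: "\<And>k k'. k \<in> F \<Longrightarrow> k' \<in> F \<Longrightarrow> k \<noteq> k' \<Longrightarrow> \<exists>u. (\<Lambda> k u = 0) \<noteq> (\<Lambda> k' u = 0)"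
    and S: "S \<subseteq> F" and rel: "(\<Sum>k\<in>S. sc (g k) (v k)) = 0" and k: "k \<in> S"
  shows "g k = 0"
  using S rel k
proof (induction "card S" arbitrary: S g k rule: less_induct)
  case less
  have finS: "finite S" using less.prems(1) F finite_subset by blast
  show ?case
  proof (cases "S = {k}")
    case True
    then show ?thesis using less.prems v by auto
  next
    case False
    then obtain k' where k': "k' \<in> S" "k' \<noteq> k" using less.prems(3) by blast
    then obtain u where u: "(\<Lambda> k u = 0) \<noteq> (\<Lambda> k' u = 0)" using sep[of k k'] less.prems by blast
    define S1 where "S1 = {k\<in>S. \<Lambda> k u \<noteq> 0}"
    have S1: "S1 \<subset> S" "S1 \<noteq> {}" using u k' less.prems(3) by (auto simp: S1_def)
    have "0 = X 2 2 u (\<Sum>k\<in>S. sc (g k) (v k))"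
      using less.prems by (simp add: X_0)
    \<comment> \<open>The coefficients come out shifted, so this relation cannot be combined with
      the original one; but a shifted coefficient is zero only if the coefficient itself is.\<close>
    also have "\<dots> = (\<Sum>k\<in>S. sc (shift (epsilon 2) (g k) * const (\<Lambda> k u)) (v k))"
    proof -
      have "(\<Sum>k\<in>K. sc (g k) (v k)) \<in> V \<and> X 2 2 u (\<Sum>k\<in>K. sc (g k) (v k)) =
          (\<Sum>k\<in>K. sc (shift (epsilon 2) (g k) * const (\<Lambda> k u)) (v k))" if "K \<subseteq> F" for K
        using finite_subset[OF that F] that
        by (induction K rule: finite_induct) (use v eig in \<open>simp_all add: X_0 X_add X_scale\<close>)
      then show ?thesis using less.prems(1) by blast
    qed
    also have "\<dots> = (\<Sum>k\<in>S1. sc (shift (epsilon 2) (g k) * const (\<Lambda> k u)) (v k))"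
      by (rule sum.mono_neutral_right[OF finS]) (auto simp: S1_def)
    finally have r1: "(\<Sum>k\<in>S1. sc (shift (epsilon 2) (g k) * const (\<Lambda> k u)) (v k)) = 0" by simp
    have g1: "g k = 0" if "k \<in> S1" for k
    proof -
      have "shift (epsilon 2) (g k) * const (\<Lambda> k u) = 0"
        by (rule less.hyps[OF psubset_card_mono[OF finS S1(1)] _ r1 that]) (use S1 less.prems in auto)
      then show ?thesis using that by (simp add: S1_def del: epsilon_2)
    qed
    have "(\<Sum>k\<in>S - S1. sc (g k) (v k)) = (\<Sum>k\<in>S. sc (g k) (v k))"
      by (rule sum.mono_neutral_left[OF finS]) (use g1 in auto)
    then have r2: "(\<Sum>k\<in>S - S1. sc (g k) (v k)) = 0" using less.prems by simp
    have "card (S - S1) < card S"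
      using S1 finS by (intro psubset_card_mono) auto
    from less.hyps[OF this _ r2] show ?thesis
      using g1 less.prems by (cases "k \<in> S1") auto
  qed
qed

lemma eigenvectors_independent_family:
  assumes "finite F" "\<And>k. k \<in> F \<Longrightarrow> v k \<in> V \<and> v k \<noteq> 0"
    "\<And>k u. k \<in> F \<Longrightarrow> X 2 2 u (v k) = sc (const (\<Lambda> k u)) (v k)"
    "\<And>k k'. k \<in> F \<Longrightarrow> k' \<in> F \<Longrightarrow> k \<noteq> k' \<Longrightarrow> \<exists>u. (\<Lambda> k u = 0) \<noteq> (\<Lambda> k' u = 0)"
  shows "inj_on v F" "independent (v ` F)"
proof -
  note ind = eigenvectors_independent[of F v \<Lambda>, OF assms]
  show inj: "inj_on v F"
  proof (rule inj_onI, rule ccontr)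
    fix k k' assume k: "k \<in> F" "k' \<in> F" "v k = v k'" "k \<noteq> k'"
    have "(\<Sum>i\<in>{k, k'}. sc (if i = k then 1 else - 1) (v i)) = 0"
      using k by simp
    then show False using ind[where S = "{k, k'}" and g = "\<lambda>i. if i = k then 1 else - 1" and k = k] k by simp
  qed
  show "independent (v ` F)"
  proof
    assume "dependent (v ` F)"
    then obtain c where c: "\<exists>x\<in>v ` F. c x \<noteq> 0" "(\<Sum>x\<in>v ` F. sc (c x) x) = 0"
      using dependent_finite[of "v ` F"] assms(1) by auto
    then have "(\<Sum>k\<in>F. sc (c (v k)) (v k)) = 0"
      by (simp add: sum.reindex[OF inj])
    with ind[where S = F and g = "\<lambda>k. c (v k)"] c(1) show False by auto
  qed
qed

lemma B2_string_closed [simp]: "v \<in> V \<Longrightarrow> B2_string X s b k v \<in> V"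
  by (induction k) simp_all

lemma B2_string_commute:
  "v \<in> V \<Longrightarrow> X 1 2 u (B2_string X s b k v) = B2_string X s b k (X 1 2 u v)"
  by (induction k) (simp_all add: X12_commute[of _ u])

text \<open>By \<open>X21_X22\<close> the vector to be inverted is visibly in the image of
  \<open>L\<^sub>2\<^sub>2(u)\<close>, and injectivity identifies its preimage.\<close>

lemma A1_op_qdet:
  assumes inv: "invertible_L22 V X u" and v: "v \<in> V"
  shows "A1_op V X u v = qdet u v"
proof -
  have "inj_on (X 2 2 u) V" using inv by (simp add: invertible_L22_def bij_betw_def)
  then have "inv_into V (X 2 2 u) (X 2 1 u (X 2 2 (u - 1) v)) = X 2 1 (u - 1) (sc (\<Theta> (-1) / \<Theta> 0) v)"
    unfolding X21_X22[OF v] using v by (intro inv_into_f_f) simp_all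
  then show ?thesis
    unfolding A1_op_def k1_op_def qdet_def by simp
qed

end

text \<open>What the argument needs of the tensor product: \<open>S\<close> bounds the dimension,
  \<open>divisible\<close> splits off the scalars of the one-dimensional factors, and
  \<open>sep\<close> is \<open>separated_strings\<close> in additive form.\<close>

locale gelfand_tsetlin = rll_operators q p sc V aP X
  for q p :: complex and sc :: "merof \<Rightarrow> 'v::ab_group_add \<Rightarrow> 'v" and V aP X +
  fixes n :: nat and s \<alpha> \<beta> :: "nat \<Rightarrow> complex" and l :: "nat \<Rightarrow> nat" and \<zeta> :: 'v and S :: "'v set"
  assumes \<zeta>: "\<zeta> \<in> V" "\<zeta> \<noteq> 0"
    and X21_\<zeta>: "X 2 1 u \<zeta> = 0"
    and X11_\<zeta>: "X 1 1 u \<zeta> = sc (const (\<Prod>i=1..n. \<theta> (\<alpha> i + u - s i))) \<zeta>"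
    and X22_\<zeta>: "X 2 2 u \<zeta> = sc (const (\<Prod>i=1..n. \<theta> (\<beta> i + u - s i))) \<zeta>"
    and \<alpha>: "i \<in> {1..n} \<Longrightarrow> \<alpha> i = \<beta> i + of_nat (l i)"
    and S: "finite S" "V \<subseteq> span S" "card S \<le> (\<Prod>i=1..n. l i + 1)"
    and divisible: "i \<in> {1,2} \<Longrightarrow> j \<in> {1,2} \<Longrightarrow> x \<in> V \<Longrightarrow> \<exists>Y. analytic_family sc V Y \<and>
      (\<forall>u. X i j u x = sc (const (\<Prod>i=1..n. if l i = 0 then \<theta> (\<beta> i + u - s i) else 1)) (Y u))"
    and sep: "i \<in> {1..n} \<Longrightarrow> j \<in> {1..n} \<Longrightarrow> i \<noteq> j \<Longrightarrow> r \<le> l i \<Longrightarrow> t < l j \<Longrightarrow>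
      \<theta> ((\<beta> i + of_nat r - s i) - (\<beta> j + of_nat t - s j)) \<noteq> 0"
begin

abbreviation box :: "(nat \<Rightarrow> nat) set" where "box \<equiv> PiE {1..n} (\<lambda>i. {..l i})"

definition trivial_factor :: "complex \<Rightarrow> complex" where
  "trivial_factor u = (\<Prod>i=1..n. if l i = 0 then \<theta> (\<beta> i + u - s i) else 1)"

definition pt :: "nat \<Rightarrow> nat \<Rightarrow> complex" where
  "pt i k = s i - (\<beta> i + of_nat k)"

definition \<Lambda> :: "(nat \<Rightarrow> nat) \<Rightarrow> complex \<Rightarrow> complex" where
  "\<Lambda> k u = (\<Prod>i=1..n. \<theta> (\<beta> i + of_nat (k i) + u - s i))"

definition Q :: "complex \<Rightarrow> complex" where
  "Q u = (\<Prod>i=1..n. \<theta> (\<alpha> i + u - s i) * \<theta> (\<beta> i - 1 + u - s i))"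

text \<open>The vectors of the theorem, labelled by string lengths. There is no upper bound on
  \<open>k\<close>, so that one step beyond the end of a string can be discussed in
  \<open>\<eta>_top\<close>.\<close>

definition \<eta> :: "(nat \<Rightarrow> nat) \<Rightarrow> 'v" where
  "\<eta> k = foldr (\<lambda>i. B2_string X (s i) (\<beta> i) (k i)) [1..<Suc n] \<zeta>"

lemma foldr_closed: "v \<in> V \<Longrightarrow> foldr (\<lambda>i. B2_string X (s i) (\<beta> i) (k i)) xs v \<in> V"
  by (induction xs) simp_all

lemma \<eta>_mem [simp]: "\<eta> k \<in> V"
  unfolding \<eta>_def by (rule foldr_closed[OF \<zeta>(1)])

lemma foldr_cong_k:
  "(\<And>i. i \<in> set xs \<Longrightarrow> k i = k' i) \<Longrightarrow>
    foldr (\<lambda>i. B2_string X (s i) (\<beta> i) (k i)) xs v = foldr (\<lambda>i. B2_string X (s i) (\<beta> i) (k' i)) xs v"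
  by (rule foldr_cong) simp_all

lemma foldr_step:
  assumes "distinct xs" "j \<in> set xs" "v \<in> V"
  shows "foldr (\<lambda>i. B2_string X (s i) (\<beta> i) ((k(j := Suc (k j))) i)) xs v =
    X 1 2 (pt j (k j)) (foldr (\<lambda>i. B2_string X (s i) (\<beta> i) (k i)) xs v)"
  using assms(1,2)
proof (induction xs)
  case (Cons a xs)
  show ?case
  proof (cases "a = j")
    case True
    then have "foldr (\<lambda>i. B2_string X (s i) (\<beta> i) ((k(j := Suc (k j))) i)) xs v =
        foldr (\<lambda>i. B2_string X (s i) (\<beta> i) (k i)) xs v"
      using Cons.prems by (intro foldr_cong_k) auto
    then show ?thesis using True by (simp add: pt_def)
  next
    case False
    then show ?thesis
      using Cons by (simp add: B2_string_commute foldr_closed assms(3))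
  qed
qed simp

lemma \<eta>_Suc: "j \<in> {1..n} \<Longrightarrow> \<eta> (k(j := Suc (k j))) = X 1 2 (pt j (k j)) (\<eta> k)"
  unfolding \<eta>_def by (rule foldr_step) (auto simp: \<zeta>)

lemma \<eta>_0: "(\<And>i. i \<in> {1..n} \<Longrightarrow> k i = 0) \<Longrightarrow> \<eta> k = \<zeta>"
proof -
  assume k: "\<And>i. i \<in> {1..n} \<Longrightarrow> k i = 0"
  have "foldr (\<lambda>i. B2_string X (s i) (\<beta> i) (k i)) [1..<Suc n] v =
      foldr (\<lambda>i. B2_string X (s i) (\<beta> i) ((\<lambda>_. 0) i)) [1..<Suc n] v" for v
    by (rule foldr_cong_k) (use k in auto)
  moreover have "foldr (\<lambda>i. B2_string X (s i) (\<beta> i) 0) xs v = v" for xs v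
    by (induction xs) simp_all
  ultimately show ?thesis by (simp only: \<eta>_def)
qed

text \<open>The total length decreases when one string is shortened. Values of \<open>k\<close>
  outside \<open>{1..n}\<close> stay arbitrary, so the base case is a family of functions rather
  than one.\<close>

lemma pattern_induct [case_names zero step]:
  assumes "\<And>k. (\<And>i. i \<in> {1..n} \<Longrightarrow> k i = 0) \<Longrightarrow> P k"
    and "\<And>k j. j \<in> {1..n} \<Longrightarrow> P k \<Longrightarrow> P (k(j := Suc (k j)))"
  shows "P k"
proof (induction "\<Sum>i=1..n. k i" arbitrary: k)
  case 0
  then show ?case by (intro assms(1)) simp
next
  case (Suc m)
  then obtain j where j: "j \<in> {1..n}" "k j \<noteq> 0"
    by (metis Zero_not_Suc sum.neutral)
  define k' where "k' = k(j := k j - 1)"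
  have k: "k = k'(j := Suc (k' j))" using j by (auto simp: k'_def)
  have "(\<Sum>i=1..n. k i) = k j + (\<Sum>i\<in>{1..n} - {j}. k i)"
    using j by (simp add: sum.remove)
  moreover have "(\<Sum>i=1..n. k' i) = (k j - 1) + (\<Sum>i\<in>{1..n} - {j}. k i)"
    using j by (subst sum.remove[of _ j]) (auto simp: k'_def intro!: sum.cong)
  ultimately have "m = (\<Sum>i=1..n. k' i)" using Suc.hyps(2) j(2) by linarith
  then have "P k'" by (rule Suc.hyps(1))
  then show ?case by (subst k) (rule assms(2)[OF j(1)])
qed

lemma \<Lambda>_pt: "j \<in> {1..n} \<Longrightarrow> \<Lambda> k (pt j (k j)) = 0"
  unfolding \<Lambda>_def pt_def by (rule prod_zero) (auto intro!: bexI[of _ j])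

lemma \<Lambda>_Suc:
  assumes "j \<in> {1..n}"
  shows "\<theta> (u - pt j (k j)) * \<Lambda> (k(j := Suc (k j))) u = \<theta> (u - pt j (k j) + 1) * \<Lambda> k u"
proof -
  have "(\<Prod>i\<in>{1..n} - {j}. \<theta> (\<beta> i + of_nat ((k(j := Suc (k j))) i) + u - s i)) =
      (\<Prod>i\<in>{1..n} - {j}. \<theta> (\<beta> i + of_nat (k i) + u - s i))"
    by (rule prod.cong) auto
  then show ?thesis
    using assms unfolding \<Lambda>_def pt_def
    by (simp add: prod.remove[of _ j] algebra_simps)
qed

lemma holomorphic_\<Lambda>: "\<Lambda> k holomorphic_on UNIV"
  unfolding \<Lambda>_def[abs_def] by (intro holomorphic_intros)

text \<open>The next operator in a string is evaluated at a zero of the current eigenvalue, so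
  \<open>X22_X12\<close> and \<open>qdet_X12\<close> apply at every step. No bound on
  \<open>k\<close> enters.\<close>

lemma eigenvalues: "X 2 2 u (\<eta> k) = sc (const (\<Lambda> k u)) (\<eta> k) \<and> qdet u (\<eta> k) = sc (const (Q u)) (\<eta> k)"
proof (induction k arbitrary: u rule: pattern_induct)
  case (zero k)
  then have e: "\<eta> k = \<zeta>" "\<Lambda> k u = (\<Prod>i=1..n. \<theta> (\<beta> i + u - s i))"
    by (auto simp: \<Lambda>_def intro!: prod.cong \<eta>_0)
  have "Q u = (\<Prod>i=1..n. \<theta> (\<beta> i + (u - 1) - s i)) * (\<Prod>i=1..n. \<theta> (\<alpha> i + u - s i))"
    unfolding Q_def prod.distrib[symmetric] by (intro prod.cong refl) (simp add: algebra_simps)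
  then show ?case
    using \<zeta>(1) by (simp add: e qdet_def X11_\<zeta> X22_\<zeta> X21_\<zeta> X_scale X_0 const_mult)
next
  case (step k j)
  define t where "t = pt j (k j)"
  have \<eta>': "\<eta> (k(j := Suc (k j))) = X 1 2 t (\<eta> k)" unfolding t_def by (rule \<eta>_Suc[OF step(1)])
  have t0: "X 2 2 t (\<eta> k) = 0" using step(2)[of t] by (simp add: t_def \<Lambda>_pt[OF step(1)])
  have "X 2 2 u (X 1 2 t (\<eta> k)) = sc (const (\<Lambda> (k(j := Suc (k j))) u)) (X 1 2 t (\<eta> k))"
  proof (rule analytic_family_eq[of V "\<lambda>u. X 2 2 u (X 1 2 t (\<eta> k))"
        "\<lambda>u. sc (const (\<Lambda> (k(j := Suc (k j))) u)) (X 1 2 t (\<eta> k))"])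
    show "analytic_family sc V (\<lambda>u. X 2 2 u (X 1 2 t (\<eta> k)))" by (intro X_analytic) auto
    show "analytic_family sc V (\<lambda>u. sc (const (\<Lambda> (k(j := Suc (k j))) u)) (X 1 2 t (\<eta> k)))"
      by (intro analytic_family.single entire_family_const holomorphic_\<Lambda>) simp
    have "X 2 2 u (X 1 2 t (\<eta> k)) = sc (const (\<Lambda> (k(j := Suc (k j))) u)) (X 1 2 t (\<eta> k))"
      if nz: "\<theta> (u + - t) \<noteq> 0" for u
    proof -
      have "sc (const (\<theta> (u - t))) (X 2 2 u (X 1 2 t (\<eta> k))) =
          sc (const (\<theta> (u - t + 1) * \<Lambda> k u)) (X 1 2 t (\<eta> k))"
        using X22_X12[OF \<eta>_mem t0, of u] step(2)[of u] by (simp add: X_const const_mult)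
      also have "\<dots> = sc (const (\<theta> (u - t))) (sc (const (\<Lambda> (k(j := Suc (k j))) u)) (X 1 2 t (\<eta> k)))"
        using \<Lambda>_Suc[OF step(1), of u k] by (simp add: t_def const_mult[symmetric])
      finally show ?thesis by (rule scale_left_imp_eq[rotated]) (use nz in simp)
    qed
    then show "\<forall>\<^sub>F u in at u. X 2 2 u (X 1 2 t (\<eta> k)) = sc (const (\<Lambda> (k(j := Suc (k j))) u)) (X 1 2 t (\<eta> k))"
      using eventually_theta_nz[of "- t" u] by (rule eventually_mono[rotated])
  qed
  moreover have "qdet u (X 1 2 t (\<eta> k)) = sc (const (Q u)) (X 1 2 t (\<eta> k))"
    using qdet_X12[OF \<eta>_mem t0, of u] step(2)[of u] by (simp add: X_const)
  ultimately show ?case by (simp only: \<eta>')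
qed

text \<open>In \<open>qdet_X21_X12\<close> at \<open>u = pt j (k j)\<close> the term with \<Pi>
  contains \<open>L\<^sub>2\<^sub>2\<close> at a zero of its eigenvalue and drops out; what is left
  carries the factor in \<Pi>*.\<close>

lemma X21_\<eta>_Suc:
  assumes j: "j \<in> {1..n}"
  shows "X 2 1 (pt j (Suc (k j))) (\<eta> (k(j := Suc (k j)))) =
    - sc (\<Theta> 1 / \<Theta> 0) (sc (const (Q (pt j (Suc (k j)) + 1))) (\<eta> k))"
proof -
  have pt: "pt j (Suc (k j)) = pt j (k j) - 1" by (simp add: pt_def)
  have z: "X 2 2 (pt j (k j)) (\<eta> k) = 0" using eigenvalues[of "pt j (k j)" k] by (simp add: \<Lambda>_pt[OF j])
  show ?thesis
    using qdet_X21_X12[OF \<eta>_mem, of "pt j (k j)" k]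
    by (simp add: pt \<eta>_Suc[OF j] X_0 z eigenvalues[THEN conjunct2])
qed

text \<open>True on the highest weight vector and preserved when another string grows: the
  eigenvalue vanishes at both points involved, and separation with \<open>r = 0\<close> makes the
  theta coefficient invertible.\<close>

lemma X21_\<eta>_0:
  assumes j: "j \<in> {1..n}" and k: "\<And>i. i \<in> {1..n} \<Longrightarrow> k i \<le> l i" "k j = 0"
  shows "X 2 1 (pt j 0) (\<eta> k) = 0"
  using k
proof (induction k rule: pattern_induct)
  case (zero k)
  have "\<eta> k = \<zeta>" by (rule \<eta>_0) (rule zero.hyps)
  then show ?case by (simp only: X21_\<zeta>)
next
  case (step k i)
  then have ij: "i \<noteq> j" by auto
  have k: "k m \<le> l m" if "m \<in> {1..n}" for m
    using step.prems(1)[OF that] by (cases "m = i") auto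
  have ki: "k i < l i" using step.prems(1)[OF step.hyps(1)] by simp
  have kj: "k j = 0" using step.prems(2) ij by simp
  have nz: "\<theta> (pt j 0 - pt i (k i)) \<noteq> 0"
    using sep[OF j step.hyps(1) ij[symmetric] le0 ki] theta_diff_commute[of "pt j 0" "pt i (k i)"]
    by (simp add: pt_def algebra_simps)
  show ?case
    unfolding \<eta>_Suc[OF step.hyps(1)]
    by (rule X21_X12_zero[OF \<eta>_mem _ _ _ nz])
      (use eigenvalues[of _ k] \<Lambda>_pt[OF step.hyps(1), of k] \<Lambda>_pt[OF j, of k] kj step.IH[OF k kj] in \<open>simp_all\<close>)
qed

subsection \<open>Division by the one-dimensional factors\<close>

text \<open>The choice is made for the whole function of \<open>u\<close> and evaluated afterwards;
  choosing separately for each \<open>u\<close> would lose analyticity.\<close>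

definition Xd :: "nat \<Rightarrow> nat \<Rightarrow> complex \<Rightarrow> 'v \<Rightarrow> 'v" where
  "Xd i j u x = (SOME Y. analytic_family sc V Y \<and> (\<forall>u. X i j u x = sc (const (trivial_factor u)) (Y u))) u"

lemma Xd:
  assumes "i \<in> {1,2}" "j \<in> {1,2}" "x \<in> V"
  shows Xd_analytic: "analytic_family sc V (\<lambda>u. Xd i j u x)"
    and X_Xd: "X i j u x = sc (const (trivial_factor u)) (Xd i j u x)"
proof -
  have "\<exists>Y. analytic_family sc V Y \<and> (\<forall>u. X i j u x = sc (const (trivial_factor u)) (Y u))"
    using divisible[OF assms] unfolding trivial_factor_def .
  note Y = someI_ex[OF this]
  show "analytic_family sc V (\<lambda>u. Xd i j u x)"
    using conjunct1[OF Y] unfolding Xd_def .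
  show "X i j u x = sc (const (trivial_factor u)) (Xd i j u x)"
    using spec[OF conjunct2[OF Y]] unfolding Xd_def .
qed

lemma eventually_trivial_factor_nz: "\<forall>\<^sub>F u in at u0. trivial_factor (u - c) \<noteq> 0"
proof -
  have e: "\<forall>\<^sub>F u in at u0. \<forall>i\<in>{1..n}. \<theta> (u + (\<beta> i - c - s i)) \<noteq> 0"
    by (rule eventually_ball_finite) (auto intro: eventually_theta_nz)
  have a: "u + (\<beta> i - c - s i) = \<beta> i + (u - c) - s i" for u i by simp
  show ?thesis
    using e unfolding a by (rule eventually_mono) (auto simp: trivial_factor_def)
qed

text \<open>The factor is nonzero in a punctured neighbourhood of each point, so it cancels even at
  its zeros by continuation. The offset \<open>c\<close> is 0 for semilinearity and 1 for the
  determinant relation.\<close>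

lemma Xd_unique:
  assumes "analytic_family sc V Y" "analytic_family sc V Z"
    "\<And>u. sc (const (trivial_factor (u - c))) (Y u) = sc (const (trivial_factor (u - c))) (Z u)"
  shows "Y u = Z u"
proof (rule analytic_family_eq[OF assms(1,2)])
  show "\<forall>\<^sub>F u in at u. Y u = Z u"
    using eventually_trivial_factor_nz[of c u]
  proof (rule eventually_mono)
    fix u assume "trivial_factor (u - c) \<noteq> 0"
    then have "const (trivial_factor (u - c)) \<noteq> 0" by simp
    then show "Y u = Z u" by (rule scale_left_imp_eq[OF _ assms(3)])
  qed
qed

lemma Xd_add:
  assumes ij: "i \<in> {1,2}" "j \<in> {1,2}" and v: "v \<in> V" "w \<in> V"
  shows "Xd i j u (v + w) = Xd i j u v + Xd i j u w"
proof (rule Xd_unique[of "\<lambda>u. Xd i j u (v + w)" "\<lambda>u. Xd i j u v + Xd i j u w" 0])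
  show "analytic_family sc V (\<lambda>u. Xd i j u (v + w))"
    by (intro Xd_analytic ij V_intros v)
  show "analytic_family sc V (\<lambda>u. Xd i j u v + Xd i j u w)"
    by (intro analytic_family.add Xd_analytic ij v)
  show "sc (const (trivial_factor (u - 0))) (Xd i j u (v + w)) =
      sc (const (trivial_factor (u - 0))) (Xd i j u v + Xd i j u w)" for u
    using X_add[OF ij v, of u] unfolding diff_zero scale_right_distrib
    by (simp only: X_Xd[OF ij v(1)] X_Xd[OF ij v(2)] X_Xd[OF ij V_intros(2)[OF v]])
qed

lemma Xd_scale:
  assumes ij: "i \<in> {1,2}" "j \<in> {1,2}" and v: "v \<in> V"
  shows "Xd i j u (sc g v) = sc (shift (epsilon j) g) (Xd i j u v)"
proof (rule Xd_unique[of "\<lambda>u. Xd i j u (sc g v)" "\<lambda>u. sc (shift (epsilon j) g) (Xd i j u v)" 0])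
  show "analytic_family sc V (\<lambda>u. sc (shift (epsilon j) g) (Xd i j u v))"
    by (intro analytic_family_scale Xd_analytic ij v entire_family_constant)
  show "sc (const (trivial_factor (u - 0))) (Xd i j u (sc g v)) =
      sc (const (trivial_factor (u - 0))) (sc (shift (epsilon j) g) (Xd i j u v))" for u
    using X_scale[OF ij v, of u g]
    by (simp add: X_Xd[OF ij v] X_Xd[OF ij V_intros(3)[OF v]] mult.commute)
qed (simp add: Xd_analytic ij v del: insert_iff)

lemma analytic_Xd:
  assumes ij: "i \<in> {1,2}" "j \<in> {1,2}" and Z: "analytic_family sc V Z"
  shows "analytic_family sc V (\<lambda>u. Xd i j (u - 1) (Z u))"
proof (rule analytic_family_apply[OF V, where F = "\<lambda>u. Xd i j (u - 1)" and m = "epsilon j"])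
  show "analytic_family sc V (\<lambda>u. Xd i j (u - 1) x)" if "x \<in> V" for x
    by (rule analytic_family_compose[OF Xd_analytic[OF ij that], of "\<lambda>u. u - 1"]) (intro holomorphic_intros)
qed (simp_all add: Xd_add Xd_scale ij Z del: insert_iff)

lemma Xd_0: "i \<in> {1,2} \<Longrightarrow> j \<in> {1,2} \<Longrightarrow> Xd i j u 0 = 0"
  using Xd_scale[of i j 0 u 0] by simp

definition Qd :: "complex \<Rightarrow> complex" where
  "Qd u = (\<Prod>i=1..n. \<theta> (\<alpha> i + u - s i)) * (\<Prod>i=1..n. if l i = 0 then 1 else \<theta> (\<beta> i - 1 + u - s i))"

lemma Q_Qd: "Q u = trivial_factor (u - 1) * Qd u"
  unfolding Q_def Qd_def trivial_factor_def prod.distrib[symmetric]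
  by (rule prod.cong) (auto simp: algebra_simps)

text \<open>This is the relation \<open>D \<theta>(q\<^sup>2\<Pi>\<^sup>*)/\<theta>(\<Pi>\<^sup>*) = \<theta>(q\<^sup>2\<Pi>)/\<theta>(\<Pi>) L\<^sub>1\<^sub>1 L\<^sub>2\<^sub>2 - L\<^sub>2\<^sub>1 L\<^sub>1\<^sub>2\<close> for the quantum
  determinant \<open>D\<close>, divided by the factors of the one-dimensional tensor factors.\<close>

lemma divided_relation:
  "sc (\<Theta> 1 / \<Theta> 0) (sc (const (Qd u)) (\<eta> k)) + Xd 2 1 (u - 1) (X 1 2 u (\<eta> k)) =
    aP (\<Theta> 1 / \<Theta> 0) (Xd 1 1 (u - 1) (X 2 2 u (\<eta> k)))"
proof (rule Xd_unique[of "\<lambda>u. sc (\<Theta> 1 / \<Theta> 0) (sc (const (Qd u)) (\<eta> k)) + Xd 2 1 (u - 1) (X 1 2 u (\<eta> k))"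
    "\<lambda>u. aP (\<Theta> 1 / \<Theta> 0) (Xd 1 1 (u - 1) (X 2 2 u (\<eta> k)))" 1])
  have Qd: "Qd holomorphic_on UNIV"
  proof -
    have "(\<lambda>u. if l i = 0 then 1 else \<theta> (\<beta> i - 1 + u - s i)) holomorphic_on UNIV" for i
      by (cases "l i = 0") (auto intro!: holomorphic_intros)
    then show ?thesis unfolding Qd_def[abs_def] by (intro holomorphic_intros)
  qed
  show "analytic_family sc V (\<lambda>u. sc (\<Theta> 1 / \<Theta> 0) (sc (const (Qd u)) (\<eta> k)) + Xd 2 1 (u - 1) (X 1 2 u (\<eta> k)))"
    by (intro analytic_family.add analytic_family_scale analytic_Xd X_analytic analytic_family_constant
        entire_family_constant entire_family_const Qd) auto
  show "analytic_family sc V (\<lambda>u. aP (\<Theta> 1 / \<Theta> 0) (Xd 1 1 (u - 1) (X 2 2 u (\<eta> k))))"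
    by (intro analytic_aP analytic_Xd X_analytic entire_family_constant) auto
  fix u
  have m: "Xd i j (u - 1) x \<in> V" if "i \<in> {1,2}" "j \<in> {1,2}" "x \<in> V" for i j x
    using analytic_family_mem[OF V Xd_analytic[OF that]] .
  let ?c = "const (trivial_factor (u - 1))"
  have "sc ?c (sc (\<Theta> 1 / \<Theta> 0) (sc (const (Qd u)) (\<eta> k)) + Xd 2 1 (u - 1) (X 1 2 u (\<eta> k))) =
      sc (\<Theta> 1 / \<Theta> 0) (qdet u (\<eta> k)) + X 2 1 (u - 1) (X 1 2 u (\<eta> k))"
    using eigenvalues[of u k]
    by (simp add: Q_Qd const_mult scale_right_distrib X_Xd[of 2 1 "X 1 2 u (\<eta> k)"] mult_ac)
  also have "\<dots> = aP (\<Theta> 1 / \<Theta> 0) (X 1 1 (u - 1) (X 2 2 u (\<eta> k)))"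
    using qdet_X21_X12[OF \<eta>_mem, of u k] by simp
  also have "\<dots> = sc ?c (aP (\<Theta> 1 / \<Theta> 0) (Xd 1 1 (u - 1) (X 2 2 u (\<eta> k))))"
    by (simp add: X_Xd[of 1 1 "X 2 2 u (\<eta> k)"] aP_scale m)
  finally show "sc ?c (sc (\<Theta> 1 / \<Theta> 0) (sc (const (Qd u)) (\<eta> k)) + Xd 2 1 (u - 1) (X 1 2 u (\<eta> k))) =
      sc ?c (aP (\<Theta> 1 / \<Theta> 0) (Xd 1 1 (u - 1) (X 2 2 u (\<eta> k))))" .
qed

text \<open>For \<open>i = j\<close> the arguments are nonzero integers. For
  \<open>i \<noteq> j\<close> separation applies, in the \<beta>-factors with the roles exchanged
  and \<open>t = 0\<close>; that needs \<open>0 < l i\<close>, which is why the \<beta>-factors with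
  \<open>l i = 0\<close> had to be divided out.\<close>

lemma Qd_nz:
  assumes j: "j \<in> {1..n}" and k: "k < l j"
  shows "Qd (pt j k) \<noteq> 0"
proof -
  have "\<theta> (\<alpha> i + pt j k - s i) \<noteq> 0" if i: "i \<in> {1..n}" for i
  proof (cases "i = j")
    case True
    then have "\<alpha> i + pt j k - s i = of_int (int (l j) - int k)"
      using \<alpha>[OF j] by (simp add: pt_def)
    then show ?thesis using theta_int_nz[of "int (l j) - int k"] k by simp
  next
    case False
    then show ?thesis
      using sep[OF i j False order_refl k] by (simp add: pt_def \<alpha>[OF i] algebra_simps)
  qed
  moreover have "\<theta> (\<beta> i - 1 + pt j k - s i) \<noteq> 0" if i: "i \<in> {1..n}" "l i \<noteq> 0" for i
  proof (cases "i = j")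
    case True
    then have e: "\<beta> i - 1 + pt j k - s i = of_int (- int (Suc k))"
      by (simp add: pt_def)
    show ?thesis unfolding e by (rule theta_int_nz) simp
  next
    case False
    have "\<theta> ((\<beta> j + of_nat (Suc k) - s j) - (\<beta> i + of_nat 0 - s i)) \<noteq> 0"
      by (rule sep) (use i j k False in auto)
    moreover have "\<beta> i - 1 + pt j k - s i = - ((\<beta> j + of_nat (Suc k) - s j) - (\<beta> i + of_nat 0 - s i))"
      by (simp add: pt_def)
    ultimately show ?thesis by (simp only: theta_minus neg_equal_0_iff_equal not_False_eq_True)
  qed
  ultimately show ?thesis unfolding Qd_def by simp
qed

text \<open>If lengthening a string gave zero, the divided determinant relation would force a
  nonzero multiple of the previous vector to vanish. With \<open>Q\<close> in place of
  \<open>Qd\<close> that multiple could itself be zero.\<close>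

lemma \<eta>_nonzero:
  assumes "\<And>i. i \<in> {1..n} \<Longrightarrow> k i \<le> l i"
  shows "\<eta> k \<noteq> 0"
  using assms
proof (induction k rule: pattern_induct)
  case (zero k)
  have "\<eta> k = \<zeta>" by (rule \<eta>_0) (rule zero.hyps)
  then show ?case using \<zeta>(2) by (simp only:) simp
next
  case (step k j)
  have k: "k i \<le> l i" if "i \<in> {1..n}" for i
    using step.prems[OF that] by (cases "i = j") auto
  have kj: "k j < l j" using step.prems[OF step.hyps] by simp
  show ?case
  proof
    assume "\<eta> (k(j := Suc (k j))) = 0"
    then have "X 1 2 (pt j (k j)) (\<eta> k) = 0" by (simp add: \<eta>_Suc[OF step.hyps])
    moreover have "X 2 2 (pt j (k j)) (\<eta> k) = 0"
      using eigenvalues[of "pt j (k j)" k] by (simp add: \<Lambda>_pt[OF step.hyps])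
    ultimately have "sc (\<Theta> 1 / \<Theta> 0 * const (Qd (pt j (k j)))) (\<eta> k) = 0"
      using divided_relation[of "pt j (k j)" k] by (simp add: Xd_0)
    then show False
      using step.IH[OF k] Qd_nz[OF step.hyps kj] by simp
  qed
qed

section \<open>Zeros of the eigenvalues and the dimension count\<close>

lemma \<Lambda>_nz:
  assumes "\<And>m. m \<in> {1..n} \<Longrightarrow> \<theta> ((\<beta> m + of_nat (k m) - s m) - (\<beta> i + of_nat r - s i)) \<noteq> 0"
  shows "\<Lambda> k (pt i r) \<noteq> 0"
proof -
  have "\<beta> m + of_nat (k m) + pt i r - s m = (\<beta> m + of_nat (k m) - s m) - (\<beta> i + of_nat r - s i)" for m
    by (simp add: pt_def)
  then have "\<theta> (\<beta> m + of_nat (k m) + pt i r - s m) \<noteq> 0" if "m \<in> {1..n}" for m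
    using assms[OF that] by (simp only: not_False_eq_True)
  then show ?thesis by (simp add: \<Lambda>_def)
qed

lemma theta_same: "r \<noteq> t \<Longrightarrow> \<theta> ((\<beta> i + of_nat r - s i) - (\<beta> i + of_nat t - s i)) \<noteq> 0"
  using theta_int_nz[of "int r - int t"] by simp

text \<open>Where the patterns first found to differ have \<open>k i < k' i\<close>, the point
  \<open>pt i (k i)\<close> is a zero of one eigenvalue only. Separation applies because
  \<open>k i\<close> is strictly below \<open>k' i\<close>, hence below \<open>l i\<close>.\<close>

lemma box_separated:
  assumes k: "k \<in> box" "k' \<in> box" "k \<noteq> k'"
  shows "\<exists>u. (\<Lambda> k u = 0) \<noteq> (\<Lambda> k' u = 0)"
proof -
  have main: "\<exists>u. \<Lambda> k u = 0 \<and> \<Lambda> k' u \<noteq> 0" if k: "k \<in> box" "k' \<in> box" and i: "i \<in> {1..n}" "k i < k' i" for k k' i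
  proof (intro exI conjI)
    show "\<Lambda> k (pt i (k i)) = 0" by (rule \<Lambda>_pt[OF i(1)])
    show "\<Lambda> k' (pt i (k i)) \<noteq> 0"
    proof (rule \<Lambda>_nz)
      fix m assume m: "m \<in> {1..n}"
      have le: "k' m \<le> l m" "k' i \<le> l i" using k(2) m i(1) by (auto simp: PiE_def Pi_def)
      show "\<theta> ((\<beta> m + of_nat (k' m) - s m) - (\<beta> i + of_nat (k i) - s i)) \<noteq> 0"
      proof (cases "m = i")
        case True
        then show ?thesis using theta_same[of "k' i" "k i" i] i by simp
      next
        case False
        then show ?thesis using sep[OF m i(1) False le(1), of "k i"] le(2) i(2) by simp
      qed
    qed
  qed
  obtain i where i: "i \<in> {1..n}" "k i \<noteq> k' i"
    using k by (metis PiE_ext)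
  then show ?thesis
    using main[of k k' i] main[of k' k i] k by (cases "k i < k' i") (auto simp: not_less)
qed

lemma finite_box: "finite box"
  by (intro finite_PiE) auto

lemma card_box: "card box = (\<Prod>i=1..n. l i + 1)"
  by (simp add: card_PiE Suc_eq_plus1)

lemma independent_card: "independent A \<Longrightarrow> A \<subseteq> V \<Longrightarrow> finite A \<and> card A \<le> (\<Prod>i=1..n. l i + 1)"
  using independent_span_bound[OF S(1), of A] subset_trans[OF _ S(2), of A] order_trans[OF _ S(3), of "card A"]
  by blast

text \<open>The box has exactly as many elements as the dimension bound allows, so a vector outside
  the span would give too large an independent set.\<close>

lemma box_basis: "inj_on \<eta> box" "independent (\<eta> ` box)" "span (\<eta> ` box) = V"
proof -
  have nz: "\<eta> k \<in> V \<and> \<eta> k \<noteq> 0" if "k \<in> box" for k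
    using that by (auto intro!: \<eta>_nonzero simp: PiE_def Pi_def)
  note ind = eigenvectors_independent_family[of box \<eta> \<Lambda>, OF finite_box nz _ box_separated]
  show inj: "inj_on \<eta> box" and indep: "independent (\<eta> ` box)"
    using ind eigenvalues by blast+
  show "span (\<eta> ` box) = V"
  proof
    show "span (\<eta> ` box) \<subseteq> V" by (rule span_minimal[OF _ V]) auto
    show "V \<subseteq> span (\<eta> ` box)"
    proof
      fix x assume x: "x \<in> V"
      show "x \<in> span (\<eta> ` box)"
      proof (rule ccontr)
        assume nx: "x \<notin> span (\<eta> ` box)"
        then have "independent (insert x (\<eta> ` box))" using indep by (simp add: independent_insert)
        moreover have "x \<notin> \<eta> ` box" using nx span_base by blast
        moreover have "insert x (\<eta> ` box) \<subseteq> V" using x \<eta>_mem by blast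
        ultimately show False
          using independent_card[of "insert x (\<eta> ` box)"] finite_box card_box card_image[OF inj] by simp
      qed
    qed
  qed
qed

text \<open>The pattern \<open>?k\<close> leaves the box, where \<open>sep\<close> does not separate
  it directly. A pattern \<open>k'\<close> of the box is told apart from it at
  \<open>pt j (k' j)\<close>, a zero of the eigenvalue of \<open>k'\<close> but not of that of
  \<open>?k\<close>.\<close>

lemma \<eta>_top:
  assumes k: "k \<in> box" and j: "j \<in> {1..n}" "k j = l j"
  shows "\<eta> (k(j := Suc (k j))) = 0"
proof (rule ccontr)
  let ?k = "k(j := Suc (k j))"
  assume nz: "\<eta> ?k \<noteq> 0"
  have kl: "k m \<le> l m" if "m \<in> {1..n}" for m using k that by (auto simp: PiE_def Pi_def)
  \<comment> \<open>Otherwise all currents vanish at this point and the vector is already zero. This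
    replaces separation for the one-dimensional factors, where \<open>sep\<close> gives
    nothing.\<close>
  have tf: "trivial_factor (pt j (l j)) \<noteq> 0"
  proof
    assume "trivial_factor (pt j (l j)) = 0"
    then have "X 1 2 (pt j (l j)) (\<eta> k) = 0"
      using X_Xd[of 1 2 "\<eta> k" "pt j (l j)"] by simp
    then show False using nz \<eta>_Suc[OF j(1), of k] j(2) by simp
  qed
  then have tf': "\<theta> (\<beta> m + pt j (l j) - s m) \<noteq> 0" if "m \<in> {1..n}" "l m = 0" for m
    using that unfolding trivial_factor_def by (auto dest: bspec[of _ _ m])
  \<comment> \<open>For \<open>l j = 0\<close> the j-th factor of \<open>trivial_factor\<close>
    would be \<theta>(0).\<close>
  have lj: "l j \<noteq> 0" using tf'[OF j(1)] by (auto simp: pt_def)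
  have out: "?k \<notin> box" using j by (auto simp: PiE_def Pi_def intro!: bexI[of _ j])
  have sep_top: "\<exists>u. \<Lambda> k' u = 0 \<and> \<Lambda> ?k u \<noteq> 0" if k': "k' \<in> box" for k'
  proof (intro exI conjI)
    have k'j: "k' j \<le> l j" using k' j(1) by (auto simp: PiE_def Pi_def)
    show "\<Lambda> k' (pt j (k' j)) = 0" by (rule \<Lambda>_pt[OF j(1)])
    show "\<Lambda> ?k (pt j (k' j)) \<noteq> 0"
    proof (rule \<Lambda>_nz)
      fix m assume m: "m \<in> {1..n}"
      show "\<theta> ((\<beta> m + of_nat (?k m) - s m) - (\<beta> j + of_nat (k' j) - s j)) \<noteq> 0"
      proof (cases "m = j")
        case True
        then show ?thesis using theta_same[of "Suc (l j)" "k' j" j] k'j j(2) by simp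
      next
        case False
        \<comment> \<open>At \<open>k' j = l j\<close> separation cannot be used as it stands: it is
          replaced by \<open>tf'\<close>, applied with exchanged roles, or, if both strings are
          full, applied after lowering both lengths by one, which leaves the difference
          unchanged.\<close>
        consider "k' j < l j" | "k' j = l j" "l m = 0" | "k' j = l j" "k m < l m" | "k' j = l j" "l m \<noteq> 0" "k m = l m"
          using k'j kl[OF m] by linarith
        then have "\<theta> ((\<beta> m + of_nat (k m) - s m) - (\<beta> j + of_nat (k' j) - s j)) \<noteq> 0"
        proof cases
          case 1
          then show ?thesis by (intro sep m j(1) False kl)
        next
          case 2
          then show ?thesis using tf'[OF m] kl[OF m] by (simp add: pt_def algebra_simps)
        next
          case 3
          then have "\<theta> ((\<beta> j + of_nat (l j) - s j) - (\<beta> m + of_nat (k m) - s m)) \<noteq> 0"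
            using False by (intro sep m j(1)) auto
          then show ?thesis
            using 3 theta_diff_commute[of "\<beta> m + of_nat (k m) - s m"] by simp
        next
          case 4
          have "\<theta> ((\<beta> m + of_nat (l m - 1) - s m) - (\<beta> j + of_nat (l j - 1) - s j)) \<noteq> 0"
            using False lj 4 by (intro sep m j(1)) auto
          moreover have "(\<beta> m + of_nat (k m) - s m) - (\<beta> j + of_nat (k' j) - s j) =
              (\<beta> m + of_nat (l m - 1) - s m) - (\<beta> j + of_nat (l j - 1) - s j)"
            using 4 lj by (simp add: of_nat_diff)
          ultimately show ?thesis by (simp only: not_False_eq_True)
        qed
        then show ?thesis using False by simp
      qed
    qed
  qed
  let ?F = "insert ?k box"
  have sepF: "\<exists>u. (\<Lambda> a u = 0) \<noteq> (\<Lambda> b u = 0)" if "a \<in> ?F" "b \<in> ?F" "a \<noteq> b" for a b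
    using that box_separated[of a b] sep_top[of a] sep_top[of b] by blast
  have nzF: "\<eta> a \<in> V \<and> \<eta> a \<noteq> 0" if "a \<in> ?F" for a
  proof (cases "a = ?k")
    case False
    then show ?thesis using that by (auto intro!: \<eta>_nonzero simp: PiE_def Pi_def)
  qed (use nz in simp)
  have finF: "finite ?F" using finite_box by simp
  note ind = eigenvectors_independent_family[of ?F \<eta> \<Lambda>, OF finF nzF _ sepF]
  have inj: "inj_on \<eta> ?F" and "independent (\<eta> ` ?F)" using ind eigenvalues by blast+
  moreover have "\<eta> ` ?F \<subseteq> V" using \<eta>_mem by blast
  ultimately have "card (\<eta> ` ?F) \<le> (\<Prod>i=1..n. l i + 1)"
    using independent_card[of "\<eta> ` ?F"] by blast
  then show False using card_image[OF inj] out finite_box card_box by simp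
qed

end

context gelfand_tsetlin
begin

subsection \<open>Patterns\<close>

text \<open>Translates complex labels into string lengths by the same \<open>THE\<close> as in
  \<open>xi\<close>; \<open>restrict\<close> places the result in the extensional
  \<open>box\<close>.\<close>

definition pattern :: "(nat \<Rightarrow> complex) \<Rightarrow> nat \<Rightarrow> nat" where
  "pattern \<gamma> = restrict (\<lambda>i. THE k. \<gamma> i - \<beta> i = of_nat k) {1..n}"

lemma pattern_eqI:
  assumes "k \<in> extensional {1..n}" "\<And>i. i \<in> {1..n} \<Longrightarrow> \<gamma> i = \<beta> i + of_nat (k i)"
  shows "pattern \<gamma> = k"
proof
  fix i
  show "pattern \<gamma> i = k i"
  proof (cases "i \<in> {1..n}")
    case True
    then have "(THE m. \<gamma> i - \<beta> i = of_nat m) = k i"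
      by (intro the_equality) (simp_all add: assms(2))
    then show ?thesis using True by (simp add: pattern_def del: atLeastAtMost_iff)
  next
    case False
    then show ?thesis using assms(1) by (simp add: pattern_def extensional_def del: atLeastAtMost_iff)
  qed
qed

lemma GT_pattern:
  assumes "\<gamma> \<in> GT_patterns n \<alpha> \<beta>"
  shows "pattern \<gamma> \<in> box" "\<And>i. i \<in> {1..n} \<Longrightarrow> \<gamma> i = \<beta> i + of_nat (pattern \<gamma> i)"
proof -
  have p: "\<gamma> i = \<beta> i + of_nat (pattern \<gamma> i) \<and> pattern \<gamma> i \<le> l i" if i: "i \<in> {1..n}" for i
  proof -
    obtain k m where k: "\<gamma> i - \<beta> i = of_nat k" "\<alpha> i - \<gamma> i = of_nat m"
      using assms i unfolding GT_patterns_def by (blast elim: Nats_cases)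
    then have "(THE k. \<gamma> i - \<beta> i = of_nat k) = k" by (intro the_equality) simp_all
    then have "pattern \<gamma> i = k" using i by (simp add: pattern_def del: atLeastAtMost_iff)
    moreover have "of_nat (l i) = (of_nat (k + m) :: complex)"
    proof -
      have "of_nat (l i) = (\<alpha> i - \<gamma> i) + (\<gamma> i - \<beta> i)" using \<alpha>[OF i] by simp
      then show ?thesis unfolding k by simp
    qed
    ultimately show ?thesis using k(1) by (simp only: of_nat_eq_iff) (simp add: algebra_simps)
  qed
  then show "\<And>i. i \<in> {1..n} \<Longrightarrow> \<gamma> i = \<beta> i + of_nat (pattern \<gamma> i)" by blast
  show "pattern \<gamma> \<in> box"
    using p by (auto simp: PiE_def Pi_def pattern_def)
qed

lemma GT_I:
  assumes "k \<in> box" "\<gamma> \<in> extensional {1..n}" "\<And>i. i \<in> {1..n} \<Longrightarrow> \<gamma> i = \<beta> i + of_nat (k i)"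
  shows "\<gamma> \<in> GT_patterns n \<alpha> \<beta>"
proof -
  have "\<alpha> i - \<gamma> i \<in> \<nat> \<and> \<gamma> i - \<beta> i \<in> \<nat>" if i: "i \<in> {1..n}" for i
  proof -
    have "k i \<le> l i" using assms(1) i by (auto simp: PiE_def Pi_def)
    then have "\<alpha> i - \<gamma> i = of_nat (l i - k i)" "\<gamma> i - \<beta> i = of_nat (k i)"
      using \<alpha>[OF i] assms(3)[OF i] by (simp_all add: of_nat_diff)
    then show ?thesis by (simp only: of_nat_in_Nats)
  qed
  then show ?thesis using assms(2) by (simp add: GT_patterns_def)
qed

lemma bij_pattern: "bij_betw pattern (GT_patterns n \<alpha> \<beta>) box"
proof (rule bij_betwI[where g = "\<lambda>k. restrict (\<lambda>i. \<beta> i + of_nat (k i)) {1..n}"])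
  show "pattern \<in> GT_patterns n \<alpha> \<beta> \<rightarrow> box" using GT_pattern(1) by blast
  show "(\<lambda>k. restrict (\<lambda>i. \<beta> i + of_nat (k i)) {1..n}) \<in> box \<rightarrow> GT_patterns n \<alpha> \<beta>"
    by (intro Pi_I GT_I) (auto simp: restrict_extensional)
  show "restrict (\<lambda>i. \<beta> i + of_nat (pattern \<gamma> i)) {1..n} = \<gamma>" if "\<gamma> \<in> GT_patterns n \<alpha> \<beta>" for \<gamma>
    using that GT_pattern(2)[OF that]
    by (intro extensionalityI[of _ "{1..n}"]) (auto simp: GT_patterns_def)
  show "pattern (restrict (\<lambda>i. \<beta> i + of_nat (k i)) {1..n}) = k" if "k \<in> box" for k
    by (rule pattern_eqI) (use that in \<open>auto simp: PiE_def\<close>)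
qed

lemma xi_eq: "\<gamma> \<in> GT_patterns n \<alpha> \<beta> \<Longrightarrow> xi X \<zeta> n s \<alpha> \<beta> \<gamma> = \<eta> (pattern \<gamma>)"
  unfolding xi_def \<eta>_def by (auto intro!: foldr_cong simp: pattern_def)

lemma xi_not_GT: "\<gamma> \<notin> GT_patterns n \<alpha> \<beta> \<Longrightarrow> xi X \<zeta> n s \<alpha> \<beta> \<gamma> = 0"
  by (simp add: xi_def)

lemma basis_family_xi: "basis_family sc V (xi X \<zeta> n s \<alpha> \<beta>) (GT_patterns n \<alpha> \<beta>)"
proof -
  let ?G = "GT_patterns n \<alpha> \<beta>"
  have im: "pattern ` ?G = box" and inj: "inj_on pattern ?G"
    using bij_pattern by (auto simp: bij_betw_def)
  have x: "xi X \<zeta> n s \<alpha> \<beta> ` ?G = \<eta> ` box"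
    unfolding im[symmetric] image_image by (rule image_cong) (simp_all add: xi_eq)
  have "inj_on (\<lambda>\<gamma>. \<eta> (pattern \<gamma>)) ?G"
    using comp_inj_on[OF inj, of \<eta>] box_basis(1) im by (simp add: o_def)
  then have "inj_on (xi X \<zeta> n s \<alpha> \<beta>) ?G"
    using inj_on_cong[of ?G "xi X \<zeta> n s \<alpha> \<beta>" "\<lambda>\<gamma>. \<eta> (pattern \<gamma>)"] xi_eq by simp
  then show ?thesis
    unfolding basis_family_def x using box_basis by simp
qed

lemma
  assumes \<gamma>: "\<gamma> \<in> GT_patterns n \<alpha> \<beta>"
  shows A1_xi: "invertible_L22 V X u \<Longrightarrow> A1_op V X u (xi X \<zeta> n s \<alpha> \<beta> \<gamma>) =
      sc (const (\<Prod>i=1..n. \<theta> (\<alpha> i + u - s i) * \<theta> (\<beta> i - 1 + u - s i))) (xi X \<zeta> n s \<alpha> \<beta> \<gamma>)"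
    and A2_xi: "X 2 2 u (xi X \<zeta> n s \<alpha> \<beta> \<gamma>) =
      sc (const (\<Prod>i=1..n. \<theta> (\<gamma> i + u - s i))) (xi X \<zeta> n s \<alpha> \<beta> \<gamma>)"
proof -
  note e = eigenvalues[of u "pattern \<gamma>"]
  show "invertible_L22 V X u \<Longrightarrow> A1_op V X u (xi X \<zeta> n s \<alpha> \<beta> \<gamma>) =
      sc (const (\<Prod>i=1..n. \<theta> (\<alpha> i + u - s i) * \<theta> (\<beta> i - 1 + u - s i))) (xi X \<zeta> n s \<alpha> \<beta> \<gamma>)"
    using e by (simp add: xi_eq[OF \<gamma>] A1_op_qdet Q_def)
  have "\<Lambda> (pattern \<gamma>) u = (\<Prod>i=1..n. \<theta> (\<gamma> i + u - s i))"
    unfolding \<Lambda>_def by (rule prod.cong) (simp_all add: GT_pattern(2)[OF \<gamma>])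
  then show "X 2 2 u (xi X \<zeta> n s \<alpha> \<beta> \<gamma>) =
      sc (const (\<Prod>i=1..n. \<theta> (\<gamma> i + u - s i))) (xi X \<zeta> n s \<alpha> \<beta> \<gamma>)"
    using e by (simp add: xi_eq[OF \<gamma>])
qed

lemma
  assumes \<gamma>: "\<gamma> \<in> GT_patterns n \<alpha> \<beta>" and j: "j \<in> {1..n}"
  shows B2_xi: "X 1 2 (s j - \<gamma> j) (xi X \<zeta> n s \<alpha> \<beta> \<gamma>) = xi X \<zeta> n s \<alpha> \<beta> (\<gamma>(j := \<gamma> j + 1))"
    and C2_xi: "X 2 1 (s j - \<gamma> j) (xi X \<zeta> n s \<alpha> \<beta> \<gamma>) =
      - sc (\<Theta> 1 / \<Theta> 0) (sc (const (\<Prod>i=1..n. \<theta> (\<alpha> i - \<gamma> j + 1 + s j - s i) * \<theta> (\<beta> i - \<gamma> j + s j - s i)))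
        (xi X \<zeta> n s \<alpha> \<beta> (\<gamma>(j := \<gamma> j - 1))))"
proof -
  define k where "k = pattern \<gamma>"
  have k: "k \<in> box" and \<gamma>k: "\<And>i. i \<in> {1..n} \<Longrightarrow> \<gamma> i = \<beta> i + of_nat (k i)"
    using GT_pattern[OF \<gamma>] by (auto simp: k_def)
  have kl: "k i \<le> l i" if "i \<in> {1..n}" for i using k that by (auto simp: PiE_def Pi_def)
  have kext: "k \<in> extensional {1..n}" using k by (simp add: PiE_def)
  have \<gamma>ext: "\<gamma>(j := x) \<in> extensional {1..n}" for x
    using \<gamma> j by (auto simp: GT_patterns_def extensional_def)
  have kext': "k(j := x) \<in> extensional {1..n}" for x
    using kext j by (auto simp: extensional_def)
  have upd: "k(j := x) \<in> box" if "x \<le> l j" for x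
    using k j that by (auto simp: PiE_def Pi_def extensional_def)
  \<comment> \<open>Serves both neighbours of \<open>\<gamma>\<close>, with \<open>x\<close> the new
    length of string \<open>j\<close>.\<close>
  have move: "xi X \<zeta> n s \<alpha> \<beta> (\<gamma>(j := \<beta> j + of_nat x)) = \<eta> (k(j := x))" if "x \<le> l j" for x
  proof -
    have "\<gamma>(j := \<beta> j + of_nat x) \<in> GT_patterns n \<alpha> \<beta>"
      by (rule GT_I[OF upd[OF that] \<gamma>ext]) (simp add: \<gamma>k)
    moreover have "pattern (\<gamma>(j := \<beta> j + of_nat x)) = k(j := x)"
      by (rule pattern_eqI[OF kext']) (simp add: \<gamma>k)
    ultimately show ?thesis by (simp add: xi_eq)
  qed
  have pt: "s j - \<gamma> j = pt j (k j)" by (simp add: pt_def \<gamma>k[OF j])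
  \<comment> \<open>A step beyond either end of a string makes one of the differences in
    \<open>GT_patterns\<close> equal to -1.\<close>
  have no_neg: "- (1::complex) \<notin> \<nat>"
  proof
    assume "- (1::complex) \<in> \<nat>"
    then obtain m :: nat where "- 1 = (of_nat m :: complex)" by (auto simp: Nats_def)
    from arg_cong[OF this, of Re] show False by simp
  qed
  show "X 1 2 (s j - \<gamma> j) (xi X \<zeta> n s \<alpha> \<beta> \<gamma>) = xi X \<zeta> n s \<alpha> \<beta> (\<gamma>(j := \<gamma> j + 1))"
  proof (cases "k j = l j")
    case True
    have "\<gamma>(j := \<gamma> j + 1) \<notin> GT_patterns n \<alpha> \<beta>"
    proof
      assume "\<gamma>(j := \<gamma> j + 1) \<in> GT_patterns n \<alpha> \<beta>"
      then have "\<alpha> j - (\<gamma> j + 1) \<in> \<nat>" using j by (auto simp: GT_patterns_def dest: bspec[of _ _ j])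
      then show False using no_neg \<alpha>[OF j] \<gamma>k[OF j] True by simp
    qed
    then show ?thesis
      using \<eta>_top[OF k j True] \<eta>_Suc[OF j, of k] by (simp add: xi_not_GT xi_eq[OF \<gamma>] pt k_def[symmetric])
  next
    case False
    have le: "Suc (k j) \<le> l j" using False kl[OF j] by simp
    show ?thesis
    proof -
      have "\<gamma> j + 1 = \<beta> j + of_nat (Suc (k j))" by (simp add: \<gamma>k[OF j])
      then show ?thesis
        using move[OF le] \<eta>_Suc[OF j, of k]
        by (simp only: xi_eq[OF \<gamma>] pt k_def[symmetric])
    qed
  qed
  show "X 2 1 (s j - \<gamma> j) (xi X \<zeta> n s \<alpha> \<beta> \<gamma>) =
      - sc (\<Theta> 1 / \<Theta> 0) (sc (const (\<Prod>i=1..n. \<theta> (\<alpha> i - \<gamma> j + 1 + s j - s i) * \<theta> (\<beta> i - \<gamma> j + s j - s i)))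
        (xi X \<zeta> n s \<alpha> \<beta> (\<gamma>(j := \<gamma> j - 1))))"
  proof (cases "k j")
    case 0
    have "\<gamma>(j := \<gamma> j - 1) \<notin> GT_patterns n \<alpha> \<beta>"
    proof
      assume "\<gamma>(j := \<gamma> j - 1) \<in> GT_patterns n \<alpha> \<beta>"
      then have "\<gamma> j - 1 - \<beta> j \<in> \<nat>" using j by (auto simp: GT_patterns_def dest: bspec[of _ _ j])
      then show False using no_neg \<gamma>k[OF j] 0 by simp
    qed
    then show ?thesis
      using X21_\<eta>_0[OF j kl 0] by (simp add: xi_not_GT xi_eq[OF \<gamma>] pt k_def[symmetric] 0)
  next
    case (Suc m)
    have m: "m \<le> l j" using kl[OF j] Suc by simp
    have \<gamma>': "\<gamma> j - 1 = \<beta> j + of_nat m" using \<gamma>k[OF j] Suc by simp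
    have Q: "Q (pt j (k j) + 1) =
        (\<Prod>i=1..n. \<theta> (\<alpha> i - \<gamma> j + 1 + s j - s i) * \<theta> (\<beta> i - \<gamma> j + s j - s i))"
      unfolding Q_def pt[symmetric] by (rule prod.cong) (simp_all add: algebra_simps)
    have "X 2 1 (pt j (k j)) (\<eta> k) = - sc (\<Theta> 1 / \<Theta> 0) (sc (const (Q (pt j (k j) + 1))) (\<eta> (k(j := m))))"
      using X21_\<eta>_Suc[OF j, of "k(j := m)"] by (simp add: Suc[symmetric])
    then show ?thesis
      unfolding Q \<gamma>' move[OF m] by (simp only: xi_eq[OF \<gamma>] pt k_def[symmetric])
  qed
qed

end

section \<open>From the given representations to the abstract setting\<close>

lemma highest_weight_dataD:
  assumes "highest_weight_data q sc R \<zeta> \<mu> \<nu> N g"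
  shows "\<zeta> \<in> rep_space R" "\<zeta> \<noteq> 0" "cur R 2 1 (q powr (2 * u)) \<zeta> = 0"
    "cur R 1 1 (q powr (2 * u)) \<zeta> = sc (const (\<mu> u)) \<zeta>"
    "cur R 2 2 (q powr (2 * u)) \<zeta> = sc (const (\<nu> u)) \<zeta>"
    "\<exists>S. finite S \<and> rep_space R \<subseteq> module.span sc S \<and> card S \<le> N"
    "i \<in> {1,2} \<Longrightarrow> j \<in> {1,2} \<Longrightarrow> x \<in> rep_space R \<Longrightarrow> \<exists>Y. analytic_family sc (rep_space R) Y \<and>
      (\<forall>u. cur R i j (q powr (2 * u)) x = sc (const (g u)) (Y u))"
  using assms unfolding highest_weight_data_def by blast+

theorem theorem4p5:
  fixes q p :: complex
    and sc :: "merof \<Rightarrow> 'v::ab_group_add \<Rightarrow> 'v"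
    and n :: nat
    and a s \<alpha> \<beta> :: "nat \<Rightarrow> complex"
    and l :: "nat \<Rightarrow> nat"
    and V :: "nat \<Rightarrow> 'v drep"
    and v :: "nat \<Rightarrow> 'v"
    and T :: "'v drep"
    and \<zeta> :: 'v
    and f :: "complex \<Rightarrow> complex"
  defines "L \<equiv> Ltw q sc f T"
    and "\<xi> \<equiv> xi (Ltw q sc f T) \<zeta> n s \<alpha> \<beta>"
  assumes pq: "generic_pq q p"
    and vs: "vector_space sc"
    and n: "n \<ge> 1"
    and a: "\<And>i. i \<in> {1..n} \<Longrightarrow> a i \<noteq> 0 \<and> q powr (2 * s i) = a i"
    and l: "\<And>i. i \<in> {1..n} \<Longrightarrow> \<alpha> i - \<beta> i = of_nat (l i)"
    and sep: "separated_strings q p n a \<beta> l"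
    and V: "\<And>i. i \<in> {1..n} \<Longrightarrow>
      eval_rep q p sc (l i) ((- \<alpha> i - \<beta> i + 2) / 2 + s i) (V i) (v i)"
    and T: "iterated_dtensor q p sc V v n T \<zeta>"
    and irr: "irreducible_rep sc T"
    and f: "twist_fun f"
    and k1: "\<And>u. invertible_L22 (rep_space T) L u \<Longrightarrow>
      k1_op (rep_space T) L u \<zeta> = sc (const (\<Prod>i=1..n. th q p (\<alpha> i + u - s i))) \<zeta>"
    and k2: "\<And>u. k2_op L u \<zeta> = sc (const (\<Prod>i=1..n. th q p (\<beta> i + u - s i))) \<zeta>"
  shows "basis_family sc (rep_space T) \<xi> (GT_patterns n \<alpha> \<beta>) \<and>
    (\<forall>\<gamma>\<in>GT_patterns n \<alpha> \<beta>.
      (\<forall>u. invertible_L22 (rep_space T) L u \<longrightarrow>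
        A1_op (rep_space T) L u (\<xi> \<gamma>) =
          sc (const (\<Prod>i=1..n. th q p (\<alpha> i + u - s i) * th q p (\<beta> i - 1 + u - s i))) (\<xi> \<gamma>)) \<and>
      (\<forall>u. A2_op L u (\<xi> \<gamma>) = sc (const (\<Prod>i=1..n. th q p (\<gamma> i + u - s i))) (\<xi> \<gamma>)) \<and>
      (\<forall>j\<in>{1..n}.
        B2_op L (s j - \<gamma> j) (\<xi> \<gamma>) = \<xi> (\<gamma>(j := \<gamma> j + 1)) \<and>
        C2_op L (s j - \<gamma> j) (\<xi> \<gamma>) =
          - sc (thPi q p 1 / thPi q p 0)
              (sc (const (\<Prod>i=1..n. th q p (\<alpha> i - \<gamma> j + 1 + s j - s i) *
                                     th q p (\<beta> i - \<gamma> j + s j - s i)))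
                (\<xi> (\<gamma>(j := \<gamma> j - 1))))))"
proof -
  interpret generic_parameters q p by unfold_locales (rule pq)
  interpret vector_space sc by (rule vs)
  interpret merof_space sc by unfold_locales
  have lc: "of_nat (l i) = \<alpha> i - \<beta> i" if "i \<in> {1..n}" for i using l[OF that] by simp
  \<comment> \<open>Each \<open>eval_rep\<close> hides its twist behind an existential quantifier;
    bundling the properties lets one twist per factor be chosen simultaneously.\<close>
  define HW where "HW i F \<longleftrightarrow> twist_fun F \<and> level0_rep q p sc (V i) \<and>
      highest_weight_data q sc (V i) (v i) (\<lambda>u. \<theta> (\<alpha> i + u - s i) / F u) (\<lambda>u. \<theta> (\<beta> i + u - s i) / F u) (l i + 1)
        (\<lambda>u. if l i = 0 then \<theta> (\<beta> i + u - s i) else 1)" for i F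
  have "\<exists>F. HW i F" if i: "i \<in> {1..n}" for i
  proof -
    let ?c = "(- \<alpha> i - \<beta> i + 2) / 2 + s i"
    have lev: "level0_rep q p sc (V i)" using V[OF i] by (simp add: eval_rep_def)
    interpret Vi: level0_representation q p sc "V i" by unfold_locales (rule lev)
    have eq: "(of_nat (l i) + 2) / 2 + u - ?c = \<alpha> i + u - s i"
      "(- of_nat (l i) + 2) / 2 + u - ?c = \<beta> i + u - s i" for u
      unfolding lc[OF i] by (simp_all add: field_simps)
    have eq0: "1 + u - ?c = \<beta> i + u - s i" if "l i = 0" for u
      using lc[OF i] that by (simp add: field_simps)
    have eq': "(\<lambda>u. if l i = 0 then \<theta> (1 + u - ?c) else 1) = (\<lambda>u. if l i = 0 then \<theta> (\<beta> i + u - s i) else 1)"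
      by (cases "l i = 0") (simp_all only: eq0 if_True if_False simp_thms)
    show ?thesis
      using Vi.highest_weight_data_eval[OF V[OF i], unfolded eq eq'] lev unfolding HW_def by blast
  qed
  then obtain F where HW: "\<And>i. i \<in> {1..n} \<Longrightarrow> HW i (F i)"
    by metis
  have F: "twist_fun (F i)" if "i \<in> {1..n}" for i
    using HW[OF that] by (simp add: HW_def)
  have hw: "level0_rep q p sc (V i) \<and>
      highest_weight_data q sc (V i) (v i) (\<lambda>u. \<theta> (\<alpha> i + u - s i) / F i u) (\<lambda>u. \<theta> (\<beta> i + u - s i) / F i u) (l i + 1)
        (\<lambda>u. if l i = 0 then \<theta> (\<beta> i + u - s i) else 1)" if "i \<in> {1..n}" for i
    using HW[OF that] unfolding HW_def by (rule conjunct2)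
  have data: "level0_rep q p sc T \<and> highest_weight_data q sc T \<zeta>
      (\<lambda>u. \<Prod>i=1..n. \<theta> (\<alpha> i + u - s i) / F i u) (\<lambda>u. \<Prod>i=1..n. \<theta> (\<beta> i + u - s i) / F i u)
      (\<Prod>i=1..n. l i + 1) (\<lambda>u. \<Prod>i=1..n. if l i = 0 then \<theta> (\<beta> i + u - s i) else 1)"
    by (rule highest_weight_data_iterated[OF vs T]) (rule hw)
  note lev = conjunct1[OF data] and z = highest_weight_dataD[OF conjunct2[OF data]]
  interpret T: level0_representation q p sc T by unfold_locales (rule lev)
  have Fnz: "F i u \<noteq> 0" and Fh: "F i holomorphic_on UNIV" if "i \<in> {1..n}" for i u
    using F[OF that] by (auto simp: twist_fun_def)
  have fh: "f holomorphic_on UNIV" using f by (simp add: twist_fun_def)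
  obtain S where S: "finite S" "rep_space T \<subseteq> span S" "card S \<le> (\<Prod>i=1..n. l i + 1)"
    using z(6) by auto
  define FF where "FF u = (\<Prod>i=1..n. F i u)" for u
  have FF: "FF u \<noteq> 0" for u using Fnz by (simp add: FF_def)
  \<comment> \<open>The normalization \<open>k2\<close> and the product of the factors' highest
    weights describe the same eigenvalue of \<open>L\<^sub>2\<^sub>2\<close> on
    \<open>\<zeta>\<close>. Comparing them off the zeros of theta forces the given twist to be the
    product of the factors' twists.\<close>
  have fF: "f u = FF u" for u
  proof -
    have "f u - FF u = 0"
    proof (rule eventually_zero_entire[of "\<lambda>u. f u - FF u" u])
      show "(\<lambda>u. f u - FF u) holomorphic_on UNIV"
        unfolding FF_def by (intro holomorphic_intros fh Fh)
      have e: "\<forall>\<^sub>F u in at u. \<forall>i\<in>{1..n}. \<theta> (u + (\<beta> i - s i)) \<noteq> 0"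
        by (rule eventually_ball_finite) (auto intro: eventually_theta_nz)
      have a: "u + (\<beta> i - s i) = \<beta> i + u - s i" for u i by simp
      show "\<forall>\<^sub>F u in at u. f u - FF u = 0"
        using e unfolding a
      proof (rule eventually_mono)
        fix u assume "\<forall>i\<in>{1..n}. \<theta> (\<beta> i + u - s i) \<noteq> 0"
        then have nz: "(\<Prod>i=1..n. \<theta> (\<beta> i + u - s i)) \<noteq> 0" by simp
        have "sc (const (f u * ((\<Prod>i=1..n. \<theta> (\<beta> i + u - s i)) / FF u))) \<zeta> =
            sc (const (\<Prod>i=1..n. \<theta> (\<beta> i + u - s i))) \<zeta>"
          using k2[of u] by (simp add: L_def Ltw_def z(5) const_mult[symmetric] prod_dividef FF_def)
        then have "const (f u * ((\<Prod>i=1..n. \<theta> (\<beta> i + u - s i)) / FF u)) = const (\<Prod>i=1..n. \<theta> (\<beta> i + u - s i))"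
          by (rule scale_right_imp_eq[OF z(2)])
        then have "f u * ((\<Prod>i=1..n. \<theta> (\<beta> i + u - s i)) / FF u) = (\<Prod>i=1..n. \<theta> (\<beta> i + u - s i))"
          by (simp only: const_eq_iff)
        then show "f u - FF u = 0" using nz FF[of u] by (simp add: field_simps)
      qed
    qed
    then show ?thesis by simp
  qed
  \<comment> \<open>A zero of theta means that the ratio of two string points is an integral power
    of \<open>p\<close>, which is what \<open>separated_strings\<close> forbids.\<close>
  have q_ratio: "\<theta> ((\<beta> i + of_nat r - s i) - (\<beta> j + of_nat t - s j)) \<noteq> 0"
    if ij: "i \<in> {1..n}" "j \<in> {1..n}" "i \<noteq> j" "r \<le> l i" "t < l j" for i j r t
  proof
    assume "\<theta> ((\<beta> i + of_nat r - s i) - (\<beta> j + of_nat t - s j)) = 0"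
    then obtain m :: int where m: "q powr (2 * ((\<beta> i + of_nat r - s i) - (\<beta> j + of_nat t - s j))) = p powi m"
      unfolding theta_eq_0_iff by blast
    have pt: "q powr (- 2 * (\<beta> i + of_nat r)) * a i = q powr (2 * (s i - (\<beta> i + of_nat r)))"
      if "i \<in> {1..n}" for i r
      unfolding conjunct2[OF a[OF that], symmetric] powr_add[symmetric] by (simp add: algebra_simps)
    have "q powr (2 * (s j - (\<beta> j + of_nat t))) = p powi m * q powr (2 * (s i - (\<beta> i + of_nat r)))"
      unfolding m[symmetric] powr_add[symmetric] by (simp add: algebra_simps)
    then have "q powr (2 * (s i - (\<beta> i + of_nat r))) = p powi (- m) * q powr (2 * (s j - (\<beta> j + of_nat t)))"
      using p_nz by (simp add: power_int_minus)
    then show False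
      using sep ij unfolding separated_strings_def pt[OF ij(1), symmetric] pt[OF ij(2), symmetric] by blast
  qed
  interpret rll_operators q p sc "rep_space T" "actPh T" L
    unfolding L_def by (rule T.rll_operators_Ltw[OF fh])
  interpret gelfand_tsetlin q p sc "rep_space T" "actPh T" L n s \<alpha> \<beta> l \<zeta> S
  proof
    show "\<zeta> \<in> rep_space T" "\<zeta> \<noteq> 0" by (fact z(1), fact z(2))
    show "finite S" "rep_space T \<subseteq> span S" "card S \<le> (\<Prod>i=1..n. l i + 1)" by (fact S)+
    show "L 2 1 u \<zeta> = 0" for u by (simp add: L_def Ltw_def z(3))
    show "L 1 1 u \<zeta> = sc (const (\<Prod>i=1..n. \<theta> (\<alpha> i + u - s i))) \<zeta>" for u
      using FF[of u] by (simp add: L_def Ltw_def z(4) const_mult[symmetric] prod_dividef fF FF_def[symmetric])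
    show "L 2 2 u \<zeta> = sc (const (\<Prod>i=1..n. \<theta> (\<beta> i + u - s i))) \<zeta>" for u
      by (rule k2)
    show "\<alpha> i = \<beta> i + of_nat (l i)" if "i \<in> {1..n}" for i using lc[OF that] by simp
    show "\<theta> ((\<beta> i + of_nat r - s i) - (\<beta> j + of_nat t - s j)) \<noteq> 0"
      if "i \<in> {1..n}" "j \<in> {1..n}" "i \<noteq> j" "r \<le> l i" "t < l j" for i j r t
      by (rule q_ratio[OF that])
    fix i j :: nat and x
    assume ij: "i \<in> {1,2}" "j \<in> {1,2}" and x: "x \<in> rep_space T"
    obtain Y where Y: "analytic_family sc (rep_space T) Y"
      "\<And>u. cur T i j (q powr (2 * u)) x = sc (const (\<Prod>i=1..n. if l i = 0 then \<theta> (\<beta> i + u - s i) else 1)) (Y u)"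
      using z(7)[OF ij x] by auto
    have "analytic_family sc (rep_space T) (\<lambda>u. sc (const (f u)) (Y u))"
      by (intro analytic_family_scale Y entire_family_const fh)
    moreover have "L i j u x = sc (const (\<Prod>i=1..n. if l i = 0 then \<theta> (\<beta> i + u - s i) else 1)) (sc (const (f u)) (Y u))" for u
      unfolding L_def Ltw_def Y(2) scale_scale by (simp only: mult.commute)
    ultimately show "\<exists>Y. analytic_family sc (rep_space T) Y \<and>
        (\<forall>u. L i j u x = sc (const (\<Prod>i=1..n. if l i = 0 then \<theta> (\<beta> i + u - s i) else 1)) (Y u))"
      by blast
  qed
  show ?thesis
    unfolding \<xi>_def L_def[symmetric]
    using basis_family_xi A1_xi A2_xi B2_xi C2_xi by blast
qed

end
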